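(* For each of the following four cases there exists an unbounded maximal dissipative operator $T$ (in an infinite-dimensional separable complex Hilbert space), with a boundary pair $\{\mathcal E,\Gamma\}$, such that the symmetric operators $\mathcal T_z$, $z\in\mathbb C_+$, in $\mathcal H\oplus\mathcal E$ given by $$\mathrm{dom}\,\mathcal T_z=\left\{\begin{bmatrix}f\\-\frac{\Gamma f}{\sqrt{\mathrm{Im}\,z}}\end{bmatrix}: f\in\mathrm{dom}\,T\right\},\qquad \mathcal T_z\begin{bmatrix}f\\-\frac{\Gamma f}{\sqrt{\mathrm{Im}\,z}}\end{bmatrix}=\begin{bmatrix}Tf\\-\frac{\bar z\,\Gamma f}{\sqrt{\mathrm{Im}\,z}}\end{bmatrix}$$ are densely defined and the condition of the case holds: (I) $\mathrm{dom}\,\mathcal T_z^2$ is dense and is a core of $\mathcal T_z$ for at least one (then for all) $z\in\mathbb C_+$; (II) $\mathrm{dom}\,\mathcal T_z^2$ is dense but is not a core of $\mathcal T_z$ for at least one (then for all) $z\in\mathbb C_+$; (III) $\mathrm{dom}\,\mathcal T_z^2\neq\{0\}$ and is non-dense for at least one (then for all) $z\in\mathbb C_+$; (IV) $\mathrm{dom}\,\mathcal T_z^2=\{0\}$ for at least one (then for all) $z\in\mathbb C_+$. Moreover, for each $\alpha\in(0,\pi/2)$ it is possible (in each case) to choose $T$ such that the symmetric operator $\mathcal T_z$ is nonnegative for all $z$ with $\arg z\in(0,\pi-\alpha)$.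
   Context: $\mathbb C_+=\{z\in\mathbb C:\mathrm{Im}\,z>0\}$. A linear operator $T$ in a complex Hilbert space $\mathcal H$ is dissipative if $\mathrm{Im}(Tf,f)\ge 0$ for all $f\in\mathrm{dom}\,T$, and maximal dissipative if it is dissipative and has no proper dissipative (operator) extension in $\mathcal H$. A maximal dissipative operator is closed and densely defined, and its resolvent set contains the open lower half-plane. A boundary pair $\{\mathcal E,\Gamma\}$ of a maximal dissipative operator $T$ consists of a Hilbert space $\mathcal E$ and a linear operator $\Gamma:\mathrm{dom}\,T\to\mathcal E$ with range dense in $\mathcal E$ such that $(Tf,g)-(f,Tg)=2i(\Gamma f,\Gamma g)_{\mathcal E}$ for all $f,g\in\mathrm{dom}\,T$. The operators $\mathcal T_z$ are then closed and symmetric. A symmetric operator $\mathcal T$ is nonnegative if $(\mathcal Tu,u)\ge0$ for all $u\in\mathrm{dom}\,\mathcal T$. $\mathrm{dom}\,\mathcal T^2=\{u\in\mathrm{dom}\,\mathcal T:\mathcal Tu\in\mathrm{dom}\,\mathcal T\}$. A core of a closed operator is a linear manifold in its domain that is dense in the domain with respect to the graph norm. "At least one (then for all)" means that the property for some $z\in\mathbb C_+$ holds if and only if it holds for all $z\in\mathbb C_+$. *)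

theory Defs
  imports "HOL-Analysis.Analysis" "HOL-Library.Function_Algebras"
begin

section \<open>Complex vector spaces\<close>

class scaleC =
  fixes scaleC :: "complex \<Rightarrow> 'a \<Rightarrow> 'a"  (infixr \<open>*\<^sub>C\<close> 75)

class complex_vector = ab_group_add + scaleC +
  assumes scaleC_add_right: "a *\<^sub>C (x + y) = a *\<^sub>C x + a *\<^sub>C y"
    and scaleC_add_left: "(a + b) *\<^sub>C x = a *\<^sub>C x + b *\<^sub>C x"
    and scaleC_scaleC: "a *\<^sub>C (b *\<^sub>C x) = (a * b) *\<^sub>C x"
    and scaleC_one: "1 *\<^sub>C x = x"

global_interpretation complex_vector: vector_space "scaleC :: complex \<Rightarrow> 'a \<Rightarrow> 'a::complex_vector"
  by unfold_locales (rule scaleC_add_right scaleC_add_left scaleC_scaleC scaleC_one)+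

instantiation complex :: complex_vector
begin
definition scaleC_complex :: "complex \<Rightarrow> complex \<Rightarrow> complex" where
  "a *\<^sub>C x = a * (x::complex)"
instance
  by standard (auto simp: scaleC_complex_def algebra_simps)
end

instantiation "fun" :: (type, complex_vector) complex_vector
begin
definition scaleC_fun :: "complex \<Rightarrow> ('a \<Rightarrow> 'b) \<Rightarrow> 'a \<Rightarrow> 'b" where
  "a *\<^sub>C f = (\<lambda>i. a *\<^sub>C f i)"
instance
  by standard (auto simp: scaleC_fun_def fun_eq_iff scaleC_add_right scaleC_add_left
      scaleC_scaleC scaleC_one)
end

instantiation prod :: (complex_vector, complex_vector) complex_vector
begin
definition scaleC_prod :: "complex \<Rightarrow> 'a \<times> 'b \<Rightarrow> 'a \<times> 'b" where
  "a *\<^sub>C p = (a *\<^sub>C fst p, a *\<^sub>C snd p)"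
instance
  by standard (auto simp: scaleC_prod_def scaleC_add_right scaleC_add_left scaleC_scaleC scaleC_one)
end


section \<open>Hilbert spaces\<close>

text \<open>
  A complex inner product space is a linear subspace \<open>carr H\<close> of an ambient complex vector space
  together with an inner product \<open>ip H\<close> on it, linear in the \<^emph>\<open>first\<close> argument.  Spaces are values
  rather than types so that they can be existentially quantified.  Only the linear operations are
  taken from the ambient type; any topology or inner product it may carry is irrelevant.
\<close>

record 'a ip_space =
  carr :: "'a set"
  ip :: "'a \<Rightarrow> 'a \<Rightarrow> complex"

definition inner_product_space :: "'a::complex_vector ip_space \<Rightarrow> bool" where
  "inner_product_space H \<longleftrightarrow>
     complex_vector.subspace (carr H) \<and>
     (\<forall>f\<in>carr H. \<forall>g\<in>carr H. \<forall>h\<in>carr H. ip H (f + g) h = ip H f h + ip H g h) \<and>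
     (\<forall>c. \<forall>f\<in>carr H. \<forall>g\<in>carr H. ip H (c *\<^sub>C f) g = c * ip H f g) \<and>
     (\<forall>f\<in>carr H. \<forall>g\<in>carr H. ip H g f = cnj (ip H f g)) \<and>
     (\<forall>f\<in>carr H. 0 \<le> Re (ip H f f)) \<and>
     (\<forall>f\<in>carr H. ip H f f = 0 \<longrightarrow> f = 0)"

definition ip_norm :: "'a::complex_vector ip_space \<Rightarrow> 'a \<Rightarrow> real" where
  "ip_norm H f = sqrt (Re (ip H f f))"

text \<open>
  The value off the carrier is irrelevant; it is fixed only because \<^locale>\<open>Metric_space\<close> requires
  symmetry and nonnegativity of the distance on the whole type.
\<close>

definition ip_dist :: "'a::complex_vector ip_space \<Rightarrow> 'a \<Rightarrow> 'a \<Rightarrow> real" where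
  "ip_dist H f g = (if f \<in> carr H \<and> g \<in> carr H then ip_norm H (f - g) else 0)"

definition ip_topology :: "'a::complex_vector ip_space \<Rightarrow> 'a topology" where
  "ip_topology H = Metric_space.mtopology (carr H) (ip_dist H)"

definition hilbert_space :: "'a::complex_vector ip_space \<Rightarrow> bool" where
  "hilbert_space H \<longleftrightarrow>
     inner_product_space H \<and> Metric_space.mcomplete (carr H) (ip_dist H)"

definition infinite_dimensional :: "'a::complex_vector ip_space \<Rightarrow> bool" where
  "infinite_dimensional H \<longleftrightarrow> \<not> (\<exists>B. finite B \<and> carr H \<subseteq> complex_vector.span B)"

definition dense_in :: "'a::complex_vector ip_space \<Rightarrow> 'a set \<Rightarrow> bool" where
  "dense_in H S \<longleftrightarrow> S \<subseteq> carr H \<and> ip_topology H closure_of S = carr H"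

definition direct_sum ::
    "'a::complex_vector ip_space \<Rightarrow> 'b::complex_vector ip_space \<Rightarrow> ('a \<times> 'b) ip_space"
    (infixr \<open>\<oplus>\<^sub>H\<close> 65) where
  "H \<oplus>\<^sub>H E = \<lparr>carr = carr H \<times> carr E,
              ip = (\<lambda>(f, e) (g, d). ip H f g + ip E e d)\<rparr>"


section \<open>Operators\<close>

text \<open>The values of \<open>app T\<close> outside \<open>opdom T\<close> are meaningless and never used.\<close>

record ('a, 'b) operator =
  opdom :: "'a set"
  app :: "'a \<Rightarrow> 'b"

definition linear_operator ::
    "'a::complex_vector ip_space \<Rightarrow> 'b::complex_vector ip_space \<Rightarrow> ('a, 'b) operator \<Rightarrow> bool" where
  "linear_operator H K T \<longleftrightarrow>
     complex_vector.subspace (opdom T) \<and> opdom T \<subseteq> carr H \<and> app T ` opdom T \<subseteq> carr K \<and>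
     (\<forall>f\<in>opdom T. \<forall>g\<in>opdom T. app T (f + g) = app T f + app T g) \<and>
     (\<forall>c. \<forall>f\<in>opdom T. app T (c *\<^sub>C f) = c *\<^sub>C app T f)"

definition bounded_operator ::
    "'a::complex_vector ip_space \<Rightarrow> 'b::complex_vector ip_space \<Rightarrow> ('a, 'b) operator \<Rightarrow> bool" where
  "bounded_operator H K T \<longleftrightarrow>
     linear_operator H K T \<and> (\<exists>C. \<forall>f\<in>opdom T. ip_norm K (app T f) \<le> C * ip_norm H f)"

definition extends :: "('a, 'b) operator \<Rightarrow> ('a, 'b) operator \<Rightarrow> bool" where
  "extends S T \<longleftrightarrow> opdom T \<subseteq> opdom S \<and> (\<forall>f\<in>opdom T. app S f = app T f)"

definition dissipative :: "'a::complex_vector ip_space \<Rightarrow> ('a, 'a) operator \<Rightarrow> bool" where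
  "dissipative H T \<longleftrightarrow> linear_operator H H T \<and> (\<forall>f\<in>opdom T. 0 \<le> Im (ip H (app T f) f))"

definition maximal_dissipative :: "'a::complex_vector ip_space \<Rightarrow> ('a, 'a) operator \<Rightarrow> bool" where
  "maximal_dissipative H T \<longleftrightarrow>
     dissipative H T \<and> (\<forall>S. dissipative H S \<and> extends S T \<longrightarrow> opdom S = opdom T)"

definition symmetric_operator :: "'a::complex_vector ip_space \<Rightarrow> ('a, 'a) operator \<Rightarrow> bool" where
  "symmetric_operator H S \<longleftrightarrow>
     linear_operator H H S \<and>
     (\<forall>u\<in>opdom S. \<forall>v\<in>opdom S. ip H (app S u) v = ip H u (app S v))"

definition nonnegative_operator :: "'a::complex_vector ip_space \<Rightarrow> ('a, 'a) operator \<Rightarrow> bool" where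
  "nonnegative_operator H S \<longleftrightarrow>
     symmetric_operator H S \<and> (\<forall>u\<in>opdom S. ip H (app S u) u \<in> \<real>\<^sub>\<ge>\<^sub>0)"

definition opdom_square :: "('a, 'a) operator \<Rightarrow> 'a set" where
  "opdom_square S = {u \<in> opdom S. app S u \<in> opdom S}"

definition graph_space ::
    "'a::complex_vector ip_space \<Rightarrow> 'b::complex_vector ip_space \<Rightarrow> ('a, 'b) operator \<Rightarrow> 'a ip_space"
where
  "graph_space H K T =
     \<lparr>carr = opdom T, ip = (\<lambda>f g. ip H f g + ip K (app T f) (app T g))\<rparr>"

definition is_core ::
    "'a::complex_vector ip_space \<Rightarrow> 'b::complex_vector ip_space \<Rightarrow> ('a, 'b) operator \<Rightarrow> 'a set \<Rightarrow> bool"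
where
  "is_core H K T D \<longleftrightarrow>
     complex_vector.subspace D \<and> D \<subseteq> opdom T \<and> dense_in (graph_space H K T) D"


section \<open>Boundary pairs and the associated symmetric operators\<close>

definition boundary_pair ::
    "'a::complex_vector ip_space \<Rightarrow> ('a, 'a) operator \<Rightarrow>
     'b::complex_vector ip_space \<Rightarrow> ('a, 'b) operator \<Rightarrow> bool" where
  "boundary_pair H T E \<Gamma> \<longleftrightarrow>
     hilbert_space E \<and> linear_operator H E \<Gamma> \<and> opdom \<Gamma> = opdom T \<and>
     dense_in E (app \<Gamma> ` opdom T) \<and>
     (\<forall>f\<in>opdom T. \<forall>g\<in>opdom T.
        ip H (app T f) g - ip H f (app T g) = 2 * \<i> * ip E (app \<Gamma> f) (app \<Gamma> g))"

text \<open>On \<open>opdom\<close> the second component is determined by the first, so \<open>app\<close> can ignore it.\<close>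

definition assoc_op ::
    "('a, 'a) operator \<Rightarrow> ('a, 'b::complex_vector) operator \<Rightarrow> complex \<Rightarrow> ('a \<times> 'b, 'a \<times> 'b) operator"
where
  "assoc_op T \<Gamma> z =
     \<lparr>opdom = (\<lambda>f. (f, - ((1 / complex_of_real (sqrt (Im z))) *\<^sub>C app \<Gamma> f))) ` opdom T,
      app = (\<lambda>(f, e). (app T f, - ((cnj z / complex_of_real (sqrt (Im z))) *\<^sub>C app \<Gamma> f)))\<rparr>"

definition upper_half_plane :: "complex set"  (\<open>\<complex>\<^sub>+\<close>) where
  "\<complex>\<^sub>+ = {z. 0 < Im z}"

definition admissible ::
    "'a::complex_vector ip_space \<Rightarrow> ('a, 'a) operator \<Rightarrow>
     'b::complex_vector ip_space \<Rightarrow> ('a, 'b) operator \<Rightarrow> bool" where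
  "admissible H T E \<Gamma> \<longleftrightarrow>
     hilbert_space H \<and> infinite_dimensional H \<and> separable_space (ip_topology H) \<and>
     maximal_dissipative H T \<and> \<not> bounded_operator H H T \<and>
     boundary_pair H T E \<Gamma> \<and>
     (\<forall>z\<in>\<complex>\<^sub>+. symmetric_operator (H \<oplus>\<^sub>H E) (assoc_op T \<Gamma> z) \<and>
               dense_in (H \<oplus>\<^sub>H E) (opdom (assoc_op T \<Gamma> z)))"

definition case_I :: "'a::complex_vector ip_space \<Rightarrow> ('a, 'a) operator \<Rightarrow> bool" where
  "case_I K S \<longleftrightarrow> dense_in K (opdom_square S) \<and> is_core K K S (opdom_square S)"

definition case_II :: "'a::complex_vector ip_space \<Rightarrow> ('a, 'a) operator \<Rightarrow> bool" where
  "case_II K S \<longleftrightarrow> dense_in K (opdom_square S) \<and> \<not> is_core K K S (opdom_square S)"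

definition case_III :: "'a::complex_vector ip_space \<Rightarrow> ('a, 'a) operator \<Rightarrow> bool" where
  "case_III K S \<longleftrightarrow> opdom_square S \<noteq> {0} \<and> \<not> dense_in K (opdom_square S)"

definition case_IV :: "'a::complex_vector ip_space \<Rightarrow> ('a, 'a) operator \<Rightarrow> bool" where
  "case_IV K S \<longleftrightarrow> opdom_square S = {0}"

end

theory Submission
  imports Defs
begin

text \<open>
  All examples come from one construction on \<open>\<H> = \<E> = \<ell>\<^sup>2\<close>.  Take an injective diagonal operator \<open>R\<close>
  with entries tending to \<open>0\<close> and a bounded operator \<open>K\<close> with adjoint \<open>K'\<close>, and let the sesquilinear form
  \<open>(g, g') + i (K g, K g')\<close>, where \<open>f = R g\<close> and \<open>f' = R g'\<close>, define an operator:
  \<open>T (R g) = h\<close> whenever \<open>g + i K' K g = R h\<close>, and \<open>\<Gamma> (R g) = K g\<close>.  Then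
  \<open>(T f, f) = \<parallel>g\<parallel>\<^sup>2 + i \<parallel>K g\<parallel>\<^sup>2\<close>, so \<open>T\<close> is dissipative and \<open>\<Gamma>\<close> gives a boundary pair; the
  Lax--Milgram theorem shows that \<open>T - cnj z\<close> maps onto \<open>\<H>\<close>, which gives maximality.  For the lift
  \<open>u\<close> of \<open>f\<close> to the domain of \<open>\<T>\<^sub>z\<close> one gets
  \<open>(\<T>\<^sub>z u, u) = \<parallel>g\<parallel>\<^sup>2 + cot (arg z) \<parallel>K g\<parallel>\<^sup>2\<close>, and \<open>\<parallel>K\<parallel>\<^sup>2 \<le> tan \<alpha>\<close> makes this nonnegative
  for \<open>arg z < \<pi> - \<alpha>\<close>.

  The domain of \<open>\<T>\<^sub>z\<^sup>2\<close> consists of the lifts of those \<open>f\<close> for which \<open>T f - cnj z f\<close> lies in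
  \<open>ker \<Gamma> = {R R h | K R h = 0}\<close>.  Two facts reduce the four cases to the position of
  \<open>ker \<Gamma>\<close>.  The graph norm of \<open>\<T>\<^sub>z\<close> at the lift of \<open>f\<close> is equivalent to the norm of
  \<open>T f - cnj z f\<close>, so the domain of the square is a core exactly when \<open>ker \<Gamma>\<close> is dense
  (\<open>gnorm_le\<close>, \<open>gnorm_ge\<close>).  And if the ranges of \<open>R\<close> and \<open>K'\<close> meet only in \<open>0\<close> and \<open>K'\<close> is
  injective, then the domain of the square is dense as soon as no nonzero vector of the range of
  \<open>R\<close> is orthogonal to \<open>ker \<Gamma>\<close> (\<open>dense_lift\<close>).  Hence the cases occur when
  (I) \<open>(ker \<Gamma>)\<^sup>\<bottom> = 0\<close>; (II) \<open>(ker \<Gamma>)\<^sup>\<bottom>\<close> is nonzero but meets the range of \<open>R\<close> only in \<open>0\<close>;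
  (III) \<open>ker \<Gamma>\<close> is nonzero and contained in a coordinate hyperplane; (IV) \<open>ker \<Gamma> = 0\<close>.

  For (I) and (II) the index set is split into infinitely many infinite blocks, and \<open>K\<close> takes
  differences of weighted sums over consecutive blocks.  A vector orthogonal to \<open>ker \<Gamma>\<close> is then
  determined on each block by a single constant, and the decay of \<open>R\<close> on a block decides whether
  that constant must vanish for a vector of \<open>\<ell>\<^sup>2\<close> or of the range of \<open>R\<close>.  In (IV), \<open>K\<close> is a
  multiple of the symmetric matrix \<open>x\<^sub>m\<^bsup>n+1\<^esup>\<close> with \<open>x\<^sub>m = 2\<^bsup>-(m+1)\<^esup>\<close>, and in (III) its first column is
  replaced by \<open>0\<close>.  Then \<open>K g = 0\<close> says that a power series vanishes at a sequence tending to \<open>0\<close>, and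
  by symmetry the same argument shows that no nonzero value of \<open>K'\<close> decays as fast as the vectors in
  the range of \<open>R\<close>.
\<close>

section \<open>Geometry of inner product spaces\<close>

locale inner_product =
  fixes H :: "'a::complex_vector ip_space"
  assumes inner_product_space: "inner_product_space H"
begin

lemma subspace_carr: "complex_vector.subspace (carr H)"
  using inner_product_space by (simp add: inner_product_space_def)

lemma carr_zero [simp]: "0 \<in> carr H"
  and carr_add [simp]: "f \<in> carr H \<Longrightarrow> g \<in> carr H \<Longrightarrow> f + g \<in> carr H"
  and carr_diff [simp]: "f \<in> carr H \<Longrightarrow> g \<in> carr H \<Longrightarrow> f - g \<in> carr H"
  and carr_scale [simp]: "f \<in> carr H \<Longrightarrow> c *\<^sub>C f \<in> carr H"
  using subspace_carr
  by (auto intro: complex_vector.subspace_0 complex_vector.subspace_add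
      complex_vector.subspace_diff complex_vector.subspace_scale)

lemma ip_add_left: "f \<in> carr H \<Longrightarrow> g \<in> carr H \<Longrightarrow> h \<in> carr H \<Longrightarrow> ip H (f + g) h = ip H f h + ip H g h"
  using inner_product_space unfolding inner_product_space_def by metis

lemma ip_scale_left: "f \<in> carr H \<Longrightarrow> g \<in> carr H \<Longrightarrow> ip H (c *\<^sub>C f) g = c * ip H f g"
  using inner_product_space unfolding inner_product_space_def by metis

lemma ip_cnj: "f \<in> carr H \<Longrightarrow> g \<in> carr H \<Longrightarrow> ip H g f = cnj (ip H f g)"
  using inner_product_space unfolding inner_product_space_def by metis

lemma ip_ge_0: "f \<in> carr H \<Longrightarrow> 0 \<le> Re (ip H f f)"
  using inner_product_space unfolding inner_product_space_def by metis

lemma ip_eq_0: "f \<in> carr H \<Longrightarrow> ip H f f = 0 \<Longrightarrow> f = 0"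
  using inner_product_space unfolding inner_product_space_def by metis

lemma ip_add_right: "f \<in> carr H \<Longrightarrow> g \<in> carr H \<Longrightarrow> h \<in> carr H \<Longrightarrow> ip H h (f + g) = ip H h f + ip H h g"
  by (metis carr_add complex_cnj_add ip_add_left ip_cnj)

lemma ip_scale_right: "f \<in> carr H \<Longrightarrow> g \<in> carr H \<Longrightarrow> ip H f (c *\<^sub>C g) = cnj c * ip H f g"
  by (metis carr_scale complex_cnj_mult ip_cnj ip_scale_left)

lemma ip_diff_left:
  assumes "f \<in> carr H" "g \<in> carr H" "h \<in> carr H"
  shows "ip H (f - g) h = ip H f h - ip H g h"
  using ip_add_left[of "f - g" g h] assms by simp

lemma ip_diff_right: "f \<in> carr H \<Longrightarrow> g \<in> carr H \<Longrightarrow> h \<in> carr H \<Longrightarrow> ip H h (f - g) = ip H h f - ip H h g"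
  by (metis carr_diff complex_cnj_diff ip_diff_left ip_cnj)

lemma ip_zero_left [simp]: "f \<in> carr H \<Longrightarrow> ip H 0 f = 0"
  using ip_diff_left[of f f f] by simp

lemma ip_zero_right [simp]: "f \<in> carr H \<Longrightarrow> ip H f 0 = 0"
  using ip_diff_right[of f f f] by simp

lemma Im_ip_self [simp]: "f \<in> carr H \<Longrightarrow> Im (ip H f f) = 0"
  using ip_cnj[of f f] by (simp add: complex_eq_iff)

lemma norm_ge_0 [simp]: "f \<in> carr H \<Longrightarrow> 0 \<le> ip_norm H f"
  by (simp add: ip_norm_def ip_ge_0)

lemma norm_sq: "f \<in> carr H \<Longrightarrow> (ip_norm H f)\<^sup>2 = Re (ip H f f)"
  by (simp add: ip_norm_def ip_ge_0)

lemma ip_self: "f \<in> carr H \<Longrightarrow> ip H f f = complex_of_real ((ip_norm H f)\<^sup>2)"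
  by (simp add: complex_eq_iff norm_sq)

lemma norm_eq_0 [simp]: "f \<in> carr H \<Longrightarrow> ip_norm H f = 0 \<longleftrightarrow> f = 0"
  using ip_eq_0[of f] ip_self[of f] by auto

lemma norm_sq_add:
  assumes "f \<in> carr H" "g \<in> carr H"
  shows "(ip_norm H (f + g))\<^sup>2 = (ip_norm H f)\<^sup>2 + 2 * Re (ip H f g) + (ip_norm H g)\<^sup>2"
proof -
  have "Re (ip H g f) = Re (ip H f g)"
    using ip_cnj[of f g] assms by simp
  then show ?thesis
    using assms by (simp add: norm_sq ip_add_left ip_add_right)
qed

lemma norm_sq_diff:
  assumes "f \<in> carr H" "g \<in> carr H"
  shows "(ip_norm H (f - g))\<^sup>2 = (ip_norm H f)\<^sup>2 - 2 * Re (ip H f g) + (ip_norm H g)\<^sup>2"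
proof -
  have "Re (ip H g f) = Re (ip H f g)"
    using ip_cnj[of f g] assms by simp
  then show ?thesis
    using assms by (simp add: norm_sq ip_diff_left ip_diff_right)
qed

lemma norm_scale: "f \<in> carr H \<Longrightarrow> ip_norm H (c *\<^sub>C f) = cmod c * ip_norm H f"
proof -
  assume f: "f \<in> carr H"
  have "ip H (c *\<^sub>C f) (c *\<^sub>C f) = complex_of_real ((cmod c)\<^sup>2) * ip H f f"
    using f by (simp add: ip_scale_left ip_scale_right complex_norm_square mult_ac del: of_real_power)
  then have "Re (ip H (c *\<^sub>C f) (c *\<^sub>C f)) = (cmod c)\<^sup>2 * Re (ip H f f)"
    by simp
  then show ?thesis
    by (simp add: ip_norm_def real_sqrt_mult)
qed

lemma ip_norm_minus_commute:
  assumes "f \<in> carr H" "g \<in> carr H"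
  shows "ip_norm H (f - g) = ip_norm H (g - f)"
proof -
  have "f - g = (-1) *\<^sub>C (g - f)"
    using complex_vector.scale_minus_left[of 1 "g - f"] by (simp add: scaleC_one)
  then show ?thesis
    using assms norm_scale[of "g - f" "-1"] by simp
qed

lemma Cauchy_Schwarz:
  assumes "f \<in> carr H" "g \<in> carr H"
  shows "cmod (ip H f g) \<le> ip_norm H f * ip_norm H g"
proof (cases "g = 0")
  case True
  then show ?thesis using assms by (simp add: ip_norm_def)
next
  case False
  define G where "G = (ip_norm H g)\<^sup>2"
  have G: "G > 0"
    using False assms by (simp add: G_def)
  define c where "c = ip H f g / complex_of_real G"
  have "0 \<le> (ip_norm H (f - c *\<^sub>C g))\<^sup>2"
    by simp
  also have "\<dots> = (ip_norm H f)\<^sup>2 - 2 * Re (cnj c * ip H f g) + (cmod c)\<^sup>2 * G"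
    using assms by (simp add: norm_sq_diff ip_scale_right norm_scale G_def power_mult_distrib)
  also have "cnj c * ip H f g = complex_of_real ((cmod (ip H f g))\<^sup>2 / G)"
    by (metis (no_types, lifting) c_def complex_cnj_complex_of_real complex_cnj_divide
        complex_norm_square mult.commute of_real_divide times_divide_eq_right)
  also have "(cmod c)\<^sup>2 * G = (cmod (ip H f g))\<^sup>2 / G"
    using G by (simp add: c_def norm_divide power_divide power2_eq_square)
  finally have "(cmod (ip H f g))\<^sup>2 / G \<le> (ip_norm H f)\<^sup>2"
    by simp
  then have "(cmod (ip H f g))\<^sup>2 \<le> (ip_norm H f * ip_norm H g)\<^sup>2"
    using G by (simp add: pos_divide_le_eq power_mult_distrib G_def)
  then show ?thesis
    by (rule power2_le_imp_le) (use assms in simp)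
qed

lemma norm_triangle:
  assumes "f \<in> carr H" "g \<in> carr H"
  shows "ip_norm H (f + g) \<le> ip_norm H f + ip_norm H g"
proof -
  have "Re (ip H f g) \<le> ip_norm H f * ip_norm H g"
    using Cauchy_Schwarz[OF assms] complex_Re_le_cmod[of "ip H f g"] by linarith
  then have "(ip_norm H (f + g))\<^sup>2 \<le> (ip_norm H f + ip_norm H g)\<^sup>2"
    using assms by (simp add: norm_sq_add power2_sum)
  then show ?thesis
    by (rule power2_le_imp_le) (use assms in simp)
qed

sublocale metric: Metric_space "carr H" "ip_dist H"
proof
  fix x y z
  show "0 \<le> ip_dist H x y"
    by (simp add: ip_dist_def)
  show "ip_dist H x y = ip_dist H y x"
    by (simp add: ip_dist_def ip_norm_minus_commute)
  show "x \<in> carr H \<Longrightarrow> y \<in> carr H \<Longrightarrow> (ip_dist H x y = 0) = (x = y)"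
    by (simp add: ip_dist_def)
  show "x \<in> carr H \<Longrightarrow> y \<in> carr H \<Longrightarrow> z \<in> carr H \<Longrightarrow> ip_dist H x z \<le> ip_dist H x y + ip_dist H y z"
    using norm_triangle[of "x - y" "y - z"] by (simp add: ip_dist_def)
qed

lemma dense_in_iff:
  "dense_in H S \<longleftrightarrow> S \<subseteq> carr H \<and> (\<forall>x\<in>carr H. \<forall>e>0. \<exists>s\<in>S. ip_norm H (x - s) < e)"
  unfolding dense_in_def ip_topology_def metric.metric_closure_of
proof -
  have "(s \<in> metric.mball x e) = (s \<in> carr H \<and> x \<in> carr H \<and> ip_norm H (x - s) < e)" for s x e
    by (auto simp: metric.in_mball ip_dist_def)
  then show "(S \<subseteq> carr H \<and> {x \<in> carr H. \<forall>r>0. \<exists>y\<in>S. y \<in> metric.mball x r} = carr H) =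
      (S \<subseteq> carr H \<and> (\<forall>x\<in>carr H. \<forall>e>0. \<exists>s\<in>S. ip_norm H (x - s) < e))"
    by (simp add: set_eq_iff) blast
qed

lemma not_dense_inI:
  assumes v: "v \<in> carr H" "v \<noteq> 0" and orth: "\<And>s. s \<in> S \<Longrightarrow> ip H s v = 0"
  shows "\<not> dense_in H S"
proof
  assume D: "dense_in H S"
  then obtain s where s: "s \<in> S" "ip_norm H (v - s) < ip_norm H v" "s \<in> carr H"
    using v dense_in_iff norm_eq_0 norm_ge_0 by (metis less_eq_real_def subsetD)
  have "ip H v s = 0"
    using orth[OF s(1)] ip_cnj s v by (metis complex_cnj_zero)
  then have "(ip_norm H (v - s))\<^sup>2 = (ip_norm H v)\<^sup>2 + (ip_norm H s)\<^sup>2"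
    using s v by (simp add: norm_sq_diff)
  moreover have "(ip_norm H (v - s))\<^sup>2 < (ip_norm H v)\<^sup>2"
    using s v by (simp add: power_strict_mono)
  ultimately show False
    by (metis add_increasing2 linorder_not_less order_refl zero_le_power2)
qed

text \<open>Parallelogram law, recentred at \<open>x\<close>: two almost nearest points of a subspace are close.\<close>

lemma parallelogram_midpoint:
  assumes "x \<in> carr H" "s \<in> carr H" "t \<in> carr H"
  shows "(ip_norm H (s - t))\<^sup>2 = 2 * (ip_norm H (x - s))\<^sup>2 + 2 * (ip_norm H (x - t))\<^sup>2
           - 4 * (ip_norm H (x - (1/2) *\<^sub>C (s + t)))\<^sup>2"
proof -
  define a b where "a = x - s" and "b = x - t"
  have ab: "a \<in> carr H" "b \<in> carr H"
    using assms by (simp_all add: a_def b_def)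
  have half: "(1/2) *\<^sub>C (y + y) = y" for y :: 'a
  proof -
    have "(1/2) *\<^sub>C (y + y) = (1/2 + 1/2) *\<^sub>C y"
      by (simp only: scaleC_add_right scaleC_add_left)
    then show ?thesis
      by (simp add: scaleC_one)
  qed
  have "x - (1/2) *\<^sub>C (s + t) = (1/2) *\<^sub>C (x + x) - (1/2) *\<^sub>C (s + t)"
    by (simp add: half)
  also have "\<dots> = (1/2) *\<^sub>C ((x + x) - (s + t))"
    by (rule complex_vector.scale_right_diff_distrib[symmetric])
  also have "(x + x) - (s + t) = a + b"
    by (simp add: a_def b_def)
  finally have mid: "4 * (ip_norm H (x - (1/2) *\<^sub>C (s + t)))\<^sup>2 = (ip_norm H (a + b))\<^sup>2"
    using ab by (simp add: norm_scale power_divide norm_divide)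
  have st: "s - t = b - a"
    by (simp add: a_def b_def)
  have "Re (ip H b a) = Re (ip H a b)"
    using ip_cnj[of a b] ab by simp
  then show ?thesis
    unfolding mid using ab by (simp add: a_def[symmetric] b_def[symmetric] st norm_sq_add norm_sq_diff)
qed

end

lemma (in inner_product) hilbert_spaceI:
  assumes "\<And>s :: nat \<Rightarrow> 'a. (\<And>n. s n \<in> carr H) \<Longrightarrow>
      (\<And>e. e > 0 \<Longrightarrow> \<exists>M. \<forall>m\<ge>M. \<forall>n\<ge>M. ip_norm H (s m - s n) < e) \<Longrightarrow>
      \<exists>x\<in>carr H. \<forall>e>0. \<exists>M. \<forall>n\<ge>M. ip_norm H (s n - x) < e"
  shows "hilbert_space H"
  unfolding hilbert_space_def metric.mcomplete_def
proof (intro conjI allI impI inner_product_space)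
  fix s :: "nat \<Rightarrow> 'a"
  assume "metric.MCauchy s"
  then have s: "\<And>n. s n \<in> carr H"
    and "\<And>e. e > 0 \<Longrightarrow> \<exists>M. \<forall>m\<ge>M. \<forall>n\<ge>M. ip_norm H (s m - s n) < e"
    unfolding metric.MCauchy_def ip_dist_def by (auto simp: image_subset_iff)
  then obtain x where "x \<in> carr H" "\<forall>e>0. \<exists>M. \<forall>n\<ge>M. ip_norm H (s n - x) < e"
    using assms[of s] by blast
  then have "limitin metric.mtopology s x sequentially"
    unfolding metric.limit_metric_sequentially using s by (simp add: ip_dist_def)
  then show "\<exists>x. limitin metric.mtopology s x sequentially"
    by blast
qed

locale hilbert = inner_product +
  assumes hilbert_space: "hilbert_space H"
begin

lemma Cauchy_converges:
  assumes s: "\<And>n. s n \<in> carr H"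
    and C: "\<And>e. e > 0 \<Longrightarrow> \<exists>M. \<forall>m\<ge>M. \<forall>n\<ge>M. ip_norm H (s m - s n) < e"
  shows "\<exists>x\<in>carr H. (\<lambda>n. ip_norm H (s n - x)) \<longlonglongrightarrow> 0"
proof -
  have "metric.MCauchy s"
    using s C unfolding metric.MCauchy_def ip_dist_def by (simp add: image_subset_iff)
  then obtain x where x: "limitin metric.mtopology s x sequentially"
    using hilbert_space unfolding hilbert_space_def metric.mcomplete_def by blast
  then have xH: "x \<in> carr H"
    using metric.limitin_mspace by blast
  have "\<forall>e>0. \<exists>M. \<forall>n\<ge>M. ip_norm H (s n - x) < e"
    using x s xH unfolding metric.limit_metric_sequentially ip_dist_def by simp
  then have "(\<lambda>n. ip_norm H (s n - x)) \<longlonglongrightarrow> 0"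
    using s xH by (simp add: LIMSEQ_iff)
  then show ?thesis
    using xH by blast
qed

text \<open>
  The projection theorem in the form used below.  The almost nearest points of \<open>S\<close> to \<open>x\<close> form a
  Cauchy sequence by the parallelogram law; if \<open>y\<close> is its limit, \<open>x - y\<close> is orthogonal to \<open>S\<close>,
  so \<open>x = y\<close> is a limit of points of \<open>S\<close>.
\<close>

theorem dense_in_if_orthogonal_trivial:
  assumes sub: "complex_vector.subspace S" and S: "S \<subseteq> carr H"
    and triv: "\<And>v. v \<in> carr H \<Longrightarrow> (\<And>s. s \<in> S \<Longrightarrow> ip H s v = 0) \<Longrightarrow> v = 0"
  shows "dense_in H S"
  unfolding dense_in_iff
proof (intro conjI ballI allI impI)
  fix x and e :: real
  assume x: "x \<in> carr H" and e: "e > 0"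
  define d where "d = Inf ((\<lambda>s. (ip_norm H (x - s))\<^sup>2) ` S)"
  have S0: "S \<noteq> {}"
    using complex_vector.subspace_0[OF sub] by blast
  have bdd: "bdd_below ((\<lambda>s. (ip_norm H (x - s))\<^sup>2) ` S)"
    by (rule bdd_belowI[of _ 0]) auto
  have d_le: "d \<le> (ip_norm H (x - s))\<^sup>2" if "s \<in> S" for s
    unfolding d_def using bdd that by (intro cInf_lower) auto
  have "\<exists>s\<in>S. (ip_norm H (x - s))\<^sup>2 < d + 1 / real (Suc n)" for n
  proof -
    have "Inf ((\<lambda>s. (ip_norm H (x - s))\<^sup>2) ` S) < d + 1 / real (Suc n)"
      unfolding d_def by simp
    then show ?thesis
      using cInf_lessD[of "(\<lambda>s. (ip_norm H (x - s))\<^sup>2) ` S"] S0 by blast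
  qed
  then obtain s where sS: "\<And>n. s n \<in> S"
    and near: "\<And>n. (ip_norm H (x - s n))\<^sup>2 < d + 1 / real (Suc n)"
    by metis
  have s: "s n \<in> carr H" for n
    using sS S by blast
  have close: "(ip_norm H (s m - s n))\<^sup>2 < 2 / real (Suc m) + 2 / real (Suc n)" for m n
  proof -
    have "(1/2) *\<^sub>C (s m + s n) \<in> S"
      using sS sub by (intro complex_vector.subspace_scale complex_vector.subspace_add) auto
    then have "d \<le> (ip_norm H (x - (1/2) *\<^sub>C (s m + s n)))\<^sup>2"
      by (rule d_le)
    then show ?thesis
      using parallelogram_midpoint[OF x s s, of m n] near[of m] near[of n] by linarith
  qed
  have "\<exists>y\<in>carr H. (\<lambda>n. ip_norm H (s n - y)) \<longlonglongrightarrow> 0"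
  proof (rule Cauchy_converges[OF s])
    fix r :: real
    assume r: "r > 0"
    obtain M where M: "1 / real (Suc M) < r\<^sup>2 / 4"
      using r reals_Archimedean[of "r\<^sup>2 / 4"] by (auto simp: inverse_eq_divide)
    have "ip_norm H (s m - s n) < r" if "m \<ge> M" "n \<ge> M" for m n
    proof -
      have "1 / real (Suc m) \<le> 1 / real (Suc M)" "1 / real (Suc n) \<le> 1 / real (Suc M)"
        using that by (simp_all add: frac_le)
      then have "(ip_norm H (s m - s n))\<^sup>2 < r\<^sup>2"
        using close[of m n] M by linarith
      then show ?thesis
        using r by (simp add: power2_less_imp_less)
    qed
    then show "\<exists>M. \<forall>m\<ge>M. \<forall>n\<ge>M. ip_norm H (s m - s n) < r"
      by blast
  qed
  then obtain y where y: "y \<in> carr H" and lim: "(\<lambda>n. ip_norm H (s n - y)) \<longlonglongrightarrow> 0"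
    by blast
  have "ip H (x - y) t = 0" if t: "t \<in> S" for t
  proof -
    have tH: "t \<in> carr H"
      using t S by blast
    define a where "a = ip H (x - y) t"
    \<comment> \<open>Moving from \<open>s n\<close> by \<open>c t\<close> cannot shorten the distance to \<open>x\<close> by more than \<open>1 / (n + 1)\<close>; this step
      size makes the quadratic gain strictly smaller than the linear one unless \<open>a = 0\<close>.\<close>
    define \<tau> where "\<tau> = 1 / ((ip_norm H t)\<^sup>2 + 1)"
    have pos: "(ip_norm H t)\<^sup>2 + 1 > 0"
      by (simp add: add_nonneg_pos)
    define c where "c = complex_of_real \<tau> * a"
    have c: "(cmod c)\<^sup>2 = \<tau>\<^sup>2 * (cmod a)\<^sup>2"
      by (simp add: c_def norm_mult power_mult_distrib)
    have ip_lim: "(\<lambda>n. ip H (x - s n) t) \<longlonglongrightarrow> a"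
    proof -
      have "cmod (ip H (x - s n) t - a) \<le> ip_norm H (s n - y) * ip_norm H t" for n
      proof -
        have "a - ip H (x - s n) t = ip H (s n - y) t"
          using x y s tH by (simp add: a_def ip_diff_left)
        then have "cmod (a - ip H (x - s n) t) \<le> ip_norm H (s n - y) * ip_norm H t"
          using Cauchy_Schwarz[of "s n - y" t] s y tH by simp
        then show ?thesis
          by (simp add: norm_minus_commute)
      qed
      moreover have "(\<lambda>n. ip_norm H (s n - y) * ip_norm H t) \<longlonglongrightarrow> 0"
        using lim by (intro tendsto_mult_left_zero)
      ultimately have "(\<lambda>n. ip H (x - s n) t - a) \<longlonglongrightarrow> 0"
        by (rule Lim_null_comparison[OF always_eventually[OF allI]])
      then show ?thesis
        by (simp add: LIM_zero_iff)
    qed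
    have "- (1 / real (Suc n)) \<le> - 2 * Re (cnj c * ip H (x - s n) t) + (cmod c)\<^sup>2 * (ip_norm H t)\<^sup>2" for n
    proof -
      have "s n + c *\<^sub>C t \<in> S"
        using sS t sub by (intro complex_vector.subspace_scale complex_vector.subspace_add) auto
      then have "d \<le> (ip_norm H (x - (s n + c *\<^sub>C t)))\<^sup>2"
        by (rule d_le)
      also have "x - (s n + c *\<^sub>C t) = (x - s n) - c *\<^sub>C t"
        by simp
      also have "(ip_norm H ((x - s n) - c *\<^sub>C t))\<^sup>2 =
          (ip_norm H (x - s n))\<^sup>2 - 2 * Re (cnj c * ip H (x - s n) t) + (cmod c)\<^sup>2 * (ip_norm H t)\<^sup>2"
        using x s tH by (subst norm_sq_diff) (simp_all add: ip_scale_right norm_scale power_mult_distrib)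
      finally show ?thesis
        using near[of n] by linarith
    qed
    then have "0 \<le> - 2 * Re (cnj c * a) + (cmod c)\<^sup>2 * (ip_norm H t)\<^sup>2"
    proof (intro LIMSEQ_le[of "\<lambda>n. - (1 / real (Suc n))" _
          "\<lambda>n. - 2 * Re (cnj c * ip H (x - s n) t) + (cmod c)\<^sup>2 * (ip_norm H t)\<^sup>2"])
      show "(\<lambda>n. - (1 / real (Suc n))) \<longlonglongrightarrow> 0"
        using LIMSEQ_inverse_real_of_nat tendsto_minus[of "\<lambda>n. inverse (real (Suc n))" 0]
        by (simp add: inverse_eq_divide)
      show "(\<lambda>n. - 2 * Re (cnj c * ip H (x - s n) t) + (cmod c)\<^sup>2 * (ip_norm H t)\<^sup>2)
          \<longlonglongrightarrow> - 2 * Re (cnj c * a) + (cmod c)\<^sup>2 * (ip_norm H t)\<^sup>2"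
        by (intro tendsto_intros ip_lim)
    qed auto
    also have "Re (cnj c * a) = \<tau> * (cmod a)\<^sup>2"
      unfolding cmod_power2 by (simp add: c_def power2_eq_square algebra_simps)
    also have "- 2 * (\<tau> * (cmod a)\<^sup>2) + (cmod c)\<^sup>2 * (ip_norm H t)\<^sup>2
        = - (cmod a)\<^sup>2 * \<tau> * (2 - (ip_norm H t)\<^sup>2 * \<tau>)"
      unfolding c by (simp add: power2_eq_square algebra_simps)
    finally have le: "(cmod a)\<^sup>2 * (\<tau> * (2 - (ip_norm H t)\<^sup>2 * \<tau>)) \<le> 0"
      by (simp add: mult.assoc)
    have "\<tau> > 0" "(ip_norm H t)\<^sup>2 * \<tau> \<le> 1"
      using pos by (simp_all add: \<tau>_def)
    then have "\<tau> * (2 - (ip_norm H t)\<^sup>2 * \<tau>) > 0"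
      by simp
    with le have "(cmod a)\<^sup>2 \<le> 0"
      by (metis mult_le_0_iff not_less)
    then show ?thesis
      by (simp add: a_def)
  qed
  then have "ip H t (x - y) = 0" if "t \<in> S" for t
    using that S x y ip_cnj[of "x - y" t] by auto
  then have "x - y = 0"
    using triv[of "x - y"] carr_diff[OF x y] by blast
  then have "(\<lambda>n. ip_norm H (s n - x)) \<longlonglongrightarrow> 0"
    using lim by simp
  then obtain n where "ip_norm H (s n - x) < e"
    using e s x by (force simp: LIMSEQ_iff)
  then show "\<exists>s\<in>S. ip_norm H (x - s) < e"
    using sS ip_norm_minus_commute[OF x s] by (intro bexI[of _ "s n"]) simp_all
qed (use S in auto)

text \<open>
  The Lax--Milgram theorem: a coercive bounded operator has closed range because it is bounded
  below, and dense range because a vector orthogonal to its own image vanishes.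
\<close>

theorem Lax_Milgram:
  assumes A: "\<And>g. g \<in> carr H \<Longrightarrow> A g \<in> carr H"
    and add: "\<And>f g. f \<in> carr H \<Longrightarrow> g \<in> carr H \<Longrightarrow> A (f + g) = A f + A g"
    and scale: "\<And>a g. g \<in> carr H \<Longrightarrow> A (a *\<^sub>C g) = a *\<^sub>C A g"
    and bounded: "\<And>g. g \<in> carr H \<Longrightarrow> ip_norm H (A g) \<le> C * ip_norm H g"
    and c: "c > 0"
    and coercive: "\<And>g. g \<in> carr H \<Longrightarrow> c * (ip_norm H g)\<^sup>2 \<le> cmod (ip H (A g) g)"
    and b: "b \<in> carr H"
  shows "\<exists>g\<in>carr H. A g = b"
proof -
  have below: "c * ip_norm H g \<le> ip_norm H (A g)" if g: "g \<in> carr H" for g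
  proof (cases "ip_norm H g = 0")
    case False
    then have "ip_norm H g > 0"
      using norm_ge_0[OF g] by simp
    moreover have "c * ip_norm H g * ip_norm H g \<le> ip_norm H (A g) * ip_norm H g"
      using coercive[OF g] Cauchy_Schwarz[OF A[OF g] g] by (simp add: power2_eq_square mult.assoc)
    ultimately show ?thesis
      by simp
  qed (simp add: A[OF g])
  have diff: "A (f - g) = A f - A g" if "f \<in> carr H" "g \<in> carr H" for f g
    using add[of "f - g" g] that by simp
  have "dense_in H (A ` carr H)"
  proof (rule dense_in_if_orthogonal_trivial)
    have "A 0 = 0"
      using diff[of 0 0] by simp
    show "complex_vector.subspace (A ` carr H)"
    proof (rule complex_vector.subspaceI)
      show "0 \<in> A ` carr H"
        using \<open>A 0 = 0\<close> carr_zero by (metis image_eqI)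
      show "x + y \<in> A ` carr H" if "x \<in> A ` carr H" "y \<in> A ` carr H" for x y
        using that add by (auto simp: image_iff) (metis carr_add)
      show "a *\<^sub>C x \<in> A ` carr H" if "x \<in> A ` carr H" for a x
        using that scale by (auto simp: image_iff) (metis carr_scale)
    qed
    show "v = 0" if v: "v \<in> carr H" and o: "\<And>s. s \<in> A ` carr H \<Longrightarrow> ip H s v = 0" for v
    proof -
      have "c * (ip_norm H v)\<^sup>2 \<le> 0"
        using coercive[OF v] o v by auto
      then show ?thesis
        using c v by (simp add: mult_le_0_iff)
    qed
  qed (use A in auto)
  then have "\<exists>g\<in>carr H. ip_norm H (b - A g) < 1 / real (Suc n)" for n
    using b unfolding dense_in_iff by (metis (no_types, lifting) image_iff of_nat_0_less_iff zero_less_Suc zero_less_divide_1_iff)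
  then obtain g where g: "\<And>n. g n \<in> carr H" and near: "\<And>n. ip_norm H (b - A (g n)) < 1 / real (Suc n)"
    by metis
  have gg: "c * ip_norm H (g m - g n) \<le> 1 / real (Suc m) + 1 / real (Suc n)" for m n
  proof -
    have "c * ip_norm H (g m - g n) \<le> ip_norm H (A (g m) - A (g n))"
      using below[of "g m - g n"] g diff by simp
    also have "\<dots> \<le> ip_norm H (A (g m) - b) + ip_norm H (b - A (g n))"
      using norm_triangle[of "A (g m) - b" "b - A (g n)"] g A b by simp
    also have "\<dots> \<le> 1 / real (Suc m) + 1 / real (Suc n)"
      using near[of m] near[of n] ip_norm_minus_commute[OF b A[OF g], of m] by simp
    finally show ?thesis .
  qed
  have "\<exists>h\<in>carr H. (\<lambda>n. ip_norm H (g n - h)) \<longlonglongrightarrow> 0"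
  proof (rule Cauchy_converges[OF g])
    fix r :: real
    assume r: "r > 0"
    obtain M where M: "1 / real (Suc M) < c * r / 2"
      using r c reals_Archimedean[of "c * r / 2"] by (auto simp: inverse_eq_divide)
    have "ip_norm H (g m - g n) < r" if "m \<ge> M" "n \<ge> M" for m n
    proof -
      have "1 / real (Suc m) \<le> 1 / real (Suc M)" "1 / real (Suc n) \<le> 1 / real (Suc M)"
        using that by (simp_all add: frac_le)
      then have "c * ip_norm H (g m - g n) < c * r"
        using gg[of m n] M by linarith
      then show ?thesis
        using c by simp
    qed
    then show "\<exists>M. \<forall>m\<ge>M. \<forall>n\<ge>M. ip_norm H (g m - g n) < r"
      by blast
  qed
  then obtain h where h: "h \<in> carr H" and lim: "(\<lambda>n. ip_norm H (g n - h)) \<longlonglongrightarrow> 0"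
    by blast
  have "ip_norm H (b - A h) \<le> 1 / real (Suc n) + C * ip_norm H (g n - h)" for n
  proof -
    have "ip_norm H (b - A h) \<le> ip_norm H (b - A (g n)) + ip_norm H (A (g n) - A h)"
      using norm_triangle[of "b - A (g n)" "A (g n) - A h"] g h A b by simp
    also have "\<dots> \<le> 1 / real (Suc n) + C * ip_norm H (g n - h)"
      using near[of n] bounded[of "g n - h"] diff g h by (simp add: add_mono)
    finally show ?thesis .
  qed
  moreover have "(\<lambda>n. 1 / real (Suc n) + C * ip_norm H (g n - h)) \<longlonglongrightarrow> 0 + C * 0"
    using LIMSEQ_inverse_real_of_nat by (intro tendsto_add tendsto_mult tendsto_const lim) (simp add: inverse_eq_divide)
  ultimately have "ip_norm H (b - A h) \<le> 0"
    using LIMSEQ_le_const[of "\<lambda>n. 1 / real (Suc n) + C * ip_norm H (g n - h)"] by simp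
  then have "b - A h = 0"
    using norm_eq_0 norm_ge_0 h A b by (metis carr_diff order_antisym)
  then show ?thesis
    using h by auto
qed

end

section \<open>Direct sums, graph spaces and square summable sequences\<close>

lemma inner_product_space_direct_sum:
  assumes "inner_product_space H" "inner_product_space E"
  shows "inner_product_space (H \<oplus>\<^sub>H E)"
proof -
  interpret H: inner_product H by (unfold_locales) (fact assms)
  interpret E: inner_product E by (unfold_locales) (fact assms)
  have scale: "c *\<^sub>C p = (c *\<^sub>C fst p, c *\<^sub>C snd p)" for c and p :: "'a \<times> 'b"
    by (simp add: scaleC_prod_def)
  have sub: "complex_vector.subspace (carr H \<times> carr E)"
    by (rule complex_vector.subspaceI) (auto simp: scale zero_prod_def)
  have nonneg: "0 \<le> Re (ip H f f) + Re (ip E e e)" if "f \<in> carr H" "e \<in> carr E" for f e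
    using that H.ip_ge_0 E.ip_ge_0 by (metis add_nonneg_nonneg)
  have zero: "f = 0 \<and> e = 0"
    if fe: "f \<in> carr H" "e \<in> carr E" and eq: "ip H f f + ip E e e = 0" for f e
  proof -
    have "complex_of_real ((ip_norm H f)\<^sup>2 + (ip_norm E e)\<^sup>2) = 0"
      using eq fe by (simp add: H.ip_self E.ip_self)
    then have "(ip_norm H f)\<^sup>2 + (ip_norm E e)\<^sup>2 = 0"
      using of_real_eq_0_iff by blast
    then show ?thesis
      using fe by (simp add: sum_power2_eq_zero_iff)
  qed
  show ?thesis
    unfolding inner_product_space_def direct_sum_def
    using sub
    by (auto simp: scale H.ip_add_left E.ip_add_left H.ip_scale_left E.ip_scale_left nonneg
        distrib_left zero_prod_def dest: zero intro!: arg_cong2[where f = "(+)"] H.ip_cnj E.ip_cnj)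
qed

lemma carr_direct_sum: "carr (H \<oplus>\<^sub>H E) = carr H \<times> carr E"
  and ip_direct_sum [simp]: "ip (H \<oplus>\<^sub>H E) (f, e) (g, d) = ip H f g + ip E e d"
  by (simp_all add: direct_sum_def)

lemma hilbert_space_direct_sum:
  assumes "hilbert_space H" "hilbert_space E"
  shows "hilbert_space (H \<oplus>\<^sub>H E)"
proof -
  interpret H: hilbert H using assms by unfold_locales (simp_all add: hilbert_space_def)
  interpret E: hilbert E using assms by unfold_locales (simp_all add: hilbert_space_def)
  interpret K: inner_product "H \<oplus>\<^sub>H E"
    by unfold_locales (intro inner_product_space_direct_sum H.inner_product_space E.inner_product_space)
  have norm: "(ip_norm (H \<oplus>\<^sub>H E) p)\<^sup>2 = (ip_norm H (fst p))\<^sup>2 + (ip_norm E (snd p))\<^sup>2"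
    if "p \<in> carr (H \<oplus>\<^sub>H E)" for p
    using that by (cases p) (simp add: K.norm_sq H.norm_sq E.norm_sq carr_direct_sum)
  show ?thesis
  proof (rule K.hilbert_spaceI)
    fix s :: "nat \<Rightarrow> 'a \<times> 'b"
    assume sK: "\<And>n. s n \<in> carr (H \<oplus>\<^sub>H E)"
      and C: "\<And>e. e > 0 \<Longrightarrow> \<exists>M. \<forall>m\<ge>M. \<forall>n\<ge>M. ip_norm (H \<oplus>\<^sub>H E) (s m - s n) < e"
    have sH: "fst (s n) \<in> carr H" and sE: "snd (s n) \<in> carr E" for n
      using sK[of n] by (auto simp: carr_direct_sum)
    have leH: "ip_norm H (fst (s m) - fst (s n)) \<le> ip_norm (H \<oplus>\<^sub>H E) (s m - s n)"
      and leE: "ip_norm E (snd (s m) - snd (s n)) \<le> ip_norm (H \<oplus>\<^sub>H E) (s m - s n)" for m n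
      using norm[of "s m - s n"] K.carr_diff[OF sK sK, of m n]
      by (auto intro: power2_le_imp_le[OF _ K.norm_ge_0])
    obtain x where x: "x \<in> carr H" "(\<lambda>n. ip_norm H (fst (s n) - x)) \<longlonglongrightarrow> 0"
      using H.Cauchy_converges[of "\<lambda>n. fst (s n)"] sH C leH by (meson order_le_less_trans)
    obtain y where y: "y \<in> carr E" "(\<lambda>n. ip_norm E (snd (s n) - y)) \<longlonglongrightarrow> 0"
      using E.Cauchy_converges[of "\<lambda>n. snd (s n)"] sE C leE by (meson order_le_less_trans)
    have xy: "(x, y) \<in> carr (H \<oplus>\<^sub>H E)"
      using x y by (simp add: carr_direct_sum)
    have "(\<lambda>n. (ip_norm H (fst (s n) - x))\<^sup>2 + (ip_norm E (snd (s n) - y))\<^sup>2) \<longlonglongrightarrow> 0\<^sup>2 + 0\<^sup>2"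
      by (intro tendsto_intros x y)
    then have "(\<lambda>n. (ip_norm (H \<oplus>\<^sub>H E) (s n - (x, y)))\<^sup>2) \<longlonglongrightarrow> 0"
      using norm[of "s _ - (x, y)"] sK xy by simp
    then have "(\<lambda>n. ip_norm (H \<oplus>\<^sub>H E) (s n - (x, y))) \<longlonglongrightarrow> 0"
      by simp
    then show "\<exists>x\<in>carr (H \<oplus>\<^sub>H E). \<forall>e>0. \<exists>M. \<forall>n\<ge>M. ip_norm (H \<oplus>\<^sub>H E) (s n - x) < e"
      using xy sK by (intro bexI[of _ "(x, y)"]) (auto simp: LIMSEQ_iff)
  qed
qed

lemma inner_product_space_graph_space:
  assumes "inner_product_space H" "inner_product_space E" "linear_operator H E S"
  shows "inner_product_space (graph_space H E S)"
proof -
  interpret H: inner_product H by unfold_locales (fact assms)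
  interpret E: inner_product E by unfold_locales (fact assms)
  have sub: "complex_vector.subspace (opdom S)"
    and H: "\<And>f. f \<in> opdom S \<Longrightarrow> f \<in> carr H" and E: "\<And>f. f \<in> opdom S \<Longrightarrow> app S f \<in> carr E"
    and add: "\<And>f g. f \<in> opdom S \<Longrightarrow> g \<in> opdom S \<Longrightarrow> app S (f + g) = app S f + app S g"
    and scale: "\<And>c f. f \<in> opdom S \<Longrightarrow> app S (c *\<^sub>C f) = c *\<^sub>C app S f"
    using assms(3) unfolding linear_operator_def by auto
  have cnj: "ip H g f + ip E (app S g) (app S f) = cnj (ip H f g) + cnj (ip E (app S f) (app S g))"
    if "f \<in> opdom S" "g \<in> opdom S" for f g
    using that H.ip_cnj[of f g] E.ip_cnj[of "app S f" "app S g"] H E by simp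
  have nonneg: "0 \<le> Re (ip H f f) + Re (ip E (app S f) (app S f))" if "f \<in> opdom S" for f
    using that H.ip_ge_0 E.ip_ge_0 H E by (metis add_nonneg_nonneg)
  have zero: "f = 0" if f: "f \<in> opdom S" and eq: "ip H f f + ip E (app S f) (app S f) = 0" for f
  proof -
    have "complex_of_real ((ip_norm H f)\<^sup>2 + (ip_norm E (app S f))\<^sup>2) = 0"
      using eq f H E by (simp add: H.ip_self E.ip_self)
    then have "(ip_norm H f)\<^sup>2 + (ip_norm E (app S f))\<^sup>2 = 0"
      using of_real_eq_0_iff by blast
    then show ?thesis
      using f H by (simp add: sum_power2_eq_zero_iff)
  qed
  show ?thesis
    unfolding inner_product_space_def graph_space_def
    by (auto simp: sub H E add scale H.ip_add_left E.ip_add_left H.ip_scale_left E.ip_scale_left nonneg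
        distrib_left intro: cnj dest: zero)
qed

definition ell2 :: "(nat \<Rightarrow> complex) ip_space" where
  "ell2 = \<lparr>carr = {f. summable (\<lambda>n. (cmod (f n))\<^sup>2)}, ip = (\<lambda>f g. \<Sum>n. f n * cnj (g n))\<rparr>"

abbreviation l2 :: "(nat \<Rightarrow> complex) set" where
  "l2 \<equiv> carr ell2"

lemma l2_iff: "f \<in> l2 \<longleftrightarrow> summable (\<lambda>n. (cmod (f n))\<^sup>2)"
  by (simp add: ell2_def)

lemma ip_ell2: "ip ell2 f g = (\<Sum>n. f n * cnj (g n))"
  by (simp add: ell2_def)

lemma scaleC_apply [simp]: "(a *\<^sub>C f) n = a * f n" for f :: "nat \<Rightarrow> complex"
  by (simp add: scaleC_fun_def scaleC_complex_def)

lemma norm_mult_le_sum_squares: "2 * (cmod a * cmod b) \<le> (cmod a)\<^sup>2 + (cmod b)\<^sup>2"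
  using sum_squares_bound[of "cmod a" "cmod b"] by (simp add: mult.assoc)

lemma summable_l2_mult:
  assumes "f \<in> l2" "g \<in> l2"
  shows "summable (\<lambda>n. cmod (f n) * cmod (g n))"
proof (rule summable_comparison_test')
  show "summable (\<lambda>n. (cmod (f n))\<^sup>2 + (cmod (g n))\<^sup>2)"
    using assms by (intro summable_add) (simp_all add: l2_iff)
  show "norm (cmod (f n) * cmod (g n)) \<le> (cmod (f n))\<^sup>2 + (cmod (g n))\<^sup>2" if "0 \<le> n" for n
    using norm_mult_le_sum_squares[of "f n" "g n"] by (simp add: norm_mult) (smt (verit) mult_nonneg_nonneg norm_ge_zero)
qed

lemma summable_ip: "f \<in> l2 \<Longrightarrow> g \<in> l2 \<Longrightarrow> summable (\<lambda>n. f n * cnj (g n))"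
  by (rule summable_norm_cancel) (simp add: norm_mult summable_l2_mult)

lemma l2_add: 
  assumes "f \<in> l2" "g \<in> l2"
  shows "f + g \<in> l2"
  unfolding l2_iff
proof (rule summable_comparison_test')
  show "summable (\<lambda>n. 2 * (cmod (f n))\<^sup>2 + 2 * (cmod (g n))\<^sup>2)"
    using assms by (intro summable_add summable_mult) (simp_all add: l2_iff)
  show "norm ((cmod ((f + g) n))\<^sup>2) \<le> 2 * (cmod (f n))\<^sup>2 + 2 * (cmod (g n))\<^sup>2" if "0 \<le> n" for n
  proof -
    have "(cmod (f n + g n))\<^sup>2 \<le> (cmod (f n) + cmod (g n))\<^sup>2"
      by (intro power_mono norm_triangle_ineq) simp
    then show ?thesis
      using norm_mult_le_sum_squares[of "f n" "g n"] by (simp add: power2_sum)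
  qed
qed

lemma l2_scale: "f \<in> l2 \<Longrightarrow> a *\<^sub>C f \<in> l2"
  by (simp add: l2_iff norm_mult power_mult_distrib summable_mult)

lemma ip_ell2_self: "f \<in> l2 \<Longrightarrow> ip ell2 f f = complex_of_real (\<Sum>n. (cmod (f n))\<^sup>2)"
  unfolding ip_ell2 by (simp add: l2_iff complex_norm_square[symmetric] suminf_of_real del: of_real_power)

lemma inner_product_space_ell2: "inner_product_space ell2"
  unfolding inner_product_space_def
proof (intro conjI ballI allI impI)
  show "complex_vector.subspace l2"
    by (rule complex_vector.subspaceI) (auto simp: l2_add l2_scale, simp add: l2_iff)
  fix f g
  assume f: "f \<in> l2" and g: "g \<in> l2"
  show "ip ell2 (f + g) h = ip ell2 f h + ip ell2 g h" if "h \<in> l2" for h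
    unfolding ip_ell2 using f g that by (simp add: distrib_right suminf_add summable_ip)
  show "ip ell2 (c *\<^sub>C f) g = c * ip ell2 f g" for c
    unfolding ip_ell2 using suminf_mult[OF summable_ip[OF f g], of c] by (simp add: mult.assoc)
  have "(\<lambda>n. cnj (f n * cnj (g n))) sums cnj (\<Sum>n. f n * cnj (g n))"
    using summable_sums[OF summable_ip[OF f g]] by (simp only: sums_cnj)
  then show "ip ell2 g f = cnj (ip ell2 f g)"
    unfolding ip_ell2 by (simp add: sums_iff mult.commute)
next
  fix f
  assume f: "f \<in> l2"
  then have s: "summable (\<lambda>n. (cmod (f n))\<^sup>2)"
    by (simp add: l2_iff)
  show "0 \<le> Re (ip ell2 f f)"
    using suminf_nonneg[OF s] f by (simp add: ip_ell2_self)
  assume "ip ell2 f f = 0"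
  then have "(\<Sum>n. (cmod (f n))\<^sup>2) = 0"
    using f by (simp add: ip_ell2_self del: of_real_eq_0_iff) (metis of_real_eq_0_iff)
  then show "f = 0"
    using suminf_eq_zero_iff[OF s] by (auto simp: fun_eq_iff)
qed

interpretation ell2: inner_product ell2
  by unfold_locales (rule inner_product_space_ell2)

lemma norm_ell2_sq: "f \<in> l2 \<Longrightarrow> (ip_norm ell2 f)\<^sup>2 = (\<Sum>n. (cmod (f n))\<^sup>2)"
  by (simp add: ell2.norm_sq ip_ell2_self)

lemma sum_le_norm_ell2: "f \<in> l2 \<Longrightarrow> (\<Sum>n<N. (cmod (f n))\<^sup>2) \<le> (ip_norm ell2 f)\<^sup>2"
  by (simp add: norm_ell2_sq l2_iff sum_le_suminf)

lemma l2_bounded_by: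
  assumes "\<And>N. (\<Sum>n<N. (cmod (f n))\<^sup>2) \<le> e\<^sup>2" "e \<ge> 0"
  shows "f \<in> l2" "ip_norm ell2 f \<le> e"
proof -
  have s: "summable (\<lambda>n. (cmod (f n))\<^sup>2)"
    using assms by (intro summableI_nonneg_bounded[where x = "e\<^sup>2"]) simp_all
  then show f: "f \<in> l2"
    by (simp add: l2_iff)
  have "(ip_norm ell2 f)\<^sup>2 \<le> e\<^sup>2"
    using suminf_le_const[OF s] assms(1) by (simp add: norm_ell2_sq[OF f])
  then show "ip_norm ell2 f \<le> e"
    using assms(2) by (rule power2_le_imp_le)
qed

lemma norm_coordinate_le: "f \<in> l2 \<Longrightarrow> cmod (f n) \<le> ip_norm ell2 f"
proof (rule power2_le_imp_le)
  assume f: "f \<in> l2"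
  have "(cmod (f n))\<^sup>2 \<le> (\<Sum>i<Suc n. (cmod (f i))\<^sup>2)"
    by (simp add: sum_nonneg)
  then show "(cmod (f n))\<^sup>2 \<le> (ip_norm ell2 f)\<^sup>2"
    using sum_le_norm_ell2[OF f, of "Suc n"] by linarith
qed simp

lemma l2_tendsto_0: 
  assumes "f \<in> l2"
  shows "f \<longlonglongrightarrow> 0"
proof -
  have "(\<lambda>n. (cmod (f n))\<^sup>2) \<longlonglongrightarrow> 0"
    using assms unfolding l2_iff by (rule summable_LIMSEQ_zero)
  then show ?thesis
    by (simp add: tendsto_norm_zero_iff)
qed

lemma hilbert_space_ell2: "hilbert_space ell2"
proof (rule ell2.hilbert_spaceI)
  fix s :: "nat \<Rightarrow> nat \<Rightarrow> complex"
  assume s: "\<And>n. s n \<in> l2"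
    and C: "\<And>e. e > 0 \<Longrightarrow> \<exists>M. \<forall>m\<ge>M. \<forall>n\<ge>M. ip_norm ell2 (s m - s n) < e"
  have "Cauchy (\<lambda>n. s n i)" for i
  proof (rule metric_CauchyI)
    fix e :: real
    assume "e > 0"
    then obtain M where M: "\<And>m n. m \<ge> M \<Longrightarrow> n \<ge> M \<Longrightarrow> ip_norm ell2 (s m - s n) < e"
      using C by blast
    have "dist (s m i) (s n i) < e" if "m \<ge> M" "n \<ge> M" for m n
      using norm_coordinate_le[OF ell2.carr_diff[OF s s], of m n i] M[OF that] by (simp add: dist_norm)
    then show "\<exists>M. \<forall>m\<ge>M. \<forall>n\<ge>M. dist (s m i) (s n i) < e"
      by blast
  qed
  then have "(\<lambda>n. s n i) \<longlonglongrightarrow> lim (\<lambda>n. s n i)" for i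
    by (simp add: Cauchy_convergent_iff convergent_LIMSEQ_iff)
  then obtain x where x: "\<And>i. (\<lambda>n. s n i) \<longlonglongrightarrow> x i"
    by (rule that)
  have lim: "\<exists>M. \<forall>m\<ge>M. s m - x \<in> l2 \<and> ip_norm ell2 (s m - x) \<le> e" if e: "e > 0" for e
  proof -
    obtain M where M: "\<And>m n. m \<ge> M \<Longrightarrow> n \<ge> M \<Longrightarrow> ip_norm ell2 (s m - s n) < e"
      using C[OF e] by blast
    have le: "(\<Sum>i<N. (cmod ((s m - x) i))\<^sup>2) \<le> e\<^sup>2" if m: "m \<ge> M" for m N
    proof (rule LIMSEQ_le_const2)
      show "(\<lambda>n. \<Sum>i<N. (cmod (s m i - s n i))\<^sup>2) \<longlonglongrightarrow> (\<Sum>i<N. (cmod ((s m - x) i))\<^sup>2)"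
        using x by (auto intro!: tendsto_intros)
      have "(\<Sum>i<N. (cmod (s m i - s n i))\<^sup>2) \<le> e\<^sup>2" if "n \<ge> M" for n
        using sum_le_norm_ell2[of "s m - s n" N] M[OF m that] s
        by (simp add: order_trans[OF _ power_mono[of _ e 2]])
      then show "\<exists>K. \<forall>n\<ge>K. (\<Sum>i<N. (cmod (s m i - s n i))\<^sup>2) \<le> e\<^sup>2"
        by blast
    qed
    show ?thesis
      using l2_bounded_by[of "s _ - x" e, OF le] less_imp_le[OF e] by blast
  qed
  obtain M where "s M - x \<in> l2"
    using lim[of 1] by auto
  then have "x \<in> l2"
    using ell2.carr_diff[OF s[of M], of "s M - x"] by simp
  moreover have "\<exists>M. \<forall>n\<ge>M. ip_norm ell2 (s n - x) < e" if "e > 0" for e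
    using lim[of "e/2"] that by fastforce
  ultimately show "\<exists>x\<in>l2. \<forall>e>0. \<exists>M. \<forall>n\<ge>M. ip_norm ell2 (s n - x) < e"
    by blast
qed

interpretation ell2: hilbert ell2
  by unfold_locales (rule hilbert_space_ell2)

lemma l2_minus [simp]: "f \<in> l2 \<Longrightarrow> - f \<in> l2"
  using ell2.carr_diff[of 0 f] by simp

definition unit :: "nat \<Rightarrow> nat \<Rightarrow> complex" where
  "unit j = (\<lambda>n. if n = j then 1 else 0)"

lemma finite_support_l2: 
  assumes "\<And>n. n \<ge> N \<Longrightarrow> f n = 0"
  shows "f \<in> l2"
  unfolding l2_iff by (rule summable_finite[of "{..<N}"]) (use assms in auto)

lemma unit_l2 [simp]: "unit j \<in> l2"
  by (rule finite_support_l2[of "Suc j"]) (auto simp: unit_def)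

lemma norm_unit [simp]: "ip_norm ell2 (unit j) = 1"
proof -
  have "(\<Sum>n. (cmod (unit j n))\<^sup>2) = (\<Sum>n\<in>{j}. (cmod (unit j n))\<^sup>2)"
    by (rule suminf_finite) (auto simp: unit_def)
  then have "(ip_norm ell2 (unit j))\<^sup>2 = 1"
    by (simp add: norm_ell2_sq) (simp add: unit_def)
  then show ?thesis
    using ell2.norm_ge_0[OF unit_l2, of j] by (simp add: power2_eq_1_iff)
qed

lemma ip_unit: "ip ell2 (unit n) w = cnj (w n)"
proof -
  have "ip ell2 (unit n) w = (\<Sum>i\<in>{n}. unit n i * cnj (w i))"
    unfolding ip_ell2 by (rule suminf_finite) (auto simp: unit_def)
  then show ?thesis
    by (simp add: unit_def)
qed

lemma ip_unit_right: "ip ell2 f (unit n) = f n"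
proof -
  have "ip ell2 f (unit n) = (\<Sum>i\<in>{n}. f i * cnj (unit n i))"
    unfolding ip_ell2 by (rule suminf_finite) (auto simp: unit_def)
  then show ?thesis
    by (simp add: unit_def)
qed

lemma infinite_dimensional_ell2: "infinite_dimensional ell2"
  unfolding infinite_dimensional_def
proof
  assume "\<exists>B. finite B \<and> l2 \<subseteq> complex_vector.span B"
  then obtain B where B: "finite B" "l2 \<subseteq> complex_vector.span B"
    by blast
  have "complex_vector.independent (range unit)"
    unfolding complex_vector.dependent_def
  proof clarsimp
    fix j
    assume j: "unit j \<in> complex_vector.span (range unit - {unit j})"
    have "complex_vector.span (range unit - {unit j}) \<subseteq> {f. f j = 0}"
      by (rule complex_vector.span_minimal)
        (auto simp: unit_def fun_eq_iff intro!: complex_vector.subspaceI)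
    with j show False
      by (auto simp: unit_def)
  qed
  moreover have "range unit \<subseteq> complex_vector.span B"
    using B(2) unit_l2 by blast
  ultimately have "finite (range unit)"
    using complex_vector.independent_span_bound[OF B(1)] by blast
  moreover have "inj unit"
    by (rule injI) (metis unit_def zero_neq_one)
  ultimately show False
    using finite_imageD infinite_UNIV_nat by blast
qed

text \<open>Finitely supported sequences with rational real and imaginary parts are dense.\<close>

lemma separable_ell2: "separable_space (ip_topology ell2)"
proof -
  define C where "C = range (\<lambda>(xs :: (rat \<times> rat) list) n.
      if n < length xs then Complex (of_rat (fst (xs ! n))) (of_rat (snd (xs ! n))) else 0)"
  have rational: "\<exists>q. cmod (w - Complex (of_rat (fst q)) (of_rat (snd q))) < d" if d: "d > 0" for w d
  proof -
    obtain a where a: "Re w < of_rat a" "of_rat a < Re w + d/2"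
      using of_rat_dense[of "Re w" "Re w + d/2"] d by auto
    obtain b where b: "Im w < of_rat b" "of_rat b < Im w + d/2"
      using of_rat_dense[of "Im w" "Im w + d/2"] d by auto
    have "cmod (w - Complex (of_rat a) (of_rat b)) < d"
      using a b cmod_le[of "w - Complex (of_rat a) (of_rat b)"] by simp
    then show ?thesis
      by (intro exI[of _ "(a, b)"]) simp
  qed
  have "dense_in ell2 C"
    unfolding ell2.dense_in_iff
  proof (intro conjI ballI allI impI)
    show "C \<subseteq> l2"
      unfolding C_def
    proof clarify
      fix xs :: "(rat \<times> rat) list"
      show "(\<lambda>n. if n < length xs then Complex (of_rat (fst (xs ! n))) (of_rat (snd (xs ! n))) else 0) \<in> l2"
        by (rule finite_support_l2[of "length xs"]) simp
    qed
    fix x and e :: real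
    assume x: "x \<in> l2" and e: "e > 0"
    then have xs: "summable (\<lambda>n. (cmod (x n))\<^sup>2)"
      by (simp add: l2_iff)
    obtain N where "norm (\<Sum>i. (cmod (x (i + N)))\<^sup>2) < e\<^sup>2 / 2"
      using suminf_exist_split[OF _ xs, of "e\<^sup>2 / 2"] e by auto
    then have tail: "(\<Sum>i. (cmod (x (i + N)))\<^sup>2) < e\<^sup>2 / 2"
      by simp
    define d where "d = e / sqrt (2 * (real N + 1))"
    have d: "d > 0" "d\<^sup>2 * real N \<le> e\<^sup>2 / 2"
      using e by (simp_all add: d_def power_divide field_simps)
    obtain q where q: "\<And>n. cmod (x n - Complex (of_rat (fst (q n))) (of_rat (snd (q n)))) < d"
      using choice[of "\<lambda>n q. cmod (x n - Complex (of_rat (fst q)) (of_rat (snd q))) < d"] rational[OF d(1)]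
      by blast
    define y where "y = (\<lambda>n. if n < N then Complex (of_rat (fst (q n))) (of_rat (snd (q n))) else 0)"
    have "y \<in> C"
      unfolding C_def y_def by (rule range_eqI[of _ _ "map q [0..<N]"]) (auto simp: fun_eq_iff)
    have y: "y \<in> l2"
      by (rule finite_support_l2[of N]) (simp add: y_def)
    have s: "summable (\<lambda>n. (cmod ((x - y) n))\<^sup>2)"
      using x y ell2.carr_diff l2_iff by blast
    have sum_d: "(\<Sum>i<N. d\<^sup>2) = d\<^sup>2 * real N"
      by simp
    have "(ip_norm ell2 (x - y))\<^sup>2 = (\<Sum>n. (cmod ((x - y) n))\<^sup>2)"
      using x y by (simp add: norm_ell2_sq)
    also have "\<dots> = (\<Sum>i. (cmod ((x - y) (i + N)))\<^sup>2) + (\<Sum>i<N. (cmod ((x - y) i))\<^sup>2)"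
      by (rule suminf_split_initial_segment[OF s])
    also have "(\<Sum>i. (cmod ((x - y) (i + N)))\<^sup>2) = (\<Sum>i. (cmod (x (i + N)))\<^sup>2)"
      by (simp add: y_def)
    also have "(\<Sum>i<N. (cmod ((x - y) i))\<^sup>2) \<le> (\<Sum>i<N. d\<^sup>2)"
      using q by (intro sum_mono power_mono) (auto simp: y_def less_imp_le)
    finally have "(ip_norm ell2 (x - y))\<^sup>2 < e\<^sup>2"
      using tail d(2) sum_d by linarith
    then have "ip_norm ell2 (x - y) < e"
      by (rule power2_less_imp_less) (use e in simp)
    then show "\<exists>s\<in>C. ip_norm ell2 (x - s) < e"
      using \<open>y \<in> C\<close> by blast
  qed
  moreover have "countable C"
    by (simp add: C_def)
  moreover have "topspace (ip_topology ell2) = l2"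
    by (simp add: ip_topology_def)
  ultimately show ?thesis
    unfolding separable_space_def dense_in_def by metis
qed

section \<open>The operator model\<close>

definition diag :: "(nat \<Rightarrow> real) \<Rightarrow> (nat \<Rightarrow> complex) \<Rightarrow> nat \<Rightarrow> complex" where
  "diag r f = (\<lambda>n. complex_of_real (r n) * f n)"

text \<open>
  The last assumption contains both that \<open>K'\<close> is injective (take \<open>p = 0\<close>) and that the ranges of
  \<open>R\<close> and \<open>K'\<close> meet only in \<open>0\<close>.  Together these make the operators \<open>\<T>\<^sub>z\<close> densely defined.  The bound
  on \<open>r\<close> makes \<open>T\<close> unbounded.
\<close>

locale sectorial_model =
  fixes r :: "nat \<Rightarrow> real" and K K' :: "(nat \<Rightarrow> complex) \<Rightarrow> nat \<Rightarrow> complex" and b :: real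
  assumes r_pos: "\<And>n. 0 < r n" and r_le: "\<And>n. r n \<le> (1/2)^n"
    and K_l2: "\<And>f. f \<in> l2 \<Longrightarrow> K f \<in> l2" and K'_l2: "\<And>f. f \<in> l2 \<Longrightarrow> K' f \<in> l2"
    and K_add: "\<And>f g. f \<in> l2 \<Longrightarrow> g \<in> l2 \<Longrightarrow> K (f + g) = K f + K g"
    and K'_add: "\<And>f g. f \<in> l2 \<Longrightarrow> g \<in> l2 \<Longrightarrow> K' (f + g) = K' f + K' g"
    and K_scale: "\<And>a f. f \<in> l2 \<Longrightarrow> K (a *\<^sub>C f) = a *\<^sub>C K f"
    and K'_scale: "\<And>a f. f \<in> l2 \<Longrightarrow> K' (a *\<^sub>C f) = a *\<^sub>C K' f"
    and K_bound: "\<And>f. f \<in> l2 \<Longrightarrow> ip_norm ell2 (K f) \<le> b * ip_norm ell2 f"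
    and K'_bound: "\<And>f. f \<in> l2 \<Longrightarrow> ip_norm ell2 (K' f) \<le> b * ip_norm ell2 f"
    and adjoint: "\<And>f q. f \<in> l2 \<Longrightarrow> q \<in> l2 \<Longrightarrow> ip ell2 (K f) q = ip ell2 f (K' q)"
    and ranges_disjoint: "\<And>p q. p \<in> l2 \<Longrightarrow> q \<in> l2 \<Longrightarrow> diag r p = K' q \<Longrightarrow> q = 0"
begin

abbreviation norm2 :: "(nat \<Rightarrow> complex) \<Rightarrow> real" where
  "norm2 \<equiv> ip_norm ell2"

abbreviation "R \<equiv> diag r"

abbreviation "Q \<equiv> diag (\<lambda>n. 1 / r n)"

lemma r_le_1: "r n \<le> 1"
  using r_le[of n] power_le_one[of "1/2::real" n] by linarith

lemma R_Q [simp]: "R (Q f) = f" and Q_R [simp]: "Q (R f) = f"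
  using r_pos by (auto simp: diag_def fun_eq_iff less_imp_neq[symmetric])

lemma R_zero [simp]: "R 0 = 0" and Q_zero [simp]: "Q 0 = 0"
  by (simp_all add: diag_def fun_eq_iff)

lemma R_eq_0_iff [simp]: "R f = 0 \<longleftrightarrow> f = 0"
  by (metis Q_R Q_zero R_zero)

lemma R_add: "R (f + g) = R f + R g" and Q_add: "Q (f + g) = Q f + Q g"
  and R_diff: "R (f - g) = R f - R g" and Q_diff: "Q (f - g) = Q f - Q g"
  and R_scale: "R (a *\<^sub>C f) = a *\<^sub>C R f" and Q_scale: "Q (a *\<^sub>C f) = a *\<^sub>C Q f"
  by (simp_all add: diag_def fun_eq_iff algebra_simps add_divide_distrib diff_divide_distrib)

lemma R_sq_sum: "f \<in> l2 \<Longrightarrow> (\<Sum>n<N. (cmod (R f n))\<^sup>2) \<le> (norm2 f)\<^sup>2"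
proof -
  assume f: "f \<in> l2"
  have "(cmod (R f n))\<^sup>2 \<le> (cmod (f n))\<^sup>2" for n
    using r_pos[of n] r_le_1[of n]
    by (auto simp: diag_def norm_mult power_mult_distrib power_le_one intro!: mult_left_le_one_le)
  then have "(\<Sum>n<N. (cmod (R f n))\<^sup>2) \<le> (\<Sum>n<N. (cmod (f n))\<^sup>2)"
    by (intro sum_mono)
  then show ?thesis
    using sum_le_norm_ell2[OF f, of N] by linarith
qed

lemma R_l2 [simp]: "f \<in> l2 \<Longrightarrow> R f \<in> l2"
  using l2_bounded_by(1)[of "R f" "norm2 f", OF R_sq_sum] ell2.norm_ge_0 by blast

lemma R_bound: "f \<in> l2 \<Longrightarrow> norm2 (R f) \<le> norm2 f"
  using l2_bounded_by(2)[of "R f" "norm2 f", OF R_sq_sum] ell2.norm_ge_0 by blast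

lemma R_self_adjoint: "ip ell2 (R f) g = ip ell2 f (R g)"
  by (simp add: ip_ell2 diag_def mult_ac)

lemma K_zero [simp]: "K 0 = 0" and K'_zero [simp]: "K' 0 = 0"
  using K_scale[of 0 0] K'_scale[of 0 0] by simp_all

lemma K_diff: "f \<in> l2 \<Longrightarrow> g \<in> l2 \<Longrightarrow> K (f - g) = K f - K g"
  and K'_diff: "f \<in> l2 \<Longrightarrow> g \<in> l2 \<Longrightarrow> K' (f - g) = K' f - K' g"
  using K_add[of "f - g" g] K'_add[of "f - g" g] by simp_all

declare K_l2 [simp] K'_l2 [simp]

lemma adjoint': "f \<in> l2 \<Longrightarrow> q \<in> l2 \<Longrightarrow> ip ell2 (K' q) f = ip ell2 q (K f)"
  by (metis adjoint ell2.ip_cnj K_l2 K'_l2)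

text \<open>
  The pointwise expression for \<open>T\<close>, meaningful as soon as \<open>Q f\<close> is square summable, where
  \<open>Q\<close> is the inverse of \<open>R\<close>; the domain of \<open>T\<close> is where its value is square summable as well.
\<close>

definition T0 :: "(nat \<Rightarrow> complex) \<Rightarrow> nat \<Rightarrow> complex" where
  "T0 f = Q (Q f + \<i> *\<^sub>C K' (K (Q f)))"

definition T :: "(nat \<Rightarrow> complex, nat \<Rightarrow> complex) operator" where
  "T = \<lparr>opdom = {f. Q f \<in> l2 \<and> T0 f \<in> l2}, app = T0\<rparr>"

definition \<Gamma> :: "(nat \<Rightarrow> complex, nat \<Rightarrow> complex) operator" where
  "\<Gamma> = \<lparr>opdom = opdom T, app = (\<lambda>f. K (Q f))\<rparr>"

lemma dom_Q [simp]: "f \<in> opdom T \<Longrightarrow> Q f \<in> l2"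
  and dom_T0 [simp]: "f \<in> opdom T \<Longrightarrow> T0 f \<in> l2"
  by (simp_all add: T_def)

lemma app_T [simp]: "app T = T0" and app_\<Gamma>: "app \<Gamma> f = K (Q f)" and opdom_\<Gamma> [simp]: "opdom \<Gamma> = opdom T"
  by (simp_all only: T_def \<Gamma>_def operator.simps)

lemma dom_l2 [simp]: "f \<in> opdom T \<Longrightarrow> f \<in> l2"
  by (metis R_Q R_l2 dom_Q)

lemma dom_\<Gamma> [simp]: "f \<in> opdom T \<Longrightarrow> app \<Gamma> f \<in> l2"
  by (simp add: app_\<Gamma>)

lemma R_T0: "R (T0 f) = Q f + \<i> *\<^sub>C K' (K (Q f))"
  by (simp add: T0_def)

lemma domI:
  assumes "g \<in> l2" "h \<in> l2" "g + \<i> *\<^sub>C K' (K g) = R h"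
  shows "R g \<in> opdom T" "T0 (R g) = h"
  using assms unfolding T_def by (simp_all add: T0_def)

lemma T0_add: "f \<in> opdom T \<Longrightarrow> g \<in> opdom T \<Longrightarrow> T0 (f + g) = T0 f + T0 g"
  by (simp add: T0_def Q_add K_add K'_add scaleC_add_right)

lemma T0_scale: "f \<in> opdom T \<Longrightarrow> T0 (a *\<^sub>C f) = a *\<^sub>C T0 f"
  by (simp add: T0_def Q_scale K_scale K'_scale Q_add scaleC_add_right scaleC_scaleC mult.commute)

lemma \<Gamma>_add: "f \<in> opdom T \<Longrightarrow> g \<in> opdom T \<Longrightarrow> app \<Gamma> (f + g) = app \<Gamma> f + app \<Gamma> g"
  by (simp add: app_\<Gamma> Q_add K_add)

lemma \<Gamma>_scale: "f \<in> opdom T \<Longrightarrow> app \<Gamma> (a *\<^sub>C f) = a *\<^sub>C app \<Gamma> f"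
  by (simp add: app_\<Gamma> Q_scale K_scale)

lemma dom_subspace: "complex_vector.subspace (opdom T)"
proof (rule complex_vector.subspaceI)
  show "0 \<in> opdom T"
    using domI(1)[of 0 0] by simp
  show "f + g \<in> opdom T" if "f \<in> opdom T" "g \<in> opdom T" for f g
    using that T0_add[OF that] unfolding T_def by (simp add: Q_add)
  show "a *\<^sub>C f \<in> opdom T" if "f \<in> opdom T" for a f
    using that T0_scale[OF that] unfolding T_def by (simp add: Q_scale)
qed

lemma dom_add [simp]: "f \<in> opdom T \<Longrightarrow> g \<in> opdom T \<Longrightarrow> f + g \<in> opdom T"
  and dom_diff [simp]: "f \<in> opdom T \<Longrightarrow> g \<in> opdom T \<Longrightarrow> f - g \<in> opdom T"
  and dom_scale [simp]: "f \<in> opdom T \<Longrightarrow> a *\<^sub>C f \<in> opdom T"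
  and dom_zero [simp]: "0 \<in> opdom T"
  using dom_subspace
  by (auto intro: complex_vector.subspace_0 complex_vector.subspace_add
      complex_vector.subspace_diff complex_vector.subspace_scale)

lemma T0_diff: "f \<in> opdom T \<Longrightarrow> g \<in> opdom T \<Longrightarrow> T0 (f - g) = T0 f - T0 g"
  using T0_add[of "f - g" g] by simp

lemma \<Gamma>_diff: "f \<in> opdom T \<Longrightarrow> g \<in> opdom T \<Longrightarrow> app \<Gamma> (f - g) = app \<Gamma> f - app \<Gamma> g"
  using \<Gamma>_add[of "f - g" g] by simp

lemma linear_T: "linear_operator ell2 ell2 T"
  unfolding linear_operator_def using dom_subspace by (auto simp: T0_add T0_scale)

lemma linear_\<Gamma>: "linear_operator ell2 ell2 \<Gamma>"
  unfolding linear_operator_def using dom_subspace by (auto simp: \<Gamma>_add \<Gamma>_scale)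

text \<open>
  Moving \<open>R\<close> across the inner product turns \<open>T\<close> into the form that defines it.
\<close>

lemma form_T:
  assumes "f \<in> opdom T" "g \<in> opdom T"
  shows "ip ell2 (T0 f) g = ip ell2 (Q f) (Q g) + \<i> * ip ell2 (app \<Gamma> f) (app \<Gamma> g)"
proof -
  have "ip ell2 (T0 f) g = ip ell2 (R (T0 f)) (Q g)"
    using R_self_adjoint[of "T0 f" "Q g"] by simp
  then show ?thesis
    unfolding R_T0 using assms
    by (simp add: ell2.ip_add_left ell2.ip_scale_left adjoint' app_\<Gamma>)
qed

lemma form_T':
  assumes "f \<in> opdom T" "g \<in> opdom T"
  shows "ip ell2 f (T0 g) = ip ell2 (Q f) (Q g) - \<i> * ip ell2 (app \<Gamma> f) (app \<Gamma> g)"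
proof -
  have "ip ell2 f (T0 g) = cnj (ip ell2 (T0 g) f)"
    using assms by (intro ell2.ip_cnj) auto
  also have "\<dots> = cnj (ip ell2 (Q g) (Q f)) - \<i> * cnj (ip ell2 (app \<Gamma> g) (app \<Gamma> f))"
    using assms by (simp add: form_T)
  finally show ?thesis
    using assms ell2.ip_cnj[of "Q g" "Q f"] ell2.ip_cnj[of "app \<Gamma> g" "app \<Gamma> f"] by simp
qed

text \<open>
  With \<open>s = \<i>\<close> and \<open>w = cnj z\<close>, the bounded equation \<open>A s w g = R k\<close> is the resolvent equation
  \<open>T f - cnj z f = k\<close> for \<open>f = R g\<close>; with \<open>s = - \<i>\<close> and \<open>w = z\<close> one obtains the adjoint of that
  operator.
\<close>

definition A :: "complex \<Rightarrow> complex \<Rightarrow> (nat \<Rightarrow> complex) \<Rightarrow> nat \<Rightarrow> complex" where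
  "A s w g = g + s *\<^sub>C K' (K g) - w *\<^sub>C R (R g)"

lemma A_l2 [simp]: "g \<in> l2 \<Longrightarrow> A s w g \<in> l2"
  by (simp add: A_def)

lemma A_adjoint:
  assumes "f \<in> l2" "g \<in> l2"
  shows "ip ell2 (A s w f) g = ip ell2 f (A (cnj s) (cnj w) g)"
  using assms unfolding A_def
  by (simp add: ell2.ip_add_left ell2.ip_diff_left ell2.ip_scale_left ell2.ip_add_right
      ell2.ip_diff_right ell2.ip_scale_right adjoint' adjoint[symmetric] R_self_adjoint)

text \<open>
  For \<open>Re z > 0\<close> the real part \<open>\<parallel>g\<parallel>\<^sup>2 - Re z \<parallel>R g\<parallel>\<^sup>2\<close> of the form of \<open>A\<close> may be negative, but the
  imaginary part dominates \<open>Im z \<parallel>R g\<parallel>\<^sup>2\<close>, so the absolute value of the form is still coercive.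
\<close>

lemma A_surjective:
  assumes z: "Im z > 0" and d: "d \<in> l2" and sw: "(s, w) = (\<i>, cnj z) \<or> (s, w) = (- \<i>, z)"
  shows "\<exists>g\<in>l2. A s w g = d"
proof -
  define M where "M = 1 + \<bar>Re z\<bar> / Im z"
  have M: "M > 0"
    unfolding M_def using z by (intro add_pos_nonneg) auto
  show ?thesis
  proof (rule ell2.Lax_Milgram[where A = "A s w" and c = "1 / M" and C = "1 + \<bar>b\<bar>\<^sup>2 + cmod w"])
    show "A s w (f + g) = A s w f + A s w g" if "f \<in> l2" "g \<in> l2" for f g
      using that by (simp add: A_def K_add K'_add R_add scaleC_add_right)
    show "A s w (a *\<^sub>C g) = a *\<^sub>C A s w g" if "g \<in> l2" for a g
      using that by (simp add: A_def fun_eq_iff K_scale K'_scale R_scale algebra_simps)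
    have s1: "cmod s = 1"
      using sw by auto
    fix g
    assume g: "g \<in> l2"
    have b0: "b * norm2 f \<le> \<bar>b\<bar> * norm2 f" if "f \<in> l2" for f
      using that by (intro mult_right_mono) auto
    have "norm2 (K' (K g)) \<le> \<bar>b\<bar> * norm2 (K g)"
      using K'_bound[of "K g"] b0[of "K g"] g by simp
    also have "\<dots> \<le> \<bar>b\<bar> * (\<bar>b\<bar> * norm2 g)"
      using K_bound[of g] b0[of g] g by (intro mult_left_mono) auto
    finally have K2: "norm2 (K' (K g)) \<le> \<bar>b\<bar>\<^sup>2 * norm2 g"
      by (simp add: power2_eq_square mult.assoc)
    have R2: "norm2 (R (R g)) \<le> norm2 g"
      using R_bound[of g] R_bound[of "R g"] g by simp
    have "norm2 (A s w g) \<le> norm2 (g + s *\<^sub>C K' (K g)) + norm2 ((- w) *\<^sub>C R (R g))"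
      using ell2.norm_triangle[of "g + s *\<^sub>C K' (K g)" "(- w) *\<^sub>C R (R g)"] g
      by (simp add: A_def)
    also have "\<dots> \<le> norm2 g + norm2 (K' (K g)) + cmod w * norm2 (R (R g))"
      using ell2.norm_triangle[of g "s *\<^sub>C K' (K g)"] g s1 ell2.norm_scale[of "R (R g)" "- w"]
      by (simp add: ell2.norm_scale)
    also have "\<dots> \<le> (1 + \<bar>b\<bar>\<^sup>2 + cmod w) * norm2 g"
      using K2 mult_left_mono[OF R2, of "cmod w"] by (simp add: distrib_right)
    finally show "norm2 (A s w g) \<le> (1 + \<bar>b\<bar>\<^sup>2 + cmod w) * norm2 g" .
    define a \<rho> \<kappa> where "a = (norm2 g)\<^sup>2" and "\<rho> = (norm2 (R g))\<^sup>2" and "\<kappa> = (norm2 (K g))\<^sup>2"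
    define \<zeta> where "\<zeta> = ip ell2 (A s w g) g"
    have "\<zeta> = complex_of_real a + s * complex_of_real \<kappa> - w * complex_of_real \<rho>"
      unfolding \<zeta>_def A_def a_def \<rho>_def \<kappa>_def using g
      by (simp add: ell2.ip_add_left ell2.ip_diff_left ell2.ip_scale_left adjoint'
          R_self_adjoint[of "R g" g] ell2.ip_self)
    then have re: "Re \<zeta> = a - Re z * \<rho>" and im: "\<bar>Im \<zeta>\<bar> = \<bar>\<kappa> + Im z * \<rho>\<bar>"
      using sw by auto
    have nonneg: "\<kappa> \<ge> 0" "\<rho> \<ge> 0"
      by (simp_all add: \<kappa>_def \<rho>_def)
    have "\<rho> * Im z \<le> cmod \<zeta>"
      using im nonneg z abs_Im_le_cmod[of \<zeta>] by (simp add: mult.commute)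
    then have "\<rho> \<le> cmod \<zeta> / Im z"
      using z by (simp add: pos_le_divide_eq)
    then have "\<bar>Re z\<bar> * \<rho> \<le> \<bar>Re z\<bar> * (cmod \<zeta> / Im z)"
      by (intro mult_left_mono) auto
    moreover have "Re z * \<rho> \<le> \<bar>Re z\<bar> * \<rho>"
      using nonneg by (intro mult_right_mono) auto
    moreover have "a \<le> cmod \<zeta> + Re z * \<rho>"
      using re complex_Re_le_cmod[of \<zeta>] by linarith
    ultimately have "a \<le> cmod \<zeta> + \<bar>Re z\<bar> * (cmod \<zeta> / Im z)"
      by linarith
    also have "\<dots> = M * cmod \<zeta>"
      by (simp add: M_def distrib_right)
    finally show "1 / M * (norm2 g)\<^sup>2 \<le> cmod (ip ell2 (A s w g) g)"
      using M by (simp add: a_def \<zeta>_def pos_divide_le_eq mult.commute)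
  qed (use M d in simp_all)
qed

lemma resolvent:
  assumes "g \<in> l2" "k \<in> l2" "A \<i> w g = R k"
  shows "R g \<in> opdom T" "T0 (R g) - w *\<^sub>C R g = k"
proof -
  have "g + \<i> *\<^sub>C K' (K g) = R (k + w *\<^sub>C R g)"
    using assms(3) by (simp add: A_def R_add R_scale algebra_simps)
  from domI[OF assms(1) _ this] show "R g \<in> opdom T" "T0 (R g) - w *\<^sub>C R g = k"
    using assms by simp_all
qed

lemma resolvent_exists:
  assumes "Im z > 0" "k \<in> l2"
  obtains g where "g \<in> l2" "A \<i> (cnj z) g = R k" "R g \<in> opdom T" "T0 (R g) - cnj z *\<^sub>C R g = k"
  using A_surjective[of z "R k" \<i> "cnj z"] resolvent[of _ k "cnj z"] assms by auto

abbreviation lift :: "complex \<Rightarrow> (nat \<Rightarrow> complex) \<Rightarrow> (nat \<Rightarrow> complex) \<times> (nat \<Rightarrow> complex)" where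
  "lift z f \<equiv> (f, - ((1 / complex_of_real (sqrt (Im z))) *\<^sub>C app \<Gamma> f))"

abbreviation TT :: "complex \<Rightarrow> ((nat \<Rightarrow> complex) \<times> (nat \<Rightarrow> complex), (nat \<Rightarrow> complex) \<times> (nat \<Rightarrow> complex)) operator" where
  "TT z \<equiv> assoc_op T \<Gamma> z"

abbreviation KK :: "((nat \<Rightarrow> complex) \<times> (nat \<Rightarrow> complex)) ip_space" where
  "KK \<equiv> ell2 \<oplus>\<^sub>H ell2"

lemma opdom_TT: "opdom (TT z) = lift z ` opdom T"
  by (simp add: assoc_op_def)

lemma app_TT: "app (TT z) (f, e) = (T0 f, - ((cnj z / complex_of_real (sqrt (Im z))) *\<^sub>C app \<Gamma> f))"
  by (simp add: assoc_op_def)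

lemma lift_add: "f \<in> opdom T \<Longrightarrow> g \<in> opdom T \<Longrightarrow> lift z (f + g) = lift z f + lift z g"
  by (simp add: \<Gamma>_add scaleC_add_right)

lemma scaleC_pair: "a *\<^sub>C (x, y) = (a *\<^sub>C x, a *\<^sub>C y)"
  by (simp add: scaleC_prod_def)

lemma lift_scale: "f \<in> opdom T \<Longrightarrow> lift z (a *\<^sub>C f) = a *\<^sub>C lift z f"
  by (simp add: \<Gamma>_scale scaleC_pair scaleC_scaleC mult.commute)

lemma lift_diff: "f \<in> opdom T \<Longrightarrow> g \<in> opdom T \<Longrightarrow> lift z (f - g) = lift z f - lift z g"
  by (simp add: \<Gamma>_diff complex_vector.scale_right_diff_distrib)

lemma subspace_lift:
  assumes "complex_vector.subspace D" "D \<subseteq> opdom T"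
  shows "complex_vector.subspace (lift z ` D)"
proof (rule complex_vector.subspaceI)
  show "0 \<in> lift z ` D"
    using complex_vector.subspace_0[OF assms(1)] \<Gamma>_scale[of 0 0]
    by (intro image_eqI[of _ _ 0]) (simp_all add: zero_prod_def)
  fix x y
  assume "x \<in> lift z ` D" "y \<in> lift z ` D"
  then obtain f g where fg: "f \<in> D" "g \<in> D" and xy: "x = lift z f" "y = lift z g"
    by blast
  have "x + y = lift z (f + g)"
    unfolding xy using fg assms(2) by (intro lift_add[symmetric]) auto
  then show "x + y \<in> lift z ` D"
    using complex_vector.subspace_add[OF assms(1) fg] by blast
next
  fix a x
  assume "x \<in> lift z ` D"
  then obtain f where f: "f \<in> D" and x: "x = lift z f"
    by blast
  have "a *\<^sub>C x = lift z (a *\<^sub>C f)"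
    unfolding x using f assms(2) by (intro lift_scale[symmetric]) auto
  then show "a *\<^sub>C x \<in> lift z ` D"
    using complex_vector.subspace_scale[OF assms(1) f] by blast
qed

lemma app_lift_add:
  "f \<in> opdom T \<Longrightarrow> g \<in> opdom T \<Longrightarrow> app (TT z) (lift z f + lift z g) = app (TT z) (lift z f) + app (TT z) (lift z g)"
  by (simp add: app_TT T0_add \<Gamma>_add scaleC_add_right)

lemma app_lift_scale:
  "f \<in> opdom T \<Longrightarrow> app (TT z) (a *\<^sub>C lift z f) = a *\<^sub>C app (TT z) (lift z f)"
  by (simp add: scaleC_pair app_TT T0_scale \<Gamma>_scale scaleC_scaleC mult.commute)

lemma linear_TT: "linear_operator KK KK (TT z)"
  unfolding linear_operator_def opdom_TT
proof (intro conjI ballI allI)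
  show "complex_vector.subspace (lift z ` opdom T)"
    by (rule subspace_lift[OF dom_subspace]) simp
  show "lift z ` opdom T \<subseteq> carr KK"
    by (auto simp: carr_direct_sum)
  show "app (TT z) ` lift z ` opdom T \<subseteq> carr KK"
    by (auto simp: carr_direct_sum app_TT)
  fix u
  assume "u \<in> lift z ` opdom T"
  then obtain f where f: "f \<in> opdom T" "u = lift z f"
    by blast
  show "app (TT z) (c *\<^sub>C u) = c *\<^sub>C app (TT z) u" for c
    unfolding f(2) by (rule app_lift_scale[OF f(1)])
  fix v
  assume "v \<in> lift z ` opdom T"
  then obtain g where g: "g \<in> opdom T" "v = lift z g"
    by blast
  show "app (TT z) (u + v) = app (TT z) u + app (TT z) v"
    unfolding f(2) g(2) by (rule app_lift_add[OF f(1) g(1)])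
qed

text \<open>
  The contribution of the second component replaces the imaginary coefficient \<open>\<i>\<close> in the form of
  \<open>T\<close> by \<open>\<i> + cnj z / Im z = Re z / Im z\<close>, which is real: this is the symmetry of \<open>\<T>\<^sub>z\<close>.
\<close>

lemma form_TT:
  assumes z: "Im z > 0" and f: "f \<in> opdom T" and g: "g \<in> opdom T"
  shows "ip KK (app (TT z) (lift z f)) (lift z g) =
      ip ell2 (Q f) (Q g) + complex_of_real (Re z / Im z) * ip ell2 (app \<Gamma> f) (app \<Gamma> g)" (is ?left)
    and "ip KK (lift z f) (app (TT z) (lift z g)) =
      ip ell2 (Q f) (Q g) + complex_of_real (Re z / Im z) * ip ell2 (app \<Gamma> f) (app \<Gamma> g)" (is ?right)
proof -
  define s where "s = complex_of_real (sqrt (Im z))"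
  have ss: "s * s = complex_of_real (Im z)" and cs: "cnj s = s"
    using z by (simp_all add: s_def of_real_mult[symmetric] del: of_real_mult)
  have minus: "ip ell2 (- (a *\<^sub>C x)) (- (c *\<^sub>C y)) = a * cnj c * ip ell2 x y"
    if "x \<in> l2" "y \<in> l2" for a c x y
    using that ell2.ip_scale_left[of x "- (c *\<^sub>C y)" "- a"] ell2.ip_scale_right[of x y "- c"] by simp
  have eq1: "\<i> + cnj z / s * (1 / s) = complex_of_real (Re z / Im z)"
    using z by (simp add: ss complex_eq_iff)
  have eq2: "- \<i> + 1 / s * (z / s) = complex_of_real (Re z / Im z)"
    using z by (simp add: ss complex_eq_iff)
  have "ip KK (app (TT z) (lift z f)) (lift z g) =
      ip ell2 (Q f) (Q g) + (\<i> + cnj z / s * (1 / s)) * ip ell2 (app \<Gamma> f) (app \<Gamma> g)"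
    using f g by (simp add: app_TT minus form_T s_def[symmetric] cs distrib_right)
  then show ?left
    unfolding eq1 .
  have "ip KK (lift z f) (app (TT z) (lift z g)) =
      ip ell2 (Q f) (Q g) + (- \<i> + 1 / s * (z / s)) * ip ell2 (app \<Gamma> f) (app \<Gamma> g)"
    using f g by (simp add: app_TT minus form_T' s_def[symmetric] cs left_diff_distrib)
  then show ?right
    unfolding eq2 .
qed

lemma symmetric_TT: "Im z > 0 \<Longrightarrow> symmetric_operator KK (TT z)"
  unfolding symmetric_operator_def using linear_TT by (auto simp: opdom_TT form_TT simp del: ip_direct_sum)

text \<open>
  Here \<open>Re z / Im z = cot (Arg z)\<close> exceeds \<open>- cot \<alpha>\<close>, while \<open>\<parallel>K g\<parallel>\<^sup>2 \<le> tan \<alpha> \<parallel>g\<parallel>\<^sup>2\<close>.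
\<close>

lemma nonnegative_TT:
  assumes \<alpha>: "0 < \<alpha>" "\<alpha> < pi/2" and b: "b\<^sup>2 \<le> tan \<alpha>" and z: "Arg z \<in> {0<..<pi - \<alpha>}"
  shows "nonnegative_operator KK (TT z)"
proof -
  have z0: "z \<noteq> 0"
    using z by (auto simp: Arg_zero)
  have y: "Im z > 0"
    using z \<alpha> Arg_lt_pi[of z] by auto
  have re: "Re z = cmod z * cos (Arg z)" and im: "Im z = cmod z * sin (Arg z)"
    using z0 by (simp_all add: cos_Arg sin_Arg)
  have sin\<alpha>: "sin \<alpha> > 0" and cos\<alpha>: "cos \<alpha> > 0"
    using \<alpha> sin_gt_zero[of \<alpha>] cos_gt_zero[of \<alpha>] by auto
  have "0 < sin (Arg z + \<alpha>)"
    using z \<alpha> by (intro sin_gt_zero) auto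
  then have "0 < cmod z * (sin (Arg z) * cos \<alpha> + cos (Arg z) * sin \<alpha>)"
    using z0 by (simp add: sin_add)
  then have cot: "- Re z * sin \<alpha> < Im z * cos \<alpha>"
    by (simp add: re im algebra_simps)
  have key: "0 \<le> (norm2 (Q f))\<^sup>2 + Re z / Im z * (norm2 (app \<Gamma> f))\<^sup>2" if f: "f \<in> opdom T" for f
  proof (cases "Re z \<ge> 0")
    case True
    then show ?thesis using y by simp
  next
    case False
    have "norm2 (app \<Gamma> f) \<le> b * norm2 (Q f)"
      using f K_bound by (simp add: app_\<Gamma>)
    then have "(norm2 (app \<Gamma> f))\<^sup>2 \<le> (b * norm2 (Q f))\<^sup>2"
      using f by (intro power_mono) simp_all
    also have "\<dots> \<le> tan \<alpha> * (norm2 (Q f))\<^sup>2"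
      using b by (simp add: power_mult_distrib mult_right_mono)
    finally have "- Re z / Im z * (norm2 (app \<Gamma> f))\<^sup>2 \<le> - Re z / Im z * (tan \<alpha> * (norm2 (Q f))\<^sup>2)"
      using y False by (intro mult_left_mono) (auto simp: field_simps)
    also have "\<dots> = (- Re z / Im z * tan \<alpha>) * (norm2 (Q f))\<^sup>2"
      by simp
    also have "\<dots> \<le> 1 * (norm2 (Q f))\<^sup>2"
      using cot y cos\<alpha> by (intro mult_right_mono) (auto simp: tan_def field_simps)
    finally show ?thesis
      by simp
  qed
  show ?thesis
    unfolding nonnegative_operator_def
  proof (intro conjI ballI symmetric_TT y)
    fix u
    assume "u \<in> opdom (TT z)"
    then obtain f where f: "f \<in> opdom T" and u: "u = lift z f"
      by (auto simp: opdom_TT)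
    have "ip KK (app (TT z) u) u =
        complex_of_real ((norm2 (Q f))\<^sup>2 + Re z / Im z * (norm2 (app \<Gamma> f))\<^sup>2)"
      unfolding u form_TT(1)[OF y f f] using f by (simp add: ell2.ip_self)
    then show "ip KK (app (TT z) u) u \<in> \<real>\<^sub>\<ge>\<^sub>0"
      using key[OF f] by (simp only: nonneg_Reals_of_real_iff)
  qed
qed

lemma subspace_preimage:
  assumes N: "complex_vector.subspace N"
  shows "complex_vector.subspace {f \<in> opdom T. T0 f - cnj z *\<^sub>C f \<in> N}"
proof (rule complex_vector.subspaceI)
  have "T0 0 = 0"
    using T0_scale[of 0 0] by simp
  then show "0 \<in> {f \<in> opdom T. T0 f - cnj z *\<^sub>C f \<in> N}"
    using complex_vector.subspace_0[OF N] by simp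
  fix f g a
  assume f: "f \<in> {f \<in> opdom T. T0 f - cnj z *\<^sub>C f \<in> N}"
  have "T0 (a *\<^sub>C f) - cnj z *\<^sub>C (a *\<^sub>C f) = a *\<^sub>C (T0 f - cnj z *\<^sub>C f)"
    using f by (simp add: T0_scale complex_vector.scale_right_diff_distrib scaleC_scaleC mult.commute)
  then show "a *\<^sub>C f \<in> {f \<in> opdom T. T0 f - cnj z *\<^sub>C f \<in> N}"
    using f complex_vector.subspace_scale[OF N] by simp
  assume g: "g \<in> {f \<in> opdom T. T0 f - cnj z *\<^sub>C f \<in> N}"
  have "T0 (f + g) - cnj z *\<^sub>C (f + g) = (T0 f - cnj z *\<^sub>C f) + (T0 g - cnj z *\<^sub>C g)"
    using f g by (simp add: T0_add scaleC_add_right)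
  then show "f + g \<in> {f \<in> opdom T. T0 f - cnj z *\<^sub>C f \<in> N}"
    using f g complex_vector.subspace_add[OF N] by simp
qed

text \<open>
  Suppose \<open>(p, q)\<close> is orthogonal to the lifts and let \<open>c = 1 / sqrt (Im z)\<close>.  Orthogonality to the
  lift of \<open>R g\<close> says that \<open>g\<close> is orthogonal to \<open>R p - c K' q\<close>.  Writing this vector as the adjoint
  resolvent operator applied to some \<open>v\<close> and moving the operator to \<open>g\<close> gives \<open>(k, R v) = 0\<close> for all
  \<open>k \<in> N\<close>.  So \<open>v = 0\<close>, hence \<open>R p = c K' q\<close>, which forces \<open>p = q = 0\<close>.
\<close>

lemma dense_lift:
  assumes z: "Im z > 0" and N: "complex_vector.subspace N" "N \<subseteq> l2"
    and triv: "\<And>v. v \<in> l2 \<Longrightarrow> (\<And>k. k \<in> N \<Longrightarrow> ip ell2 k (R v) = 0) \<Longrightarrow> v = 0"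
  shows "dense_in KK (lift z ` {f \<in> opdom T. T0 f - cnj z *\<^sub>C f \<in> N})"
proof -
  interpret KK: hilbert KK
    using hilbert_space_direct_sum[OF hilbert_space_ell2 hilbert_space_ell2]
    by unfold_locales (simp_all add: hilbert_space_def)
  show ?thesis
  proof (rule KK.dense_in_if_orthogonal_trivial)
    show "complex_vector.subspace (lift z ` {f \<in> opdom T. T0 f - cnj z *\<^sub>C f \<in> N})"
      using subspace_lift[OF subspace_preimage[OF N(1)]] by blast
    show "lift z ` {f \<in> opdom T. T0 f - cnj z *\<^sub>C f \<in> N} \<subseteq> carr KK"
      by (auto simp: carr_direct_sum)
    fix u
    assume u: "u \<in> carr KK"
      and orth: "\<And>s. s \<in> lift z ` {f \<in> opdom T. T0 f - cnj z *\<^sub>C f \<in> N} \<Longrightarrow> ip KK s u = 0"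
    obtain p q where u_eq: "u = (p, q)" and p: "p \<in> l2" and q: "q \<in> l2"
      using u by (auto simp: carr_direct_sum)
    define c where "c = 1 / complex_of_real (sqrt (Im z))"
    have c: "cnj c = c" "c \<noteq> 0"
      using z by (simp_all add: c_def)
    obtain v where v: "v \<in> l2" "A (- \<i>) z v = R p - K' (c *\<^sub>C q)"
      using A_surjective[of z "R p - K' (c *\<^sub>C q)" "- \<i>" z] z p q by auto
    have "ip ell2 k (R v) = 0" if k: "k \<in> N" for k
    proof -
      have kl: "k \<in> l2"
        using k N by blast
      obtain g where g: "g \<in> l2" "A \<i> (cnj z) g = R k" "R g \<in> opdom T" "T0 (R g) - cnj z *\<^sub>C R g = k"
        using resolvent_exists[OF z kl] by blast
      have "0 = ip KK (lift z (R g)) u"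
        using orth g k by (metis (no_types, lifting) image_eqI mem_Collect_eq)
      also have "\<dots> = ip ell2 (R g) p + ip ell2 ((- c) *\<^sub>C K g) q"
        by (simp add: u_eq app_\<Gamma> c_def)
      also have "\<dots> = ip ell2 g (R p) - ip ell2 g (K' (c *\<^sub>C q))"
        using g(1) p q c by (simp add: R_self_adjoint ell2.ip_scale_left[of "K g" q "- c"] ell2.ip_scale_right
            adjoint[symmetric] del: complex_vector.scale_minus_left)
      also have "\<dots> = ip ell2 g (A (- \<i>) z v)"
        using g(1) p q by (simp add: v(2) ell2.ip_diff_right)
      also have "\<dots> = ip ell2 (R k) v"
        using A_adjoint[OF g(1) v(1), of \<i> "cnj z"] by (simp add: g(2))
      finally show ?thesis
        by (simp add: R_self_adjoint)
    qed
    then have "v = 0"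
      using triv v(1) by blast
    then have eq: "R p = K' (c *\<^sub>C q)"
      using v(2) by (simp add: A_def)
    then have "c *\<^sub>C q = 0"
      using ranges_disjoint[of p "c *\<^sub>C q"] p q by simp
    moreover have "p = 0"
      using eq unfolding \<open>c *\<^sub>C q = 0\<close> by simp
    ultimately show "u = 0"
      using c by (simp add: u_eq zero_prod_def)
  qed
qed

section \<open>The model is admissible\<close>

lemma carr_KK: "carr KK = l2 \<times> l2"
  by (rule carr_direct_sum)

lemma KK_inner: "inner_product KK"
  by unfold_locales (rule inner_product_space_direct_sum[OF inner_product_space_ell2 inner_product_space_ell2])

lemma KK_norm: "x \<in> l2 \<Longrightarrow> y \<in> l2 \<Longrightarrow> (ip_norm KK (x, y))\<^sup>2 = (norm2 x)\<^sup>2 + (norm2 y)\<^sup>2"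
  using inner_product.norm_sq[OF KK_inner, of "(x, y)"] by (simp add: carr_KK ell2.norm_sq)

lemma norm_minus [simp]: "x \<in> l2 \<Longrightarrow> norm2 (- x) = norm2 x"
  using ell2.norm_scale[of x "- 1"] by (simp add: scaleC_one)

text \<open>
  Both estimates come from \<open>Im (T f - cnj z f, f) = \<parallel>\<Gamma> f\<parallel>\<^sup>2 + Im z \<parallel>f\<parallel>\<^sup>2\<close> and the Cauchy--Schwarz
  inequality.
\<close>

lemma resolvent_estimate:
  assumes z: "Im z > 0" and f: "f \<in> opdom T"
  shows "Im z * norm2 f \<le> norm2 (T0 f - cnj z *\<^sub>C f)"
    and "Im z * (norm2 (app \<Gamma> f))\<^sup>2 \<le> (norm2 (T0 f - cnj z *\<^sub>C f))\<^sup>2"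
proof -
  define k where "k = T0 f - cnj z *\<^sub>C f"
  have k: "k \<in> l2"
    using f by (simp add: k_def)
  have "ip ell2 k f = ip ell2 (Q f) (Q f) + \<i> * ip ell2 (app \<Gamma> f) (app \<Gamma> f) - cnj z * ip ell2 f f"
    using f by (simp add: k_def ell2.ip_diff_left ell2.ip_scale_left form_T)
  then have "Im (ip ell2 k f) = (norm2 (app \<Gamma> f))\<^sup>2 + Im z * (norm2 f)\<^sup>2"
    using f by (simp add: ell2.ip_self)
  then have le: "(norm2 (app \<Gamma> f))\<^sup>2 + Im z * (norm2 f)\<^sup>2 \<le> norm2 k * norm2 f"
    using ell2.Cauchy_Schwarz[OF k dom_l2[OF f]] abs_Im_le_cmod[of "ip ell2 k f"] by linarith
  show 1: "Im z * norm2 f \<le> norm2 k"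
  proof (cases "norm2 f = 0")
    case False
    then have "norm2 f > 0"
      using ell2.norm_ge_0[OF dom_l2[OF f]] by linarith
    moreover have "Im z * norm2 f * norm2 f \<le> norm2 k * norm2 f"
      using le zero_le_power2[of "norm2 (app \<Gamma> f)"]
      unfolding mult.assoc power2_eq_square[symmetric] by linarith
    ultimately show ?thesis
      by simp
  qed (use k in simp)
  have "(norm2 (app \<Gamma> f))\<^sup>2 \<le> norm2 k * norm2 f"
    using le z zero_le_power2[of "norm2 f"] by (smt (verit) mult_nonneg_nonneg)
  then have "Im z * (norm2 (app \<Gamma> f))\<^sup>2 \<le> Im z * (norm2 k * norm2 f)"
    using z by (intro mult_left_mono) auto
  also have "\<dots> = norm2 k * (Im z * norm2 f)"
    by simp
  also have "\<dots> \<le> norm2 k * norm2 k"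
    using 1 k by (intro mult_left_mono) auto
  finally show "Im z * (norm2 (app \<Gamma> f))\<^sup>2 \<le> (norm2 k)\<^sup>2"
    by (simp add: power2_eq_square)
qed

text \<open>
  If a dissipative \<open>S\<close> extends \<open>T\<close>, then for \<open>f\<close> in its domain surjectivity of \<open>T + \<i>\<close> provides an element of the
  domain of \<open>T\<close> with the same image under \<open>S + \<i>\<close>; dissipativity makes \<open>S + \<i>\<close> injective.
\<close>

lemma maximal_dissipative_T: "maximal_dissipative ell2 T"
  unfolding maximal_dissipative_def
proof (intro conjI allI impI)
  have "0 \<le> Im (ip ell2 (T0 f) f)" if "f \<in> opdom T" for f
    using that by (simp add: form_T ell2.ip_self)
  then show "dissipative ell2 T"
    unfolding dissipative_def using linear_T by simp
next
  fix S
  assume "dissipative ell2 S \<and> extends S T"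
  then have S: "linear_operator ell2 ell2 S" and dis: "\<And>f. f \<in> opdom S \<Longrightarrow> 0 \<le> Im (ip ell2 (app S f) f)"
    and sub: "opdom T \<subseteq> opdom S" and ext: "\<And>f. f \<in> opdom T \<Longrightarrow> app S f = T0 f"
    by (auto simp: dissipative_def extends_def)
  have domS: "complex_vector.subspace (opdom S)" and Sl: "\<And>f. f \<in> opdom S \<Longrightarrow> f \<in> l2"
    and appS: "\<And>f. f \<in> opdom S \<Longrightarrow> app S f \<in> l2"
    and addS: "\<And>f g. f \<in> opdom S \<Longrightarrow> g \<in> opdom S \<Longrightarrow> app S (f + g) = app S f + app S g"
    using S unfolding linear_operator_def by auto
  have "f \<in> opdom T" if f: "f \<in> opdom S" for f
  proof -
    have "app S f + \<i> *\<^sub>C f \<in> l2"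
      using f Sl appS by simp
    then obtain g where g: "R g \<in> opdom T" "T0 (R g) - cnj \<i> *\<^sub>C R g = app S f + \<i> *\<^sub>C f"
      using resolvent_exists[of \<i> "app S f + \<i> *\<^sub>C f"] by auto
    define e where "e = f - R g"
    have e: "e \<in> opdom S"
      unfolding e_def using f g(1) sub domS by (blast intro: complex_vector.subspace_diff)
    have "app S f = app S e + app S (R g)"
      using addS[OF e, of "R g"] g(1) sub by (auto simp: e_def)
    then have "app S e = app S f - T0 (R g)"
      using ext[OF g(1)] by simp
    also have "\<dots> = (- \<i>) *\<^sub>C e"
      using g(2) by (simp add: e_def complex_vector.scale_right_diff_distrib algebra_simps)
    finally have "app S e = (- \<i>) *\<^sub>C e" .
    then have "Im (ip ell2 (app S e) e) = - (norm2 e)\<^sup>2"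
      using Sl[OF e] ell2.ip_scale_left[of e e "- \<i>"] by (simp add: ell2.ip_self)
    then have "e = 0"
      using dis[OF e] Sl[OF e] by simp
    then show ?thesis
      using g(1) by (simp add: e_def)
  qed
  then show "opdom S = opdom T"
    using sub by blast
qed

text \<open>
  The solution \<open>f\<close> of \<open>T f + \<i> f = e\<^sub>n\<close> has norm at most \<open>r n\<close>, which tends to \<open>0\<close>, while
  the right-hand side has norm \<open>1\<close>.
\<close>

lemma unbounded_T: "\<not> bounded_operator ell2 ell2 T"
proof
  assume "bounded_operator ell2 ell2 T"
  then obtain C where C: "\<And>f. f \<in> opdom T \<Longrightarrow> norm2 (T0 f) \<le> C * norm2 f"
    unfolding bounded_operator_def by auto
  have "1 \<le> (\<bar>C\<bar> + 1) * (1/2)^n" for n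
  proof -
    obtain g where g: "g \<in> l2" "A \<i> (cnj \<i>) g = R (unit n)" "R g \<in> opdom T"
        "T0 (R g) - cnj \<i> *\<^sub>C R g = unit n"
      using resolvent_exists[of \<i> "unit n"] by auto
    have "ip ell2 (R (unit n)) g = ip ell2 g g + \<i> * ip ell2 (K g) (K g) + \<i> * ip ell2 (R g) (R g)"
      unfolding g(2)[symmetric] A_def using g(1) R_self_adjoint[of "R g" g]
      by (simp add: ell2.ip_add_left ell2.ip_scale_left adjoint' )
    then have "Re (ip ell2 (R (unit n)) g) = (norm2 g)\<^sup>2"
      using g(1) by (simp add: ell2.ip_self)
    then have "(norm2 g)\<^sup>2 \<le> norm2 (R (unit n)) * norm2 g"
      using ell2.Cauchy_Schwarz[of "R (unit n)" g] g(1) complex_Re_le_cmod[of "ip ell2 (R (unit n)) g"]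
      by simp
    then have "norm2 g * norm2 g \<le> norm2 (R (unit n)) * norm2 g"
      by (simp add: power2_eq_square)
    then have le: "norm2 g \<le> norm2 (R (unit n))"
      using ell2.norm_ge_0[OF g(1)] ell2.norm_ge_0[of "R (unit n)"]
      by (cases "norm2 g = 0") simp_all
    have "R (unit n) = complex_of_real (r n) *\<^sub>C unit n"
      by (simp add: diag_def unit_def fun_eq_iff)
    then have "norm2 (R (unit n)) = r n"
      using r_pos[of n] by (simp add: ell2.norm_scale)
    then have small: "norm2 (R g) \<le> (1/2)^n"
      using le R_bound[OF g(1)] r_le[of n] by linarith
    have "1 = norm2 (T0 (R g) + \<i> *\<^sub>C R g)"
      using g(4) norm_unit[of n] by simp
    also have "\<dots> \<le> norm2 (T0 (R g)) + norm2 (R g)"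
      using ell2.norm_triangle[of "T0 (R g)" "\<i> *\<^sub>C R g"] g(3) g(1) by (simp add: ell2.norm_scale)
    also have "\<dots> \<le> \<bar>C\<bar> * norm2 (R g) + norm2 (R g)"
      using C[OF g(3)] mult_right_mono[OF abs_ge_self[of C], of "norm2 (R g)"] g(1) by simp
    also have "\<dots> = (\<bar>C\<bar> + 1) * norm2 (R g)"
      by (simp add: distrib_right)
    also have "\<dots> \<le> (\<bar>C\<bar> + 1) * (1/2)^n"
      using small by (intro mult_left_mono) auto
    finally show ?thesis .
  qed
  moreover have "(\<lambda>n. (\<bar>C\<bar> + 1) * (1/2)^n) \<longlonglongrightarrow> (\<bar>C\<bar> + 1) * 0"
    by (intro tendsto_mult tendsto_const LIMSEQ_realpow_zero) auto
  ultimately have "1 \<le> (\<bar>C\<bar> + 1) * 0"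
    by (intro LIMSEQ_le_const[of "\<lambda>n. (\<bar>C\<bar> + 1) * (1/2)^n"]) blast+
  then show False
    by simp
qed

lemma dense_TT:
  assumes z: "Im z > 0"
  shows "dense_in KK (opdom (TT z))"
proof -
  have "dense_in KK (lift z ` {f \<in> opdom T. T0 f - cnj z *\<^sub>C f \<in> l2})"
  proof (rule dense_lift[OF z ell2.subspace_carr subset_refl])
    fix v
    assume v: "v \<in> l2" and orth: "\<And>k. k \<in> l2 \<Longrightarrow> ip ell2 k (R v) = 0"
    then have "ip ell2 (R v) (R v) = 0"
      using R_l2 by blast
    then show "v = 0"
      using ell2.ip_eq_0[OF R_l2[OF v]] by simp
  qed
  moreover have "{f \<in> opdom T. T0 f - cnj z *\<^sub>C f \<in> l2} = opdom T"
    by auto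
  ultimately show ?thesis
    by (simp add: opdom_TT)
qed

text \<open>
  For \<open>z = \<i>\<close> the second components of the domain of \<open>\<T>\<^sub>z\<close> are the vectors \<open>- \<Gamma> f\<close>, so density
  of the domain in the direct sum suffices.
\<close>

lemma dense_range_\<Gamma>: "dense_in ell2 (app \<Gamma> ` opdom T)"
  unfolding ell2.dense_in_iff
proof (intro conjI ballI allI impI)
  show "app \<Gamma> ` opdom T \<subseteq> l2"
    by auto
  interpret KK: inner_product KK
    by (rule KK_inner)
  fix x and e :: real
  assume x: "x \<in> l2" and e: "e > 0"
  have "(0, - x) \<in> carr KK"
    using x by (simp add: carr_KK)
  then obtain f where f: "f \<in> opdom T" and near: "ip_norm KK ((0, - x) - lift \<i> f) < e"
    using dense_TT[of \<i>] e unfolding KK.dense_in_iff opdom_TT by (metis (no_types, lifting) imageE imaginary_unit.sel(2) zero_less_one)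
  have eq: "(0, - x) - lift \<i> f = (- f, - (x - app \<Gamma> f))"
    by (simp add: scaleC_one)
  have "(ip_norm KK ((0, - x) - lift \<i> f))\<^sup>2 = (norm2 f)\<^sup>2 + (norm2 (x - app \<Gamma> f))\<^sup>2"
    unfolding eq using f x KK_norm[of "- f" "- (x - app \<Gamma> f)"] norm_minus[of "x - app \<Gamma> f"]
    by (simp del: minus_diff_eq)
  then have "(norm2 (x - app \<Gamma> f))\<^sup>2 \<le> (ip_norm KK ((0, - x) - lift \<i> f))\<^sup>2"
    by simp
  then have "norm2 (x - app \<Gamma> f) \<le> ip_norm KK ((0, - x) - lift \<i> f)"
    by (rule power2_le_imp_le) (use f x in \<open>simp add: carr_KK\<close>)
  then show "\<exists>s\<in>app \<Gamma> ` opdom T. norm2 (x - s) < e"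
    using near f by (intro bexI[of _ "app \<Gamma> f"]) auto
qed

theorem admissible: "admissible ell2 T ell2 \<Gamma>"
  unfolding admissible_def boundary_pair_def upper_half_plane_def
  using hilbert_space_ell2 infinite_dimensional_ell2 separable_ell2 maximal_dissipative_T
    unbounded_T linear_\<Gamma> dense_range_\<Gamma> symmetric_TT dense_TT
  by (auto simp: form_T form_T')

section \<open>The domain of the square\<close>

definition ker\<Gamma> :: "(nat \<Rightarrow> complex) set" where
  "ker\<Gamma> = {f \<in> opdom T. app \<Gamma> f = 0}"

lemma kernel_eq: "ker\<Gamma> = {R (R h) | h. h \<in> l2 \<and> K (R h) = 0}"
proof (intro equalityI subsetI)
  fix f
  assume "f \<in> ker\<Gamma>"
  then have f: "f \<in> opdom T" and K: "K (Q f) = 0"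
    by (auto simp: ker\<Gamma>_def app_\<Gamma>)
  have "R (T0 f) = Q f"
    unfolding R_T0 by (simp add: K)
  then have "f = R (R (T0 f)) \<and> T0 f \<in> l2 \<and> K (R (T0 f)) = 0"
    using f K by simp
  then show "f \<in> {R (R h) | h. h \<in> l2 \<and> K (R h) = 0}"
    by blast
next
  fix f
  assume "f \<in> {R (R h) | h. h \<in> l2 \<and> K (R h) = 0}"
  then obtain h where h: "h \<in> l2" "K (R h) = 0" and f: "f = R (R h)"
    by blast
  have "f \<in> opdom T"
    unfolding f using h by (intro domI(1)) auto
  then show "f \<in> ker\<Gamma>"
    using h f by (simp add: ker\<Gamma>_def app_\<Gamma>)
qed

lemma kernel_l2: "ker\<Gamma> \<subseteq> l2"
  by (auto simp: ker\<Gamma>_def)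

lemma kernel_subspace: "complex_vector.subspace ker\<Gamma>"
proof (rule complex_vector.subspaceI)
  show "0 \<in> ker\<Gamma>"
    using \<Gamma>_scale[of 0 0] by (simp add: ker\<Gamma>_def)
qed (auto simp: ker\<Gamma>_def \<Gamma>_add \<Gamma>_scale)

text \<open>
  The image of the lift of \<open>f\<close> is again a lift exactly when \<open>T f\<close> is in the domain of \<open>T\<close> and
  \<open>\<Gamma> (T f) = cnj z \<Gamma> f\<close>.
\<close>

lemma opdom_square_TT:
  assumes z: "Im z > 0"
  shows "opdom_square (TT z) = lift z ` {f \<in> opdom T. T0 f - cnj z *\<^sub>C f \<in> ker\<Gamma>}"
proof -
  define c where "c = 1 / complex_of_real (sqrt (Im z))"
  have c: "c \<noteq> 0"
    using z by (simp add: c_def)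
  have c': "cnj z / complex_of_real (sqrt (Im z)) = c * cnj z"
    by (simp add: c_def)
  have "app (TT z) (lift z f) \<in> opdom (TT z) \<longleftrightarrow> T0 f - cnj z *\<^sub>C f \<in> ker\<Gamma>" if f: "f \<in> opdom T" for f
  proof -
    have "app (TT z) (lift z f) \<in> opdom (TT z) \<longleftrightarrow>
        T0 f \<in> opdom T \<and> (c * cnj z) *\<^sub>C app \<Gamma> f = c *\<^sub>C app \<Gamma> (T0 f)"
      by (auto simp: opdom_TT app_TT c_def)
    also have "\<dots> \<longleftrightarrow> T0 f \<in> opdom T \<and> cnj z *\<^sub>C app \<Gamma> f = app \<Gamma> (T0 f)"
      using c complex_vector.scale_cancel_left[of c "cnj z *\<^sub>C app \<Gamma> f" "app \<Gamma> (T0 f)"]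
      by (simp only: scaleC_scaleC simp_thms)
    also have "\<dots> \<longleftrightarrow> T0 f \<in> opdom T \<and> app \<Gamma> (T0 f - cnj z *\<^sub>C f) = 0"
      using f by (auto simp: \<Gamma>_diff \<Gamma>_scale)
    also have "\<dots> \<longleftrightarrow> T0 f - cnj z *\<^sub>C f \<in> ker\<Gamma>"
    proof -
      have "T0 f \<in> opdom T" if "T0 f - cnj z *\<^sub>C f \<in> opdom T"
        using dom_add[OF that dom_scale[OF f, of "cnj z"]] by simp
      then show ?thesis
        using f by (auto simp: ker\<Gamma>_def)
    qed
    finally show ?thesis .
  qed
  then show ?thesis
    unfolding opdom_square_def opdom_TT by auto
qed

lemma graph_inner: "inner_product (graph_space KK KK (TT z))"
  by unfold_locales (intro inner_product_space_graph_space inner_product.inner_product_space[OF KK_inner] linear_TT)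

lemma lift_dom: "f \<in> opdom T \<Longrightarrow> lift z f \<in> opdom (TT z)"
  unfolding opdom_TT by (rule imageI)

abbreviation gnorm :: "complex \<Rightarrow> (nat \<Rightarrow> complex) \<Rightarrow> real" where
  "gnorm z f \<equiv> ip_norm (graph_space KK KK (TT z)) (lift z f)"

lemma carr_graph: "carr (graph_space KK KK (TT z)) = opdom (TT z)"
  by (simp add: graph_space_def)

lemma gnorm_sq:
  assumes z: "Im z > 0" and f: "f \<in> opdom T"
  shows "(gnorm z f)\<^sup>2 = (norm2 f)\<^sup>2 + (norm2 (T0 f))\<^sup>2
      + (1 + (cmod z)\<^sup>2) / Im z * (norm2 (app \<Gamma> f))\<^sup>2"
proof -
  interpret G: inner_product "graph_space KK KK (TT z)"
    by (rule graph_inner)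
  interpret KK: inner_product KK
    by (rule KK_inner)
  have *: "lift z f \<in> carr (graph_space KK KK (TT z))"
    unfolding carr_graph by (rule lift_dom[OF f])
  moreover have "lift z f \<in> carr KK" "app (TT z) (lift z f) \<in> carr KK"
    using f by (simp_all add: carr_KK app_TT)
  ultimately have "(gnorm z f)\<^sup>2 = (ip_norm KK (lift z f))\<^sup>2 + (ip_norm KK (app (TT z) (lift z f)))\<^sup>2"
    unfolding G.norm_sq[OF *] by (simp add: KK.norm_sq graph_space_def del: ip_direct_sum)
  also have "(ip_norm KK (lift z f))\<^sup>2 = (norm2 f)\<^sup>2 + 1 / Im z * (norm2 (app \<Gamma> f))\<^sup>2"
    using f z by (simp add: KK_norm ell2.norm_scale norm_divide power_divide power_mult_distrib)
  also have "(ip_norm KK (app (TT z) (lift z f)))\<^sup>2 = (norm2 (T0 f))\<^sup>2 + (cmod z)\<^sup>2 / Im z * (norm2 (app \<Gamma> f))\<^sup>2"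
    using f z by (simp add: app_TT KK_norm ell2.norm_scale norm_divide power_divide power_mult_distrib)
  finally show ?thesis
    by (simp only: add_divide_distrib distrib_right add_ac)
qed

lemma gnorm_le:
  assumes z: "Im z > 0"
  obtains M where "M > 0" "\<And>f. f \<in> opdom T \<Longrightarrow> gnorm z f \<le> M * norm2 (T0 f - cnj z *\<^sub>C f)"
proof -
  define y where "y = Im z"
  define B where "B = 1/y\<^sup>2 + 2 * (1 + (cmod z)\<^sup>2 * (1/y\<^sup>2)) + (1 + (cmod z)\<^sup>2) / y * (1/y)"
  have y: "y > 0"
    using z by (simp add: y_def)
  have B: "B > 0"
    unfolding B_def using y by (intro add_pos_nonneg) (auto intro!: add_pos_nonneg)
  have "gnorm z f \<le> sqrt B * norm2 (T0 f - cnj z *\<^sub>C f)" if f: "f \<in> opdom T" for f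
  proof -
    define k where "k = T0 f - cnj z *\<^sub>C f"
    have k: "k \<in> l2"
      using f by (simp add: k_def)
    note est = resolvent_estimate[OF z f, folded k_def y_def]
    have nf: "norm2 f \<le> norm2 k / y"
      using est(1) y by (simp add: pos_le_divide_eq mult.commute)
    then have "(norm2 f)\<^sup>2 \<le> (norm2 k / y)\<^sup>2"
      using f by (intro power_mono) simp_all
    then have f2: "(norm2 f)\<^sup>2 \<le> 1/y\<^sup>2 * (norm2 k)\<^sup>2"
      by (simp add: power_divide)
    have G2: "(norm2 (app \<Gamma> f))\<^sup>2 \<le> 1/y * (norm2 k)\<^sup>2"
      using est(2) y by (simp add: pos_le_divide_eq mult.commute)
    have "norm2 (T0 f) \<le> norm2 k + cmod z * norm2 f"
      using ell2.norm_triangle[of k "cnj z *\<^sub>C f"] k f by (simp add: k_def ell2.norm_scale)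
    then have "(norm2 (T0 f))\<^sup>2 \<le> (norm2 k + cmod z * norm2 f)\<^sup>2"
      using f by (intro power_mono) simp_all
    also have "\<dots> \<le> 2 * (norm2 k)\<^sup>2 + 2 * ((cmod z)\<^sup>2 * (norm2 f)\<^sup>2)"
      using sum_squares_bound[of "norm2 k" "cmod z * norm2 f"] by (simp add: power2_sum power_mult_distrib mult.assoc)
    also have "\<dots> \<le> 2 * (norm2 k)\<^sup>2 + 2 * ((cmod z)\<^sup>2 * (1/y\<^sup>2 * (norm2 k)\<^sup>2))"
      using f2 by (intro add_left_mono mult_left_mono) auto
    finally have T2: "(norm2 (T0 f))\<^sup>2 \<le> 2 * (1 + (cmod z)\<^sup>2 * (1/y\<^sup>2)) * (norm2 k)\<^sup>2"
      by (simp add: algebra_simps)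
    have G3: "(1 + (cmod z)\<^sup>2) / y * (norm2 (app \<Gamma> f))\<^sup>2 \<le> (1 + (cmod z)\<^sup>2) / y * (1/y * (norm2 k)\<^sup>2)"
      using G2 y by (intro mult_left_mono) auto
    have "(gnorm z f)\<^sup>2 \<le> 1/y\<^sup>2 * (norm2 k)\<^sup>2 + 2 * (1 + (cmod z)\<^sup>2 * (1/y\<^sup>2)) * (norm2 k)\<^sup>2
        + (1 + (cmod z)\<^sup>2) / y * (1/y * (norm2 k)\<^sup>2)"
      using f2 T2 G3 gnorm_sq[OF z f] by (simp only: y_def)
    also have "\<dots> = B * (norm2 k)\<^sup>2"
      unfolding B_def by (simp only: distrib_right mult.assoc)
    also have "\<dots> = (sqrt B * norm2 k)\<^sup>2"
      using B by (simp add: power_mult_distrib)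
    finally show ?thesis
      unfolding k_def[symmetric] by (rule power2_le_imp_le) (use B k in simp)
  qed
  then show ?thesis
    using that[of "sqrt B"] B by simp
qed

lemma gnorm_ge:
  assumes z: "Im z > 0" and f: "f \<in> opdom T"
  shows "norm2 (T0 f - cnj z *\<^sub>C f) \<le> (1 + cmod z) * gnorm z f"
proof -
  have g0: "0 \<le> gnorm z f"
    by (rule inner_product.norm_ge_0[OF graph_inner]) (unfold carr_graph, rule lift_dom[OF f])
  have rest: "0 \<le> (1 + (cmod z)\<^sup>2) / Im z * (norm2 (app \<Gamma> f))\<^sup>2"
    using z by simp
  have "(norm2 f)\<^sup>2 \<le> (gnorm z f)\<^sup>2" "(norm2 (T0 f))\<^sup>2 \<le> (gnorm z f)\<^sup>2"
    unfolding gnorm_sq[OF z f]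
    using rest zero_le_power2[of "norm2 f"] zero_le_power2[of "norm2 (T0 f)"] by linarith+
  then have le: "norm2 f \<le> gnorm z f" "norm2 (T0 f) \<le> gnorm z f"
    using g0 power2_le_imp_le by blast+
  have "norm2 (T0 f - cnj z *\<^sub>C f) \<le> norm2 (T0 f) + cmod z * norm2 f"
    using ell2.norm_triangle[of "T0 f" "(- cnj z) *\<^sub>C f"] ell2.norm_scale[of f "- cnj z"] f by simp
  also have "\<dots> \<le> gnorm z f + cmod z * gnorm z f"
    using le by (intro add_mono mult_left_mono) auto
  finally show ?thesis
    by (simp add: distrib_right)
qed

text \<open>
  The kernel of \<open>\<Gamma>\<close> is dense, and the resolvent carries this density over to the graph norm.
\<close>

lemma case_I_TT:
  assumes triv: "\<And>w. w \<in> l2 \<Longrightarrow> (\<And>k. k \<in> ker\<Gamma> \<Longrightarrow> ip ell2 k w = 0) \<Longrightarrow> w = 0"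
    and z: "Im z > 0"
  shows "case_I KK (TT z)"
proof -
  interpret G: inner_product "graph_space KK KK (TT z)"
    by (rule graph_inner)
  define D where "D = {f \<in> opdom T. T0 f - cnj z *\<^sub>C f \<in> ker\<Gamma>}"
  have D: "opdom_square (TT z) = lift z ` D"
    by (simp add: D_def opdom_square_TT[OF z])
  have dense: "dense_in KK (opdom_square (TT z))"
    unfolding opdom_square_TT[OF z]
  proof (rule dense_lift[OF z kernel_subspace kernel_l2])
    fix v
    assume "v \<in> l2" "\<And>k. k \<in> ker\<Gamma> \<Longrightarrow> ip ell2 k (R v) = 0"
    then show "v = 0"
      using triv[of "R v"] by simp
  qed
  have kernel_dense: "dense_in ell2 ker\<Gamma>"
    by (rule ell2.dense_in_if_orthogonal_trivial[OF kernel_subspace kernel_l2 triv])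
  obtain M where M: "M > 0" "\<And>f. f \<in> opdom T \<Longrightarrow> gnorm z f \<le> M * norm2 (T0 f - cnj z *\<^sub>C f)"
    using gnorm_le[OF z] by blast
  have core: "dense_in (graph_space KK KK (TT z)) (lift z ` D)"
    unfolding G.dense_in_iff carr_graph opdom_TT
  proof (intro conjI ballI allI impI)
    show "lift z ` D \<subseteq> lift z ` opdom T"
      by (auto simp: D_def)
    fix u and e :: real
    assume "u \<in> lift z ` opdom T" and e: "e > 0"
    then obtain f where f: "f \<in> opdom T" and u: "u = lift z f"
      by blast
    define k where "k = T0 f - cnj z *\<^sub>C f"
    have "k \<in> l2"
      using f by (simp add: k_def)
    then obtain k' where k': "k' \<in> ker\<Gamma>" "norm2 (k - k') < e / M"
      using kernel_dense e M(1) unfolding ell2.dense_in_iff by (meson divide_pos_pos)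
    obtain g where g: "R g \<in> opdom T" "T0 (R g) - cnj z *\<^sub>C R g = k'"
      using resolvent_exists[OF z, of k'] k'(1) kernel_l2 by blast
    have gD: "R g \<in> D"
      using g k' by (simp add: D_def)
    have "T0 (f - R g) - cnj z *\<^sub>C (f - R g) = k - k'"
      using f g(1) by (simp add: g(2)[symmetric] k_def T0_diff complex_vector.scale_right_diff_distrib)
    then have "gnorm z (f - R g) \<le> M * norm2 (k - k')"
      using M(2)[of "f - R g"] f g(1) by simp
    also have "\<dots> < e"
      using k'(2) M(1) by (simp add: pos_less_divide_eq mult.commute)
    finally have "ip_norm (graph_space KK KK (TT z)) (u - lift z (R g)) < e"
      unfolding u lift_diff[OF f g(1)] .
    then show "\<exists>s\<in>lift z ` D. ip_norm (graph_space KK KK (TT z)) (u - s) < e"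
      using gD by blast
  qed
  show ?thesis
    unfolding case_I_def is_core_def
  proof (intro conjI dense)
    have "complex_vector.subspace D"
      unfolding D_def by (rule subspace_preimage[OF kernel_subspace])
    then show "complex_vector.subspace (opdom_square (TT z))"
      unfolding D by (rule subspace_lift) (auto simp: D_def)
    show "opdom_square (TT z) \<subseteq> opdom (TT z)"
      by (auto simp: opdom_square_def)
    show "dense_in (graph_space KK KK (TT z)) (opdom_square (TT z))"
      unfolding D by (rule core)
  qed
qed

text \<open>
  The functional \<open>f \<mapsto> (T f - cnj z f, w)\<close> is continuous in the graph norm and vanishes on the domain
  of the square, but takes the value \<open>\<parallel>w\<parallel>\<^sup>2\<close> at the solution of \<open>T f - cnj z f = w\<close>.
\<close>

lemma case_II_TT:
  assumes triv: "\<And>v. v \<in> l2 \<Longrightarrow> (\<And>k. k \<in> ker\<Gamma> \<Longrightarrow> ip ell2 k (R v) = 0) \<Longrightarrow> v = 0"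
    and w: "w \<in> l2" "w \<noteq> 0" "\<And>k. k \<in> ker\<Gamma> \<Longrightarrow> ip ell2 k w = 0"
    and z: "Im z > 0"
  shows "case_II KK (TT z)"
  unfolding case_II_def
proof
  interpret G: inner_product "graph_space KK KK (TT z)"
    by (rule graph_inner)
  show "dense_in KK (opdom_square (TT z))"
    unfolding opdom_square_TT[OF z] by (rule dense_lift[OF z kernel_subspace kernel_l2 triv])
  show "\<not> is_core KK KK (TT z) (opdom_square (TT z))"
  proof
    assume "is_core KK KK (TT z) (opdom_square (TT z))"
    then have D: "dense_in (graph_space KK KK (TT z)) (opdom_square (TT z))"
      by (simp add: is_core_def)
    obtain g where g: "R g \<in> opdom T" "T0 (R g) - cnj z *\<^sub>C R g = w"
      using resolvent_exists[OF z w(1)] by blast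
    have nw: "norm2 w > 0"
      using w ell2.norm_ge_0[OF w(1)] by (simp add: less_le)
    have pos: "1 + cmod z > 0"
      by (simp add: add_pos_nonneg)
    have "lift z (R g) \<in> opdom (TT z)"
      by (rule lift_dom[OF g(1)])
    then obtain s where s: "s \<in> opdom_square (TT z)"
        "ip_norm (graph_space KK KK (TT z)) (lift z (R g) - s) < norm2 w / (1 + cmod z)"
      using D nw pos unfolding G.dense_in_iff carr_graph by (meson divide_pos_pos)
    then obtain f where f: "f \<in> opdom T" "T0 f - cnj z *\<^sub>C f \<in> ker\<Gamma>" and s_eq: "s = lift z f"
      by (auto simp: opdom_square_TT[OF z])
    define k where "k = T0 f - cnj z *\<^sub>C f"
    have k: "k \<in> l2" "ip ell2 k w = 0"
      using f w kernel_l2 by (auto simp: k_def)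
    have "gnorm z (R g - f) < norm2 w / (1 + cmod z)"
      using s(2) unfolding s_eq lift_diff[OF g(1) f(1)] .
    then have lt: "(1 + cmod z) * gnorm z (R g - f) < norm2 w"
      using pos by (simp add: pos_less_divide_eq mult.commute)
    have "T0 (R g - f) - cnj z *\<^sub>C (R g - f) = w - k"
      using f g(1) by (simp add: g(2)[symmetric] k_def T0_diff complex_vector.scale_right_diff_distrib)
    then have "norm2 (w - k) \<le> (1 + cmod z) * gnorm z (R g - f)"
      using gnorm_ge[OF z, of "R g - f"] f(1) g(1) by simp
    with lt have lt: "norm2 (w - k) < norm2 w"
      by simp
    have "ip ell2 (w - k) w = complex_of_real ((norm2 w)\<^sup>2)"
      using w k by (simp add: ell2.ip_diff_left ell2.ip_self)
    then have "(norm2 w)\<^sup>2 \<le> norm2 (w - k) * norm2 w"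
      using ell2.Cauchy_Schwarz[of "w - k" w] w k by (simp add: norm_power)
    then have "norm2 w \<le> norm2 (w - k)"
      using nw by (simp add: power2_eq_square)
    with lt show False
      by simp
  qed
qed

text \<open>
  The argument of \<open>dense_lift\<close> read backwards: for \<open>v = e\<^sub>j\<close>, whose image under \<open>R\<close> is orthogonal to
  the kernel, the adjoint resolvent operator applied to \<open>v\<close> has the form \<open>R p - c K' q\<close>, because
  \<open>v = R (Q v)\<close>.  The pair \<open>(p, q)\<close> is then orthogonal to the domain of the square.
\<close>

lemma case_III_TT:
  assumes f0: "f0 \<in> ker\<Gamma>" "f0 \<noteq> 0" and j: "\<And>k. k \<in> ker\<Gamma> \<Longrightarrow> k j = 0" and z: "Im z > 0"
  shows "case_III KK (TT z)"
  unfolding case_III_def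
proof
  obtain g where g: "R g \<in> opdom T" "T0 (R g) - cnj z *\<^sub>C R g = f0"
    using resolvent_exists[OF z, of f0] f0(1) kernel_l2 by blast
  have "T0 0 = 0"
    using T0_scale[of 0 0] by simp
  then have "R g \<noteq> 0"
    using g(2) f0(2) by (metis complex_vector.scale_zero_right diff_zero)
  then have "lift z (R g) \<noteq> 0"
    by (auto simp: zero_prod_def)
  moreover have "lift z (R g) \<in> opdom_square (TT z)"
    unfolding opdom_square_TT[OF z] using g f0 by (intro imageI) simp
  ultimately show "opdom_square (TT z) \<noteq> {0}"
    by blast
  define c where "c = 1 / complex_of_real (sqrt (Im z))"
  have c: "cnj c = c" "c \<noteq> 0"
    using z by (simp_all add: c_def)
  define v where "v = unit j"
  define p where "p = Q v - z *\<^sub>C R v"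
  define q where "q = (1 / c) *\<^sub>C (\<i> *\<^sub>C K v)"
  have "complex_of_real (1 / r j) *\<^sub>C v = Q v" "complex_of_real (r j) *\<^sub>C v = R v"
    by (auto simp: v_def diag_def unit_def fun_eq_iff)
  then have v: "v \<in> l2" "Q v \<in> l2"
    using ell2.carr_scale[OF unit_l2[of j], of "complex_of_real (1 / r j)"] by (simp_all add: v_def)
  have p: "p \<in> l2" and q: "q \<in> l2"
    using v by (simp_all add: p_def q_def)
  have cq: "c *\<^sub>C q = \<i> *\<^sub>C K v"
    using c by (simp add: q_def scaleC_scaleC scaleC_one)
  have "R p - K' (c *\<^sub>C q) = A (- \<i>) z v"
    unfolding cq p_def A_def using v by (simp add: R_diff R_scale K'_scale)
  moreover have "p \<noteq> 0"
  proof
    assume "p = 0"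
    then have "p j = 0"
      by simp
    then have "complex_of_real (1 / r j) - z * complex_of_real (r j) = 0"
      by (simp add: p_def v_def diag_def unit_def)
    then have "Im (complex_of_real (1 / r j) - z * complex_of_real (r j)) = 0"
      by simp
    then show False
      using z r_pos[of j] by simp
  qed
  ultimately have pq: "R p - K' (c *\<^sub>C q) = A (- \<i>) z v" "(p, q) \<noteq> 0"
    by (auto simp: zero_prod_def)
  show "\<not> dense_in KK (opdom_square (TT z))"
  proof (rule inner_product.not_dense_inI[OF KK_inner _ pq(2)])
    show "(p, q) \<in> carr KK"
      using p q by (simp add: carr_KK)
    fix s
    assume "s \<in> opdom_square (TT z)"
    then obtain f where f: "f \<in> opdom T" and fN: "T0 f - cnj z *\<^sub>C f \<in> ker\<Gamma>" and s: "s = lift z f"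
      by (auto simp: opdom_square_TT[OF z])
    define k where "k = T0 f - cnj z *\<^sub>C f"
    have Ak: "A \<i> (cnj z) (Q f) = R k"
      unfolding A_def by (simp add: R_T0[symmetric] k_def R_diff R_scale)
    have "ip KK s (p, q) = ip ell2 (R (Q f)) p + ip ell2 ((- c) *\<^sub>C K (Q f)) q"
      by (simp add: s app_\<Gamma> c_def)
    also have "\<dots> = ip ell2 (Q f) (R p) - ip ell2 (Q f) (K' (c *\<^sub>C q))"
      using f p q c by (simp add: R_self_adjoint[of "Q f" p, simplified] ell2.ip_scale_left[of "K (Q f)" q "- c"] ell2.ip_scale_right
          adjoint[symmetric] del: complex_vector.scale_minus_left)
    also have "\<dots> = ip ell2 (Q f) (A (- \<i>) z v)"
      using f p q by (simp add: pq(1)[symmetric] ell2.ip_diff_right)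
    also have "\<dots> = ip ell2 (R k) v"
      using A_adjoint[OF dom_Q[OF f] v(1), of \<i> "cnj z"] by (simp add: Ak)
    also have "\<dots> = R k j"
      unfolding v_def by (rule ip_unit_right)
    also have "\<dots> = 0"
      using j[OF fN] by (simp add: k_def diag_def)
    finally show "ip KK s (p, q) = 0" .
  qed
qed

lemma case_IV_TT:
  assumes N0: "ker\<Gamma> = {0}" and z: "Im z > 0"
  shows "case_IV KK (TT z)"
proof -
  have T00: "T0 0 = 0"
    using T0_scale[of 0 0] by simp
  have "f = 0" if f: "f \<in> opdom T" and eq: "T0 f - cnj z *\<^sub>C f \<in> ker\<Gamma>" for f
  proof -
    have "norm2 (T0 f - cnj z *\<^sub>C f) = 0"
      using eq N0 by simp
    then have "Im z * norm2 f \<le> 0"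
      using resolvent_estimate(1)[OF z f] by simp
    then have "norm2 f \<le> 0"
      using z by (simp add: mult_le_0_iff)
    then have "norm2 f = 0"
      using ell2.norm_ge_0[OF dom_l2[OF f]] by linarith
    then show ?thesis
      using ell2.norm_eq_0[OF dom_l2[OF f]] by simp
  qed
  then have "{f \<in> opdom T. T0 f - cnj z *\<^sub>C f \<in> ker\<Gamma>} = {0}"
    using N0 T00 by auto
  moreover have "lift z 0 = 0"
    using \<Gamma>_scale[of 0 0] by (simp add: zero_prod_def)
  ultimately show ?thesis
    unfolding case_IV_def opdom_square_TT[OF z] by simp
qed

lemma realizes:
  assumes "0 < \<alpha>" "\<alpha> < pi/2" "b\<^sup>2 \<le> tan \<alpha>" and C: "\<And>z. Im z > 0 \<Longrightarrow> C KK (TT z)"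
  shows "\<exists>H T E \<Gamma>. admissible H T E \<Gamma> \<and> (\<forall>z\<in>\<complex>\<^sub>+. C (H \<oplus>\<^sub>H E) (assoc_op T \<Gamma> z)) \<and>
    (\<forall>z. Arg z \<in> {0<..<pi - \<alpha>} \<longrightarrow> nonnegative_operator (H \<oplus>\<^sub>H E) (assoc_op T \<Gamma> z))"
  using admissible C nonnegative_TT[OF assms(1-3)] unfolding upper_half_plane_def by blast

end

section \<open>Operators with dyadically decaying kernels\<close>

definition kernel_op :: "(nat \<Rightarrow> nat \<Rightarrow> real) \<Rightarrow> (nat \<Rightarrow> complex) \<Rightarrow> nat \<Rightarrow> complex" where
  "kernel_op k f = (\<lambda>m. \<Sum>n. complex_of_real (k m n) * f n)"

text \<open>
  A product bound on the kernel gives boundedness and absolute convergence of all double series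
  at once; a small constant \<open>c\<close> gives a small operator norm.
\<close>

definition dyadic :: "(nat \<Rightarrow> nat \<Rightarrow> real) \<Rightarrow> real \<Rightarrow> bool" where
  "dyadic k c \<longleftrightarrow> (\<forall>m n. \<bar>k m n\<bar> \<le> c * (1/2)^m * (1/2)^n)"

lemma dyadicD: "dyadic k c \<Longrightarrow> \<bar>k m n\<bar> \<le> c * (1/2)^m * (1/2)^n"
  by (simp add: dyadic_def)

lemma dyadic_transpose: "dyadic k c \<Longrightarrow> dyadic (\<lambda>m n. k n m) c"
  unfolding dyadic_def by (metis mult.assoc mult.commute)

lemma dyadic_nonneg: "dyadic k c \<Longrightarrow> c \<ge> 0"
  using dyadicD[of k c 0 0] by simp

context
  fixes k :: "nat \<Rightarrow> nat \<Rightarrow> real" and c :: real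
  assumes dyadic: "dyadic k c"
begin

lemma kernel_term_le:
  assumes "f \<in> l2"
  shows "cmod (complex_of_real (k m n) * f n) \<le> c * ip_norm ell2 f * (1/2)^m * (1/2)^n"
proof -
  have "cmod (complex_of_real (k m n) * f n) \<le> (c * (1/2)^m * (1/2)^n) * ip_norm ell2 f"
    unfolding norm_mult norm_of_real
    using dyadicD[OF dyadic] norm_coordinate_le[OF assms] dyadic_nonneg[OF dyadic]
    by (intro mult_mono) auto
  then show ?thesis
    by (simp add: mult_ac)
qed

lemma kernel_norm_summable: "f \<in> l2 \<Longrightarrow> summable (\<lambda>n. cmod (complex_of_real (k m n) * f n))"
  by (rule summable_comparison_test'[where g = "\<lambda>n. c * ip_norm ell2 f * (1/2)^m * (1/2)^n" and N = 0])
    (use kernel_term_le in \<open>auto intro!: summable_mult summable_geometric\<close>)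

lemma kernel_summable: "f \<in> l2 \<Longrightarrow> summable (\<lambda>n. complex_of_real (k m n) * f n)"
  by (rule summable_norm_cancel[OF kernel_norm_summable])

lemma kernel_norm_sum_le:
  assumes "f \<in> l2"
  shows "(\<Sum>n. cmod (complex_of_real (k m n) * f n)) \<le> 2 * c * ip_norm ell2 f * (1/2)^m"
proof -
  have "(\<Sum>n. cmod (complex_of_real (k m n) * f n)) \<le> (\<Sum>n. c * ip_norm ell2 f * (1/2)^m * (1/2)^n)"
    by (intro suminf_le kernel_term_le kernel_norm_summable summable_mult summable_geometric assms) auto
  also have "\<dots> = c * ip_norm ell2 f * (1/2)^m * 2"
    by (subst suminf_mult) (auto intro!: summable_geometric simp: suminf_geometric)
  finally show ?thesis
    by (simp add: mult_ac)
qed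

lemma kernel_op_le: "f \<in> l2 \<Longrightarrow> cmod (kernel_op k f m) \<le> 2 * c * ip_norm ell2 f * (1/2)^m"
  unfolding kernel_op_def
  using summable_norm[OF kernel_norm_summable] kernel_norm_sum_le by (meson order_trans)

lemma kernel_op_sq_sum:
  assumes f: "f \<in> l2"
  shows "(\<Sum>m<M. (cmod (kernel_op k f m))\<^sup>2) \<le> (4 * c * ip_norm ell2 f)\<^sup>2"
proof -
  define a where "a = 2 * c * ip_norm ell2 f"
  have "(cmod (kernel_op k f m))\<^sup>2 \<le> a\<^sup>2 * (1/4)^m" for m
  proof -
    have "(cmod (kernel_op k f m))\<^sup>2 \<le> (a * (1/2)^m)\<^sup>2"
      using kernel_op_le[OF f, of m] by (intro power_mono) (auto simp: a_def)
    also have "\<dots> = a\<^sup>2 * (1/4)^m"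
      by (simp add: power_mult_distrib power2_eq_square power_divide flip: power_mult_distrib)
    finally show ?thesis .
  qed
  then have "(\<Sum>m<M. (cmod (kernel_op k f m))\<^sup>2) \<le> (\<Sum>m<M. a\<^sup>2 * (1/4)^m)"
    by (rule sum_mono)
  also have "\<dots> = a\<^sup>2 * (\<Sum>m<M. (1/4)^m)"
    by (simp add: sum_distrib_left)
  also have "(\<Sum>m<M. (1/4)^m) \<le> (\<Sum>m. (1/4::real)^m)"
    by (intro sum_le_suminf summable_geometric) auto
  also have "(\<Sum>m. (1/4::real)^m) \<le> 4"
    by (subst suminf_geometric) auto
  finally have "(\<Sum>m<M. (cmod (kernel_op k f m))\<^sup>2) \<le> a\<^sup>2 * 4"
    by (simp add: mult_left_mono)
  then show ?thesis
    by (simp add: a_def power_mult_distrib)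
qed

lemma kernel_op_l2: "f \<in> l2 \<Longrightarrow> kernel_op k f \<in> l2"
  and kernel_op_bound: "f \<in> l2 \<Longrightarrow> ip_norm ell2 (kernel_op k f) \<le> 4 * c * ip_norm ell2 f"
  using l2_bounded_by[of "kernel_op k f" "4 * c * ip_norm ell2 f", OF kernel_op_sq_sum]
    dyadic_nonneg[OF dyadic] by simp_all

lemma kernel_op_add: "f \<in> l2 \<Longrightarrow> g \<in> l2 \<Longrightarrow> kernel_op k (f + g) = kernel_op k f + kernel_op k g"
  by (simp add: kernel_op_def fun_eq_iff distrib_left suminf_add[OF kernel_summable kernel_summable])

lemma kernel_op_scale: "f \<in> l2 \<Longrightarrow> kernel_op k (a *\<^sub>C f) = a *\<^sub>C kernel_op k f"
  by (simp add: kernel_op_def fun_eq_iff mult.left_commute suminf_mult[OF kernel_summable])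

end

lemma kernel_op_unit: "kernel_op k (unit n) m = complex_of_real (k m n)"
proof -
  have "kernel_op k (unit n) m = (\<Sum>i\<in>{n}. complex_of_real (k m i) * unit n i)"
    unfolding kernel_op_def by (rule suminf_finite) (auto simp: unit_def)
  then show ?thesis
    by (simp add: unit_def)
qed

lemma infsum_eq_suminf_of_norm_summable:
  fixes f :: "nat \<Rightarrow> complex"
  assumes "summable (\<lambda>n. norm (f n))"
  shows "infsum f UNIV = suminf f"
proof -
  have "f summable_on UNIV"
    by (rule norm_summable_imp_summable_on[OF assms])
  then have "f sums infsum f UNIV"
    by (intro has_sum_imp_sums has_sum_infsum)
  then show ?thesis
    by (rule sums_unique)
qed

text \<open>The double series defining both sides converges absolutely, so Fubini applies.\<close>

lemma kernel_op_adjoint: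
  assumes dyadic: "dyadic k c" and f: "f \<in> l2" and q: "q \<in> l2"
  shows "ip ell2 (kernel_op k f) q = ip ell2 f (kernel_op (\<lambda>m n. k n m) q)"
proof -
  define F where "F m n = complex_of_real (k m n) * f n * cnj (q m)" for m n
  note dyadic' = dyadic_transpose[OF dyadic]
  have row: "summable (\<lambda>n. norm (F m n))" for m
    using summable_mult2[OF kernel_norm_summable[OF dyadic f], where c = "cmod (q m)"]
    by (simp add: F_def norm_mult)
  have col: "summable (\<lambda>m. norm (F m n))" for n
    using summable_mult[OF kernel_norm_summable[OF dyadic' q], where c = "cmod (f n)"]
    by (simp add: F_def norm_mult mult_ac)
  have rows: "(\<Sum>n. F m n) = kernel_op k f m * cnj (q m)" for m
    using suminf_mult2[OF kernel_summable[OF dyadic f], where c = "cnj (q m)"] by (simp add: F_def kernel_op_def)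
  have cols: "(\<Sum>m. F m n) = f n * cnj (kernel_op (\<lambda>m n. k n m) q n)" for n
  proof -
    have "(\<lambda>m. cnj (complex_of_real (k m n) * q m)) sums cnj (kernel_op (\<lambda>m n. k n m) q n)"
      unfolding kernel_op_def sums_cnj by (rule summable_sums[OF kernel_summable[OF dyadic' q]])
    then have "(\<lambda>m. f n * cnj (complex_of_real (k m n) * q m)) sums (f n * cnj (kernel_op (\<lambda>m n. k n m) q n))"
      by (rule sums_mult)
    then show ?thesis
      by (simp add: F_def sums_iff mult_ac)
  qed
  have "(\<lambda>p. norm (case p of (m, n) \<Rightarrow> F m n)) summable_on (UNIV \<times> UNIV)"
    unfolding Infinite_Sum.abs_summable_on_Sigma_iff
  proof (intro conjI ballI)
    show "(\<lambda>n. norm (case (m, n) of (m, n) \<Rightarrow> F m n)) summable_on UNIV" for m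
      using row[of m] by (simp add: summable_on_UNIV_nonneg_real_iff)
    have eq: "(\<Sum>\<^sub>\<infinity>n. norm (case (m, n) of (m, n) \<Rightarrow> F m n)) = (\<Sum>n. norm (F m n))" for m
      using row[of m] has_sum_imp_sums[OF has_sum_infsum, of "\<lambda>n. norm (F m n)"]
      by (simp add: summable_on_UNIV_nonneg_real_iff sums_iff)
    have "summable (\<lambda>m. norm (\<Sum>n. norm (F m n)))"
    proof (rule summable_comparison_test')
      show "summable (\<lambda>m. 2 * c * ip_norm ell2 f * ip_norm ell2 q * (1/2)^m)"
        by (intro summable_mult summable_geometric) auto
      fix m
      have "(\<Sum>n. norm (F m n)) = (\<Sum>n. cmod (complex_of_real (k m n) * f n)) * cmod (q m)"
        using suminf_mult2[OF kernel_norm_summable[OF dyadic f], where c = "cmod (q m)"]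
        by (simp add: F_def norm_mult)
      also have "\<dots> \<le> (2 * c * ip_norm ell2 f * (1/2)^m) * ip_norm ell2 q"
        using kernel_norm_sum_le[OF dyadic f] norm_coordinate_le[OF q] dyadic_nonneg[OF dyadic] f
        by (intro mult_mono) auto
      finally show "norm (norm (\<Sum>n. norm (F m n))) \<le> 2 * c * ip_norm ell2 f * ip_norm ell2 q * (1/2)^m"
        using suminf_nonneg[OF row[of m]] by (simp add: mult_ac)
    qed
    then show "(\<lambda>m. norm (\<Sum>\<^sub>\<infinity>n. norm (case (m, n) of (m, n) \<Rightarrow> F m n))) summable_on UNIV"
      unfolding eq by (simp add: summable_on_UNIV_nonneg_real_iff)
  qed
  then have "(\<Sum>\<^sub>\<infinity>m. \<Sum>\<^sub>\<infinity>n. F m n) = (\<Sum>\<^sub>\<infinity>n. \<Sum>\<^sub>\<infinity>m. F m n)"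
    by (rule infsum_swap_banach[OF abs_summable_summable])
  also have "(\<Sum>\<^sub>\<infinity>m. \<Sum>\<^sub>\<infinity>n. F m n) = (\<Sum>\<^sub>\<infinity>m. kernel_op k f m * cnj (q m))"
    by (simp add: infsum_eq_suminf_of_norm_summable[OF row] rows)
  also have "\<dots> = ip ell2 (kernel_op k f) q"
    unfolding ip_ell2 using summable_l2_mult[OF kernel_op_l2[OF dyadic f] q]
    by (intro infsum_eq_suminf_of_norm_summable) (simp add: norm_mult)
  also have "(\<Sum>\<^sub>\<infinity>n. \<Sum>\<^sub>\<infinity>m. F m n) = (\<Sum>\<^sub>\<infinity>n. f n * cnj (kernel_op (\<lambda>m n. k n m) q n))"
    by (simp add: infsum_eq_suminf_of_norm_summable[OF col] cols)
  also have "\<dots> = ip ell2 f (kernel_op (\<lambda>m n. k n m) q)"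
    unfolding ip_ell2 using summable_l2_mult[OF f kernel_op_l2[OF dyadic' q]]
    by (intro infsum_eq_suminf_of_norm_summable) (simp add: norm_mult)
  finally show ?thesis .
qed

lemma sectorial_model_kernel:
  assumes dyadic: "dyadic k c"
    and r: "\<And>n. 0 < r n" "\<And>n. r n \<le> (1/2)^n"
    and disj: "\<And>p q. p \<in> l2 \<Longrightarrow> q \<in> l2 \<Longrightarrow> diag r p = kernel_op (\<lambda>m n. k n m) q \<Longrightarrow> q = 0"
  shows "sectorial_model r (kernel_op k) (kernel_op (\<lambda>m n. k n m)) (4 * c)"
proof -
  note dyadic' = dyadic_transpose[OF dyadic]
  show ?thesis
    by unfold_locales
      (auto intro: r disj kernel_op_l2[OF dyadic] kernel_op_l2[OF dyadic'] kernel_op_add[OF dyadic]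
        kernel_op_add[OF dyadic'] kernel_op_scale[OF dyadic] kernel_op_scale[OF dyadic']
        kernel_op_bound[OF dyadic] kernel_op_bound[OF dyadic'] kernel_op_adjoint[OF dyadic])
qed

section \<open>A block kernel: the first two cases\<close>

definition block :: "nat \<Rightarrow> nat" where
  "block n = fst (prod_decode n)"

lemma block_prod_encode [simp]: "block (prod_encode (m, j)) = m"
  by (simp add: block_def)

lemma block_le: "block n \<le> n"
  by (metis block_def le_prod_encode_1 prod.collapse prod_decode_inverse)

text \<open>Blocks are infinite and square summable sequences tend to \<open>0\<close>.\<close>

lemma block_constant_eq_0:
  assumes f: "f \<in> l2" and const: "\<And>n. block n = m \<Longrightarrow> f n = a"
  shows "a = 0"
proof -
  have "filterlim (\<lambda>j. prod_encode (m, j)) at_top sequentially"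
    by (rule filterlim_at_top_mono[OF filterlim_ident]) (simp add: le_prod_encode_2)
  then have "(\<lambda>j. f (prod_encode (m, j))) \<longlonglongrightarrow> 0"
    by (rule filterlim_compose[OF l2_tendsto_0[OF f]])
  then have "(\<lambda>j. a) \<longlonglongrightarrow> 0"
    by (simp add: const)
  then show ?thesis
    using LIMSEQ_unique tendsto_const by blast
qed

definition block_sum_kernel :: "nat \<Rightarrow> nat \<Rightarrow> real" where
  "block_sum_kernel m n = (if block n = m then (1/4)^n else 0)"

text \<open>
  Writing \<open>\<sigma>\<^sub>m\<close> for the sum with kernel \<open>block_sum_kernel\<close>, the operator is
  \<open>f \<mapsto> \<epsilon> (\<sigma>\<^sub>m f - \<sigma>\<^bsub>m+1\<^esub> f)\<close>.  It annihilates \<open>f\<close> only if all \<open>\<sigma>\<^sub>m f\<close> vanish, since \<open>\<sigma>\<^sub>m f\<close>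
  tends to \<open>0\<close>.  The differences
  keep the vector \<open>4\<^bsup>-n\<^esup>\<close> supported on the block \<open>0\<close> out of the range of the adjoint: it would have
  to be the image of a constant sequence.  In the second case this vector lies in the range of \<open>R\<close>.
\<close>

definition block_kernel :: "real \<Rightarrow> nat \<Rightarrow> nat \<Rightarrow> real" where
  "block_kernel \<epsilon> m n = \<epsilon> * (block_sum_kernel m n - block_sum_kernel (Suc m) n)"

text \<open>
  The flag marks a block on which \<open>R\<close> decays more slowly than \<open>4\<^bsup>-n\<^esup>\<close>.  On the other blocks
  \<open>4\<^bsup>-n\<^esup>\<close> is the image under \<open>R\<close> of a constant, which is not square summable; on the marked block it
  is the image of \<open>2\<^bsup>-n\<^esup>\<close>, which is square summable but not in the range of \<open>R\<close>.
\<close>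

definition block_weight :: "bool \<Rightarrow> nat \<Rightarrow> real" where
  "block_weight s n = (if s \<and> block n = 0 then (1/2)^n else (1/4)^n)"

lemma quarter_power: "(1/4::real)^n = (1/2)^n * (1/2)^n"
  by (simp flip: power_mult_distrib)

lemma dyadic_block_sum: "dyadic block_sum_kernel 1"
  unfolding dyadic_def block_sum_kernel_def
  using power_decreasing[OF block_le, of "1/2::real"] by (auto simp: quarter_power intro: mult_right_mono)

lemma dyadic_block:
  assumes "\<epsilon> > 0"
  shows "dyadic (block_kernel \<epsilon>) (2 * \<epsilon>)"
  unfolding dyadic_def
proof (intro allI)
  fix m n
  have "\<bar>block_sum_kernel m n\<bar> \<le> (1/2)^m * (1/2)^n" "\<bar>block_sum_kernel (Suc m) n\<bar> \<le> (1/2)^m * (1/2)^n"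
    using dyadicD[OF dyadic_block_sum, of m n] dyadicD[OF dyadic_block_sum, of "Suc m" n]
      zero_le_power[of "1/2::real" "m + n"] by (simp_all add: power_add)
  then have "\<bar>block_sum_kernel m n - block_sum_kernel (Suc m) n\<bar> \<le> 2 * ((1/2)^m * (1/2)^n)"
    by linarith
  then have "\<epsilon> * \<bar>block_sum_kernel m n - block_sum_kernel (Suc m) n\<bar> \<le> \<epsilon> * (2 * ((1/2)^m * (1/2)^n))"
    using assms by (intro mult_left_mono) auto
  then show "\<bar>block_kernel \<epsilon> m n\<bar> \<le> 2 * \<epsilon> * (1/2)^m * (1/2)^n"
    using assms by (simp add: block_kernel_def abs_mult mult_ac)
qed

lemma block_transpose:
  "kernel_op (\<lambda>m n. block_kernel \<epsilon> n m) q n =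
    complex_of_real (\<epsilon> * (1/4)^n) * (q (block n) - (if block n = 0 then 0 else q (block n - 1)))"
proof (cases "block n")
  case 0
  have "kernel_op (\<lambda>m n. block_kernel \<epsilon> n m) q n = (\<Sum>m\<in>{0}. complex_of_real (block_kernel \<epsilon> m n) * q m)"
    unfolding kernel_op_def
    by (rule suminf_finite) (auto simp: block_kernel_def block_sum_kernel_def 0)
  then show ?thesis
    by (simp add: block_kernel_def block_sum_kernel_def 0)
next
  case (Suc j)
  have "kernel_op (\<lambda>m n. block_kernel \<epsilon> n m) q n = (\<Sum>m\<in>{j, Suc j}. complex_of_real (block_kernel \<epsilon> m n) * q m)"
    unfolding kernel_op_def
    by (rule suminf_finite) (auto simp: block_kernel_def block_sum_kernel_def Suc)
  then show ?thesis
    by (simp add: block_kernel_def block_sum_kernel_def Suc algebra_simps)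
qed

lemma block_weight_pos: "0 < block_weight s n"
  and block_weight_le: "block_weight s n \<le> (1/2)^n"
  by (auto simp: block_weight_def intro!: power_mono)

lemma block_sectorial:
  assumes \<epsilon>: "\<epsilon> > 0"
  shows "sectorial_model (block_weight s) (kernel_op (block_kernel \<epsilon>))
    (kernel_op (\<lambda>m n. block_kernel \<epsilon> n m)) (4 * (2 * \<epsilon>))"
proof (rule sectorial_model_kernel[OF dyadic_block[OF \<epsilon>] block_weight_pos block_weight_le])
  fix p q
  assume p: "p \<in> l2" and q: "q \<in> l2"
    and eq: "diag (block_weight s) p = kernel_op (\<lambda>m n. block_kernel \<epsilon> n m) q"
  have step: "q (Suc m) = q m" for m
  proof -
    have "p n = complex_of_real \<epsilon> * (q (Suc m) - q m)" if n: "block n = Suc m" for n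
      using fun_cong[OF eq, of n] n by (simp add: diag_def block_weight_def block_transpose)
    then have "complex_of_real \<epsilon> * (q (Suc m) - q m) = 0"
      by (rule block_constant_eq_0[OF p])
    then show ?thesis
      using \<epsilon> by simp
  qed
  have const: "q m = q 0" for m
    by (induction m) (simp_all add: step)
  then have "q 0 = 0"
    using block_constant_eq_0[OF q, of 0 "q 0"] by blast
  then show "q = 0"
    using const by (auto simp: fun_eq_iff)
qed

context
  fixes \<epsilon> :: real and s :: bool
  assumes \<epsilon>: "\<epsilon> > 0"
begin

interpretation sectorial_model "block_weight s" "kernel_op (block_kernel \<epsilon>)"
    "kernel_op (\<lambda>m n. block_kernel \<epsilon> n m)" "4 * (2 * \<epsilon>)"
  by (rule block_sectorial[OF \<epsilon>])

text \<open>
  Two indices in the same block carry a vector supported on them that is annihilated by \<open>K\<close>;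
  orthogonality to its image under \<open>R\<close> links the two coordinates of \<open>w\<close>.
\<close>

lemma orthogonal_kernel_block_constant:
  assumes w: "w \<in> l2" and orth: "\<And>k. k \<in> ker\<Gamma> \<Longrightarrow> ip ell2 k w = 0" and eq: "block n = block n'"
  shows "complex_of_real (block_weight s n * 4^n) * w n = complex_of_real (block_weight s n' * 4^n') * w n'"
proof -
  define a a' where "a = complex_of_real ((1/4)^n)" and "a' = complex_of_real ((1/4)^n')"
  define k where "k = a' *\<^sub>C unit n - a *\<^sub>C unit n'"
  have k: "k \<in> l2"
    by (simp add: k_def)
  have "kernel_op (block_kernel \<epsilon>) k = 0"
    unfolding k_def
    by (simp add: K_diff K_scale fun_eq_iff kernel_op_unit block_kernel_def block_sum_kernel_def eq a_def a'_def)
  moreover have "Q k \<in> l2"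
    by (rule finite_support_l2[of "Suc (max n n')"]) (auto simp: k_def diag_def unit_def)
  ultimately have "R k \<in> ker\<Gamma>"
    unfolding kernel_eq by (intro CollectI exI[of _ "Q k"]) simp
  then have "0 = ip ell2 (R k) w"
    using orth by simp
  also have "\<dots> = ip ell2 k (R w)"
    by (rule R_self_adjoint)
  also have "\<dots> = a' * cnj (R w n) - a * cnj (R w n')"
    unfolding k_def using w by (simp add: ell2.ip_diff_left ell2.ip_scale_left ip_unit)
  finally have "a' * cnj (R w n) = a * cnj (R w n')"
    by simp
  then have "cnj (a' * cnj (R w n)) = cnj (a * cnj (R w n'))"
    by simp
  then have "a' * R w n = a * R w n'"
    by (simp add: a_def a'_def)
  then show ?thesis
    by (simp add: a_def a'_def diag_def field_simps)
qed

lemma case_I_block: "\<not> s \<Longrightarrow> Im z > 0 \<Longrightarrow> case_I KK (TT z)"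
proof (rule case_I_TT)
  fix w
  assume s: "\<not> s" and w: "w \<in> l2" and orth: "\<And>k. k \<in> ker\<Gamma> \<Longrightarrow> ip ell2 k w = 0"
  have const: "w n = w n'" if "block n = block n'" for n n'
    using orthogonal_kernel_block_constant[OF w orth that] s by (simp add: block_weight_def power_divide)
  then have "w n = 0" for n
    using block_constant_eq_0[OF w, of "block n" "w n"] by blast
  then show "w = 0"
    by (simp add: fun_eq_iff)
qed

lemma case_II_block: "s \<Longrightarrow> Im z > 0 \<Longrightarrow> case_II KK (TT z)"
proof -
  assume s: "s" and z: "Im z > 0"
  \<comment> \<open>The preimage under \<open>R\<close> of the weights \<open>4\<^bsup>-n\<^esup>\<close> on the marked block.\<close>
  define w :: "nat \<Rightarrow> complex" where "w = (\<lambda>n. if block n = 0 then complex_of_real ((1/2)^n) else 0)"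
  show ?thesis
  proof (rule case_II_TT[OF _ _ _ _ z])
    fix v
    assume v: "v \<in> l2" and orth: "\<And>k. k \<in> ker\<Gamma> \<Longrightarrow> ip ell2 k (R v) = 0"
    note const = orthogonal_kernel_block_constant[OF R_l2[OF v] orth]
    have "v n = 0" for n
    proof (cases "block n = 0")
      case True
      have "v i = v n" if "block i = 0" for i
        using const[of i n] that True s by (simp add: diag_def block_weight_def power_divide power_mult_distrib[symmetric])
      then show ?thesis
        using block_constant_eq_0[OF v, of 0 "v n"] by blast
    next
      case False
      have "R v i = R v n" if "block i = block n" for i
        using const[of i n] that False by (simp add: block_weight_def power_divide)
      then have "R v n = 0"
        using block_constant_eq_0[OF R_l2[OF v], of "block n" "R v n"] by blast
      then show ?thesis
        using block_weight_pos[of s n] by (simp add: diag_def)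
    qed
    then show "v = 0"
      by (simp add: fun_eq_iff)
  next
    show "w \<in> l2"
      unfolding l2_iff
    proof (rule summable_comparison_test')
      show "summable (\<lambda>n. (1/4::real)^n)"
        by (intro summable_geometric) auto
      show "norm ((cmod (w n))\<^sup>2) \<le> (1/4)^n" if "0 \<le> n" for n
        by (auto simp: w_def norm_power quarter_power power2_eq_square)
    qed
    have "w (prod_encode (0, 0)) \<noteq> 0"
      by (simp add: w_def)
    then show "w \<noteq> 0"
      by (metis zero_fun_apply)
    fix k
    assume "k \<in> ker\<Gamma>"
    then obtain h where h: "h \<in> l2" and Kh: "kernel_op (block_kernel \<epsilon>) (R h) = 0" and k: "k = R (R h)"
      by (auto simp: kernel_eq)
    define \<sigma> where "\<sigma> = kernel_op block_sum_kernel (R h)"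
    have \<sigma>: "\<sigma> \<in> l2"
      unfolding \<sigma>_def by (rule kernel_op_l2[OF dyadic_block_sum R_l2[OF h]])
    have "\<sigma> m = \<sigma> (Suc m)" for m
    proof -
      note sums = summable_sums[OF kernel_summable[OF dyadic_block_sum R_l2[OF h]]]
      have "(\<lambda>n. complex_of_real \<epsilon> * (complex_of_real (block_sum_kernel m n) * R h n
          - complex_of_real (block_sum_kernel (Suc m) n) * R h n)) sums (complex_of_real \<epsilon> * (\<sigma> m - \<sigma> (Suc m)))"
        unfolding \<sigma>_def kernel_op_def by (intro sums_mult sums_diff sums)
      then have "kernel_op (block_kernel \<epsilon>) (R h) m = complex_of_real \<epsilon> * (\<sigma> m - \<sigma> (Suc m))"
        unfolding kernel_op_def by (simp add: block_kernel_def sums_iff algebra_simps)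
      then show ?thesis
        using Kh \<epsilon> by simp
    qed
    then have "\<sigma> m = \<sigma> 0" for m
      by (induction m) simp_all
    then have "\<sigma> 0 = 0"
      using block_constant_eq_0[OF \<sigma>, of 0 "\<sigma> 0"] by blast
    moreover have "R (R h) n * cnj (w n) = complex_of_real (block_sum_kernel 0 n) * R h n" for n
    proof -
      have "R (R h) n = complex_of_real (block_weight s n) * R h n"
        by (simp add: diag_def)
      then show ?thesis
        using s by (simp add: w_def block_sum_kernel_def block_weight_def quarter_power mult_ac)
    qed
    ultimately show "ip ell2 k w = 0"
      by (simp add: k ip_ell2 \<sigma>_def kernel_op_def)
  qed
qed

end

section \<open>A moment kernel: the last two cases\<close>

text \<open>
  If \<open>a\<^sub>m x\<^sup>m\<close> is the first nonzero term, the series divided by \<open>x\<^sup>m\<close> tends to \<open>a\<^sub>m\<close> along the points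
  \<open>2\<^bsup>-(n+1)\<^esup>\<close>, yet it is at most of the order of \<open>x\<close>.
\<close>

lemma bounded_power_series_eq_0:
  fixes a :: "nat \<Rightarrow> complex"
  assumes bounded: "\<And>m. cmod (a m) \<le> B"
    and small: "\<And>j. \<exists>C N. \<forall>n\<ge>N. cmod (\<Sum>m. a m * complex_of_real ((1/2)^Suc n) ^ m) \<le> C * ((1/2)^Suc n)^j"
  shows "a = 0"
proof (rule ccontr)
  assume "a \<noteq> 0"
  then have ex: "\<exists>m. a m \<noteq> 0"
    by (auto simp: fun_eq_iff)
  define m0 where "m0 = (LEAST m. a m \<noteq> 0)"
  have m0: "a m0 \<noteq> 0"
    unfolding m0_def by (rule LeastI_ex[OF ex])
  have below: "a m = 0" if "m < m0" for m
    using not_less_Least[of m "\<lambda>m. a m \<noteq> 0"] that unfolding m0_def by blast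
  define x where "x n = complex_of_real ((1/2)^Suc n)" for n
  define G where "G w = (\<Sum>m. a (m + m0) * w ^ m)" for w
  have summable: "summable (\<lambda>m. a' m * w ^ m)" if "cmod w < 1" "\<And>m. cmod (a' m) \<le> B" for w and a' :: "nat \<Rightarrow> complex"
  proof (rule summable_comparison_test')
    show "summable (\<lambda>m. B * cmod w ^ m)"
      using that by (intro summable_mult summable_geometric) auto
    show "norm (a' m * w ^ m) \<le> B * cmod w ^ m" if "0 \<le> m" for m
      using \<open>\<And>m. cmod (a' m) \<le> B\<close> by (auto simp: norm_mult norm_power intro: mult_right_mono)
  qed
  have "(G \<longlongrightarrow> a (0 + m0)) (at 0)"
  proof (rule powser_limit_0[of 1 "\<lambda>m. a (m + m0)"])
    show "(\<lambda>m. a (m + m0) * w ^ m) sums G w" if "cmod w < 1" for w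
      unfolding G_def using summable[OF that, of "\<lambda>m. a (m + m0)"] bounded by (intro summable_sums) auto
  qed simp
  moreover have "filterlim x (at 0) sequentially"
  proof -
    have "(\<lambda>n. complex_of_real ((1/2)^Suc n)) \<longlonglongrightarrow> complex_of_real 0"
      by (intro tendsto_of_real LIMSEQ_Suc LIMSEQ_realpow_zero) auto
    then show ?thesis
      unfolding filterlim_at x_def by simp
  qed
  ultimately have lim: "(\<lambda>n. G (x n)) \<longlonglongrightarrow> a m0"
    using filterlim_compose by fastforce
  obtain C M where CM: "\<And>n. n \<ge> M \<Longrightarrow>
      cmod (\<Sum>m. a m * complex_of_real ((1/2)^Suc n) ^ m) \<le> C * ((1/2)^Suc n)^Suc m0"
    using small[of "Suc m0"] by blast
  have "cmod (G (x n)) \<le> C * (1/2)^Suc n" if n: "n \<ge> M" for n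
  proof -
    define \<xi> :: real where "\<xi> = (1/2)^Suc n"
    have \<xi>: "\<xi> > 0" "\<xi> < 1"
      using power_Suc_less_one[of "1/2::real" n] by (simp_all add: \<xi>_def)
    have cx: "cmod (x n) = \<xi>"
      unfolding x_def norm_of_real \<xi>_def[symmetric] using \<xi> by simp
    then have x1: "cmod (x n) < 1"
      using \<xi> by simp
    have "(\<Sum>m. a m * x n ^ m) = (\<Sum>m. a (m + m0) * x n ^ (m + m0)) + (\<Sum>m<m0. a m * x n ^ m)"
      by (rule suminf_split_initial_segment) (rule summable[OF x1 bounded])
    also have "(\<Sum>m<m0. a m * x n ^ m) = 0"
      by (simp add: below)
    also have "(\<Sum>m. a (m + m0) * x n ^ (m + m0)) = x n ^ m0 * G (x n)"
      unfolding G_def using summable[OF x1, of "\<lambda>m. a (m + m0)"] bounded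
      by (subst suminf_mult[symmetric]) (auto simp: power_add mult_ac)
    finally have "cmod (x n ^ m0 * G (x n)) \<le> C * \<xi>^Suc m0"
      using CM[OF n] by (simp only: x_def \<xi>_def add_0_right)
    then have "\<xi>^m0 * cmod (G (x n)) \<le> \<xi>^m0 * (C * \<xi>)"
      by (simp add: norm_mult norm_power cx mult_ac)
    then show ?thesis
      unfolding \<xi>_def[symmetric] by (rule mult_left_le_imp_le) (use \<xi> in simp)
  qed
  then have "eventually (\<lambda>n. norm (G (x n)) \<le> C * (1/2)^Suc n) sequentially"
    by (auto simp: eventually_sequentially)
  moreover have "(\<lambda>n. C * (1/2)^Suc n) \<longlonglongrightarrow> C * 0"
    by (intro tendsto_mult tendsto_const LIMSEQ_Suc LIMSEQ_realpow_zero) auto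
  ultimately have "(\<lambda>n. G (x n)) \<longlonglongrightarrow> 0"
    unfolding mult_zero_right by (rule Lim_null_comparison)
  then show False
    using LIMSEQ_unique[OF lim] m0 by blast
qed

text \<open>
  The \<open>m\<close>-th value is \<open>\<epsilon> x\<close> times the power series with coefficients \<open>f\<^sub>n\<close> at
  \<open>x = 2\<^bsup>-(m+1)\<^esup>\<close>.  Omitting the first \<open>d\<close> columns makes the operator annihilate the first \<open>d\<close> unit vectors.
\<close>

definition moment_kernel :: "real \<Rightarrow> nat \<Rightarrow> nat \<Rightarrow> nat \<Rightarrow> real" where
  "moment_kernel \<epsilon> d m n = (if n < d then 0 else \<epsilon> * (1/2)^(Suc m * Suc n))"

lemma dyadic_moment: "\<epsilon> > 0 \<Longrightarrow> dyadic (moment_kernel \<epsilon> d) \<epsilon>"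
  unfolding dyadic_def
proof (intro allI)
  fix m n
  assume \<epsilon>: "\<epsilon> > 0"
  have "(1/2::real)^(Suc m * Suc n) \<le> (1/2)^(m + n)"
    by (rule power_decreasing) auto
  then show "\<bar>moment_kernel \<epsilon> d m n\<bar> \<le> \<epsilon> * (1/2)^m * (1/2)^n"
    using \<epsilon> by (simp add: moment_kernel_def abs_mult power_add mult.assoc del: mult_Suc mult_Suc_right)
qed

text \<open>The exponents \<open>(m + 1)(n + 1)\<close> contribute one extra power of the point.\<close>

lemma moment_sum:
  assumes "f \<in> l2"
  shows "(\<Sum>n. complex_of_real ((1/2)^(Suc m * Suc n)) * f n)
    = complex_of_real ((1/2)^Suc m) * (\<Sum>n. f n * complex_of_real ((1/2)^Suc m) ^ n)"
proof -
  have eq: "complex_of_real ((1/2)^(Suc m * Suc n)) * f n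
      = complex_of_real ((1/2)^Suc m) * (f n * complex_of_real ((1/2)^Suc m) ^ n)" for n
    unfolding power_mult by (simp del: power_Suc add: power_Suc[of _ n])
  have "summable (\<lambda>n. complex_of_real ((1/2)^Suc m) * (f n * complex_of_real ((1/2)^Suc m) ^ n))"
    using kernel_summable[OF dyadic_moment[of 1 0] assms, of m] unfolding eq[symmetric]
    by (simp add: moment_kernel_def)
  then have "summable (\<lambda>n. f n * complex_of_real ((1/2)^Suc m) ^ n)"
    by (subst (asm) summable_cmult_iff) simp
  then show ?thesis
    unfolding eq by (rule suminf_mult)
qed

definition moment_weight :: "nat \<Rightarrow> real" where
  "moment_weight n = (1/2)^(n * n)"

lemma moment_weight_pos: "0 < moment_weight n"
  and moment_weight_le: "moment_weight n \<le> (1/2)^n"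
  by (auto simp: moment_weight_def intro!: power_decreasing)

text \<open>\<open>(n + 1)(j + 1) \<le> n\<^sup>2\<close> holds for \<open>n \<ge> j + 3\<close>, so the weight
  eventually lies below every power of the point \<open>2\<^bsup>-(n+1)\<^esup>\<close>.\<close>

lemma moment_weight_small:
  assumes "n \<ge> j + 3"
  shows "moment_weight n \<le> ((1/2)^Suc n)^Suc j"
proof -
  obtain i where n: "n = j + 3 + i"
    using assms le_Suc_ex by blast
  have "Suc n * Suc j \<le> n * n"
    by (simp add: n algebra_simps)
  then show ?thesis
    unfolding moment_weight_def power_mult[symmetric] by (intro power_decreasing) auto
qed

text \<open>
  If \<open>K' q = R p\<close>, then the power series with coefficients \<open>q\<close> at the points
  \<open>x = 2\<^bsup>-(n+1)\<^esup>\<close> is at most a constant times the weight divided by \<open>x\<close>, hence vanishes.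
\<close>

lemma moment_sectorial:
  assumes \<epsilon>: "\<epsilon> > 0"
  shows "sectorial_model moment_weight (kernel_op (moment_kernel \<epsilon> d))
    (kernel_op (\<lambda>m n. moment_kernel \<epsilon> d n m)) (4 * \<epsilon>)"
proof (rule sectorial_model_kernel[OF dyadic_moment[OF \<epsilon>] moment_weight_pos moment_weight_le])
  fix p q
  assume p: "p \<in> l2" and q: "q \<in> l2"
    and eq: "diag moment_weight p = kernel_op (\<lambda>m n. moment_kernel \<epsilon> d n m) q"
  define F where "F n = (\<Sum>m. q m * complex_of_real ((1/2)^Suc n) ^ m)" for n
  have F: "cmod (F n) \<le> ip_norm ell2 p / \<epsilon> * ((1/2)^Suc n)^j" if n: "n \<ge> max d (j + 3)" for n j
  proof -
    have "complex_of_real (moment_weight n) * p n = (\<Sum>m. complex_of_real \<epsilon> * (complex_of_real ((1/2)^(Suc n * Suc m)) * q m))"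
      using fun_cong[OF eq, of n] n
      by (simp add: diag_def kernel_op_def moment_kernel_def mult.assoc mult.commute[of "Suc _" "Suc n"] del: mult_Suc mult_Suc_right power_Suc)
    also have "\<dots> = complex_of_real \<epsilon> * (\<Sum>m. complex_of_real ((1/2)^(Suc n * Suc m)) * q m)"
      using kernel_summable[OF dyadic_moment[of 1 0] q, of n]
      by (intro suminf_mult) (simp add: moment_kernel_def)
    also have "\<dots> = complex_of_real \<epsilon> * (complex_of_real ((1/2)^Suc n) * F n)"
      unfolding F_def by (simp only: moment_sum[OF q])
    finally have "cmod (complex_of_real (moment_weight n) * p n) = cmod (complex_of_real \<epsilon> * (complex_of_real ((1/2)^Suc n) * F n))"
      by (rule arg_cong)
    then have "moment_weight n * cmod (p n) = \<epsilon> * ((1/2)^Suc n * cmod (F n))"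
      unfolding norm_mult norm_of_real using \<epsilon> moment_weight_pos[of n] by simp
    moreover have "moment_weight n * cmod (p n) \<le> ((1/2)^Suc n)^Suc j * ip_norm ell2 p"
      using moment_weight_small[of j n] n norm_coordinate_le[OF p] by (intro mult_mono) auto
    ultimately have "(1/2)^Suc n * (\<epsilon> * cmod (F n)) \<le> (1/2)^Suc n * (((1/2)^Suc n)^j * ip_norm ell2 p)"
      by (simp add: mult_ac)
    then have "\<epsilon> * cmod (F n) \<le> ((1/2)^Suc n)^j * ip_norm ell2 p"
      by (rule mult_left_le_imp_le) simp
    then show ?thesis
      using \<epsilon> by (simp add: pos_le_divide_eq mult_ac)
  qed
  show "q = 0"
  proof (rule bounded_power_series_eq_0[OF norm_coordinate_le[OF q]])
    show "\<exists>C M. \<forall>n\<ge>M. cmod (\<Sum>m. q m * complex_of_real ((1/2)^Suc n) ^ m) \<le> C * ((1/2)^Suc n)^j" for j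
      using F[of j] unfolding F_def by blast
  qed
qed

lemma moment_kernel_injective:
  assumes \<epsilon>: "\<epsilon> > 0" and g: "g \<in> l2" and K: "kernel_op (moment_kernel \<epsilon> d) g = 0" and n: "n \<ge> d"
  shows "g n = 0"
proof -
  define g' where "g' = (\<lambda>n. if n < d then 0 else g n)"
  have "g' \<in> l2"
    unfolding l2_iff
  proof (rule summable_comparison_test')
    show "summable (\<lambda>n. (cmod (g n))\<^sup>2)"
      using g by (simp add: l2_iff)
  qed (simp add: g'_def)
  have "(\<Sum>n. g' n * complex_of_real ((1/2)^Suc m) ^ n) = 0" for m
  proof -
    have eq: "complex_of_real (moment_kernel \<epsilon> d m n) * g n
        = complex_of_real \<epsilon> * (complex_of_real ((1/2)^(Suc m * Suc n)) * g' n)" for n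
      by (simp add: moment_kernel_def g'_def del: mult_Suc mult_Suc_right power_Suc)
    have "0 = (\<Sum>n. complex_of_real \<epsilon> * (complex_of_real ((1/2)^(Suc m * Suc n)) * g' n))"
      using fun_cong[OF K, of m] by (simp only: kernel_op_def eq zero_fun_apply)
    also have "\<dots> = complex_of_real \<epsilon> * (\<Sum>n. complex_of_real ((1/2)^(Suc m * Suc n)) * g' n)"
      using kernel_summable[OF dyadic_moment[of 1 0] \<open>g' \<in> l2\<close>, of m]
      by (intro suminf_mult) (simp add: moment_kernel_def)
    also have "\<dots> = complex_of_real \<epsilon> * (complex_of_real ((1/2)^Suc m)
        * (\<Sum>n. g' n * complex_of_real ((1/2)^Suc m) ^ n))"
      by (simp only: moment_sum[OF \<open>g' \<in> l2\<close>])
    finally show ?thesis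
      using \<epsilon> by simp
  qed
  then have "g' = 0"
    by (intro bounded_power_series_eq_0[OF norm_coordinate_le[OF \<open>g' \<in> l2\<close>]] exI[of _ 0]) simp
  then have "g' n = 0"
    by simp
  then show ?thesis
    using n by (simp add: g'_def)
qed

context
  fixes \<epsilon> :: real and d :: nat
  assumes \<epsilon>: "\<epsilon> > 0"
begin

interpretation sectorial_model moment_weight "kernel_op (moment_kernel \<epsilon> d)"
    "kernel_op (\<lambda>m n. moment_kernel \<epsilon> d n m)" "4 * \<epsilon>"
  by (rule moment_sectorial[OF \<epsilon>])

lemma moment_kernel_eq_0: "k \<in> ker\<Gamma> \<Longrightarrow> n \<ge> d \<Longrightarrow> k n = 0"
  using moment_kernel_injective[OF \<epsilon> R_l2] by (auto simp: kernel_eq diag_def)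

lemma case_III_moment: "d = 1 \<Longrightarrow> Im z > 0 \<Longrightarrow> case_III KK (TT z)"
proof (rule case_III_TT[of "unit 0" 1])
  assume d: "d = 1"
  have R0: "R (unit 0) = unit 0"
    by (auto simp: diag_def unit_def moment_weight_def fun_eq_iff)
  have "kernel_op (moment_kernel \<epsilon> d) (unit 0) = 0"
    by (simp add: fun_eq_iff kernel_op_unit moment_kernel_def d)
  then show "unit 0 \<in> ker\<Gamma>"
    unfolding kernel_eq by (intro CollectI exI[of _ "unit 0"]) (simp add: R0)
  show "unit 0 \<noteq> 0"
    by (metis unit_def zero_fun_apply zero_neq_one)
  show "k 1 = 0" if "k \<in> ker\<Gamma>" for k
    using moment_kernel_eq_0[OF that] d by simp
qed

lemma case_IV_moment: "d = 0 \<Longrightarrow> Im z > 0 \<Longrightarrow> case_IV KK (TT z)"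
proof (rule case_IV_TT)
  assume "d = 0"
  then have "k = 0" if "k \<in> ker\<Gamma>" for k
    using moment_kernel_eq_0[OF that] by (simp add: fun_eq_iff)
  then show "ker\<Gamma> = {0}"
    using complex_vector.subspace_0[OF kernel_subspace] by blast
qed

end

lemma sectorial_example:
  assumes "C \<in> {case_I, case_II, case_III, case_IV}" and \<alpha>: "0 < \<alpha>" "\<alpha> < pi/2"
  shows "\<exists>(H :: (nat \<Rightarrow> complex) ip_space) T (E :: (nat \<Rightarrow> complex) ip_space) \<Gamma>. admissible H T E \<Gamma> \<and>
    (\<forall>z\<in>\<complex>\<^sub>+. C (H \<oplus>\<^sub>H E) (assoc_op T \<Gamma> z)) \<and>
    (\<forall>z. Arg z \<in> {0<..<pi - \<alpha>} \<longrightarrow> nonnegative_operator (H \<oplus>\<^sub>H E) (assoc_op T \<Gamma> z))"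
proof -
  have t: "tan \<alpha> > 0"
    using \<alpha> by (intro tan_gt_zero)
  \<comment> \<open>The operator norms are at most \<open>8 \<epsilon>\<close> for the block kernel and \<open>4 \<epsilon>\<close> for the moment kernel.\<close>
  define \<epsilon> where "\<epsilon> = sqrt (tan \<alpha>) / 8"
  have \<epsilon>: "\<epsilon> > 0" and e1: "(4 * (2 * \<epsilon>))\<^sup>2 \<le> tan \<alpha>" and e2: "(4 * \<epsilon>)\<^sup>2 \<le> tan \<alpha>"
    using t by (simp_all add: \<epsilon>_def power_mult_distrib power_divide)
  consider "C = case_I" | "C = case_II" | "C = case_III" | "C = case_IV"
    using assms(1) by blast
  then show ?thesis
  proof cases
    case 1
    show ?thesis
      unfolding 1 by (rule sectorial_model.realizes[OF block_sectorial[OF \<epsilon>, where s = False] \<alpha> e1])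
        (rule case_I_block[OF \<epsilon>]; simp)
  next
    case 2
    show ?thesis
      unfolding 2 by (rule sectorial_model.realizes[OF block_sectorial[OF \<epsilon>, where s = True] \<alpha> e1])
        (rule case_II_block[OF \<epsilon>]; simp)
  next
    case 3
    show ?thesis
      unfolding 3 by (rule sectorial_model.realizes[OF moment_sectorial[OF \<epsilon>, where d = 1] \<alpha> e2])
        (rule case_III_moment[OF \<epsilon>]; simp)
  next
    case 4
    show ?thesis
      unfolding 4 by (rule sectorial_model.realizes[OF moment_sectorial[OF \<epsilon>, where d = 0] \<alpha> e2])
        (rule case_IV_moment[OF \<epsilon>]; simp)
  qed
qed

theorem theorem9p1:
  fixes C :: "((nat \<Rightarrow> complex) \<times> (nat \<Rightarrow> complex)) ip_space \<Rightarrow>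
      ((nat \<Rightarrow> complex) \<times> (nat \<Rightarrow> complex), (nat \<Rightarrow> complex) \<times> (nat \<Rightarrow> complex)) operator \<Rightarrow> bool"
  assumes "C \<in> {case_I, case_II, case_III, case_IV}"
  shows "(\<exists>H T E \<Gamma>. admissible H T E \<Gamma> \<and>
            (\<forall>z\<in>\<complex>\<^sub>+. C (H \<oplus>\<^sub>H E) (assoc_op T \<Gamma> z)))
       \<and> (\<forall>\<alpha>\<in>{0<..<pi/2}.
            \<exists>H T E \<Gamma>. admissible H T E \<Gamma> \<and>
              (\<forall>z\<in>\<complex>\<^sub>+. C (H \<oplus>\<^sub>H E) (assoc_op T \<Gamma> z)) \<and>
              (\<forall>z. Arg z \<in> {0<..<pi - \<alpha>} \<longrightarrow>
                 nonnegative_operator (H \<oplus>\<^sub>H E) (assoc_op T \<Gamma> z)))"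
proof (intro conjI ballI)
  show "\<exists>H T E \<Gamma>. admissible H T E \<Gamma> \<and> (\<forall>z\<in>\<complex>\<^sub>+. C (H \<oplus>\<^sub>H E) (assoc_op T \<Gamma> z))"
    using sectorial_example[OF assms, of "pi/4"] by auto
qed (use sectorial_example[OF assms] in auto)

end
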